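(* Let $R$ and $A$ be Artin algebras, let $\iota: R\to A$ be a Frobenius extension, and let $T$ be an additive generator of $\mathrm{mod}(R)$, the category of finitely generated left $R$-modules. Put $S=\operatorname{End}_R(T)$ and $B=\operatorname{End}_A(A\otimes_R T)$. Then the natural homomorphism of endomorphism rings $\rho: S\to B$, $\rho(s)=1_A\otimes s$, is a Frobenius extension.
   Context: All rings are associative with unit; modules are left modules unless otherwise specified. A ring extension $\iota:R\to A$ is a unital ring homomorphism. It is a Frobenius extension if $A$ is finitely generated projective as a left $R$-module and $A\cong\operatorname{Hom}_R(A,R)$ as $A$-$R$-bimodules, where $(af)(x)=f(xa)$ and $(fr)(x)=f(x)r$. For an $R$-module $M$, $\operatorname{add}_R(M)$ is the class of direct summands of finite direct sums of copies of $M$. A finitely generated $R$-module $T$ is an additive generator of $\mathrm{mod}(R)$ if $\mathrm{mod}(R)=\operatorname{add}_R(T)$. Endomorphism rings use the right-action convention: for $s_1,s_2\in S$, $t(s_1s_2)=(ts_1)s_2$, i.e. $s_1s_2=s_2\circ s_1$, and similarly for $B$. Explicitly, $(a\otimes t)\rho(s)=a\otimes ts$. *)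

theory Defs
  imports
    "HOL-Algebra.Module"
    "HOL-Algebra.Ideal"
    "HOL-Algebra.AbelCoset"
    "HOL-Algebra.RingHom"
    "HOL-Algebra.Generated_Groups"
    "HOL-Algebra.Free_Abelian_Groups"
begin

section \<open>Left modules over a ring that need not be commutative\<close>

text \<open>
  The locale \<open>module\<close> of the library requires a commutative ring. Only its record type and its
  (commutativity-free) predicate \<open>submodule\<close> are used; the fields \<open>mult\<close> and \<open>one\<close> of a module
  record carry no meaning.
\<close>

locale left_module = R?: ring R + M?: abelian_group M for R (structure) and M (structure) +
  assumes smult_closed [simp, intro]:
      "\<lbrakk>a \<in> carrier R; x \<in> carrier M\<rbrakk> \<Longrightarrow> a \<odot>\<^bsub>M\<^esub> x \<in> carrier M"
    and smult_l_distr: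
      "\<lbrakk>a \<in> carrier R; b \<in> carrier R; x \<in> carrier M\<rbrakk> \<Longrightarrow>
        (a \<oplus>\<^bsub>R\<^esub> b) \<odot>\<^bsub>M\<^esub> x = a \<odot>\<^bsub>M\<^esub> x \<oplus>\<^bsub>M\<^esub> b \<odot>\<^bsub>M\<^esub> x"
    and smult_r_distr:
      "\<lbrakk>a \<in> carrier R; x \<in> carrier M; y \<in> carrier M\<rbrakk> \<Longrightarrow>
        a \<odot>\<^bsub>M\<^esub> (x \<oplus>\<^bsub>M\<^esub> y) = a \<odot>\<^bsub>M\<^esub> x \<oplus>\<^bsub>M\<^esub> a \<odot>\<^bsub>M\<^esub> y"
    and smult_assoc1:
      "\<lbrakk>a \<in> carrier R; b \<in> carrier R; x \<in> carrier M\<rbrakk> \<Longrightarrow>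
        (a \<otimes>\<^bsub>R\<^esub> b) \<odot>\<^bsub>M\<^esub> x = a \<odot>\<^bsub>M\<^esub> (b \<odot>\<^bsub>M\<^esub> x)"
    and smult_one [simp]:
      "x \<in> carrier M \<Longrightarrow> \<one>\<^bsub>R\<^esub> \<odot>\<^bsub>M\<^esub> x = x"

text \<open>Homomorphisms are extensional functions, so that equal homomorphisms are equal functions.\<close>

definition lmod_hom ::
    "('r, 'x) ring_scheme \<Rightarrow> ('r, 'm, 'y) module_scheme \<Rightarrow> ('r, 'n, 'z) module_scheme \<Rightarrow> ('m \<Rightarrow> 'n) set"
  where "lmod_hom R M N =
    {f \<in> carrier M \<rightarrow>\<^sub>E carrier N.
       (\<forall>x\<in>carrier M. \<forall>y\<in>carrier M. f (x \<oplus>\<^bsub>M\<^esub> y) = f x \<oplus>\<^bsub>N\<^esub> f y) \<and>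
       (\<forall>r\<in>carrier R. \<forall>x\<in>carrier M. f (r \<odot>\<^bsub>M\<^esub> x) = r \<odot>\<^bsub>N\<^esub> f x)}"

definition lmod_isomorphic ::
    "('r, 'x) ring_scheme \<Rightarrow> ('r, 'm, 'y) module_scheme \<Rightarrow> ('r, 'n, 'z) module_scheme \<Rightarrow> bool"
  where "lmod_isomorphic R M N \<longleftrightarrow>
    (\<exists>\<phi>\<in>lmod_hom R M N. bij_betw \<phi> (carrier M) (carrier N))"

definition lmod_span :: "('r, 'x) ring_scheme \<Rightarrow> ('r, 'm, 'y) module_scheme \<Rightarrow> 'm set \<Rightarrow> 'm set"
  where "lmod_span R M X = \<Inter>{N. submodule N R M \<and> X \<subseteq> N}"

definition finitely_generated :: "('r, 'x) ring_scheme \<Rightarrow> ('r, 'm, 'y) module_scheme \<Rightarrow> bool"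
  where "finitely_generated R M \<longleftrightarrow>
    (\<exists>X. finite X \<and> X \<subseteq> carrier M \<and> lmod_span R M X = carrier M)"

text \<open>The direct sum of copies of \<open>M\<close> indexed by \<open>I\<close>: families with finite support.\<close>

definition copies ::
    "('r, 'm, 'y) module_scheme \<Rightarrow> 'i set \<Rightarrow> ('r, 'i \<Rightarrow> 'm) module"
  where "copies M I =
    \<lparr>carrier = {f \<in> I \<rightarrow>\<^sub>E carrier M. finite {i \<in> I. f i \<noteq> \<zero>\<^bsub>M\<^esub>}},
     monoid.mult = undefined, monoid.one = undefined,
     ring.zero = (\<lambda>i\<in>I. \<zero>\<^bsub>M\<^esub>),
     ring.add = (\<lambda>f g. \<lambda>i\<in>I. f i \<oplus>\<^bsub>M\<^esub> g i),
     module.smult = (\<lambda>r f. \<lambda>i\<in>I. r \<odot>\<^bsub>M\<^esub> f i)\<rparr>"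

definition direct_summand ::
    "('r, 'x) ring_scheme \<Rightarrow> ('r, 'm, 'y) module_scheme \<Rightarrow> ('r, 'p, 'z) module_scheme \<Rightarrow> bool"
  where "direct_summand R M P \<longleftrightarrow>
    (\<exists>N N'. submodule N R P \<and> submodule N' R P \<and>
       N \<inter> N' = {\<zero>\<^bsub>P\<^esub>} \<and> N <+>\<^bsub>P\<^esub> N' = carrier P \<and>
       lmod_isomorphic R M (P\<lparr>carrier := N\<rparr>))"

text \<open>
  A ring as a left module over another ring, by restriction of scalars along \<open>\<iota>\<close>;
  \<open>\<iota>\<close> the identity gives the regular module.
\<close>

definition ring_as_module :: "('a, 'x) ring_scheme \<Rightarrow> ('r \<Rightarrow> 'a) \<Rightarrow> ('r, 'a) module"
  where "ring_as_module A \<iota> =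
    \<lparr>carrier = carrier A, monoid.mult = monoid.mult A, monoid.one = \<one>\<^bsub>A\<^esub>,
     ring.zero = \<zero>\<^bsub>A\<^esub>, ring.add = ring.add A,
     module.smult = (\<lambda>r x. \<iota> r \<otimes>\<^bsub>A\<^esub> x)\<rparr>"

abbreviation regular_module :: "('r, 'x) ring_scheme \<Rightarrow> ('r, 'r) module"
  where "regular_module R \<equiv> ring_as_module R (\<lambda>r. r)"

text \<open>
  Projective: a direct summand of a free module. Bases may be taken inside the type \<open>'m\<close>, because
  a direct summand \<open>M\<close> of any free module is also one of the free module on \<open>carrier M\<close>.
\<close>

definition projective_module :: "('r, 'x) ring_scheme \<Rightarrow> ('r, 'm, 'y) module_scheme \<Rightarrow> bool"
  where "projective_module R M \<longleftrightarrow>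
    left_module R M \<and> (\<exists>X :: 'm set. direct_summand R M (copies (regular_module R) X))"


section \<open>Artin algebras\<close>

definition comm_artinian_ring :: "('k, 'x) ring_scheme \<Rightarrow> bool"
  where "comm_artinian_ring K \<longleftrightarrow> cring K \<and>
    (\<forall>I :: nat \<Rightarrow> 'k set. (\<forall>n. ideal (I n) K \<and> I (Suc n) \<subseteq> I n) \<longrightarrow> (\<exists>n. \<forall>m\<ge>n. I m = I n))"

text \<open>
  \<open>\<kappa> : K \<rightarrow> \<Lambda>\<close> exhibits \<open>\<Lambda>\<close> as an algebra over the commutative artinian ring \<open>K\<close>,
  finitely generated as a \<open>K\<close>-module.
\<close>

definition artin_algebra :: "('k, 'x) ring_scheme \<Rightarrow> ('k \<Rightarrow> 'a) \<Rightarrow> ('a, 'y) ring_scheme \<Rightarrow> bool"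
  where "artin_algebra K \<kappa> \<Lambda> \<longleftrightarrow>
    comm_artinian_ring K \<and> ring \<Lambda> \<and> \<kappa> \<in> ring_hom K \<Lambda> \<and>
    (\<forall>c\<in>carrier K. \<forall>x\<in>carrier \<Lambda>. \<kappa> c \<otimes>\<^bsub>\<Lambda>\<^esub> x = x \<otimes>\<^bsub>\<Lambda>\<^esub> \<kappa> c) \<and>
    finitely_generated K (ring_as_module \<Lambda> \<kappa>)"


section \<open>Frobenius extensions\<close>

text \<open>Left scalars in \<open>'a\<close>, right scalars in \<open>'r\<close>.\<close>

record ('a, 'r, 'm) bimodule = "('a, 'm) module" +
  rsmult :: "'m \<Rightarrow> 'r \<Rightarrow> 'm"

definition bimodule_isomorphic ::
    "('a, 'x) ring_scheme \<Rightarrow> ('r, 'y) ring_scheme \<Rightarrow>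
     ('a, 'r, 'm) bimodule \<Rightarrow> ('a, 'r, 'n) bimodule \<Rightarrow> bool"
  where "bimodule_isomorphic A R M N \<longleftrightarrow>
    (\<exists>\<phi>\<in>lmod_hom A M N. bij_betw \<phi> (carrier M) (carrier N) \<and>
       (\<forall>x\<in>carrier M. \<forall>r\<in>carrier R. \<phi> (rsmult M x r) = rsmult N (\<phi> x) r))"

definition ring_as_bimodule :: "('a, 'x) ring_scheme \<Rightarrow> ('r \<Rightarrow> 'a) \<Rightarrow> ('a, 'r, 'a) bimodule"
  where "ring_as_bimodule A \<iota> =
    \<lparr>carrier = carrier A, monoid.mult = monoid.mult A, monoid.one = \<one>\<^bsub>A\<^esub>,
     ring.zero = \<zero>\<^bsub>A\<^esub>, ring.add = ring.add A,
     module.smult = monoid.mult A,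
     rsmult = (\<lambda>x r. x \<otimes>\<^bsub>A\<^esub> \<iota> r)\<rparr>"

text \<open>\<open>Hom\<^sub>R(A, R)\<close> with \<open>(a f)(x) = f (x a)\<close> and \<open>(f r)(x) = f(x) r\<close>.\<close>

definition dual_bimodule ::
    "('r, 'x) ring_scheme \<Rightarrow> ('a, 'y) ring_scheme \<Rightarrow> ('r \<Rightarrow> 'a) \<Rightarrow> ('a, 'r, 'a \<Rightarrow> 'r) bimodule"
  where "dual_bimodule R A \<iota> =
    \<lparr>carrier = lmod_hom R (ring_as_module A \<iota>) (regular_module R),
     monoid.mult = undefined, monoid.one = undefined,
     ring.zero = (\<lambda>x\<in>carrier A. \<zero>\<^bsub>R\<^esub>),
     ring.add = (\<lambda>f g. \<lambda>x\<in>carrier A. f x \<oplus>\<^bsub>R\<^esub> g x),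
     module.smult = (\<lambda>a f. \<lambda>x\<in>carrier A. f (x \<otimes>\<^bsub>A\<^esub> a)),
     rsmult = (\<lambda>f r. \<lambda>x\<in>carrier A. f x \<otimes>\<^bsub>R\<^esub> r)\<rparr>"

definition frobenius_extension ::
    "('r, 'x) ring_scheme \<Rightarrow> ('a, 'y) ring_scheme \<Rightarrow> ('r \<Rightarrow> 'a) \<Rightarrow> bool"
  where "frobenius_extension R A \<iota> \<longleftrightarrow>
    ring R \<and> ring A \<and> \<iota> \<in> ring_hom R A \<and>
    finitely_generated R (ring_as_module A \<iota>) \<and> projective_module R (ring_as_module A \<iota>) \<and>
    bimodule_isomorphic A R (ring_as_bimodule A \<iota>) (dual_bimodule R A \<iota>)"


section \<open>Additive generators\<close>

definition fin_gen_module :: "('r, 'x) ring_scheme \<Rightarrow> ('r, 'm, 'y) module_scheme \<Rightarrow> bool"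
  where "fin_gen_module R M \<longleftrightarrow> left_module R M \<and> finitely_generated R M"

definition in_add ::
    "('r, 'x) ring_scheme \<Rightarrow> ('r, 't, 'y) module_scheme \<Rightarrow> ('r, 'm, 'z) module_scheme \<Rightarrow> bool"
  where "in_add R T M \<longleftrightarrow>
    left_module R M \<and> (\<exists>n::nat. direct_summand R M (copies T {..<n}))"

text \<open>
  Both classes of modules are closed under isomorphism, and every finitely generated module is
  isomorphic to a quotient of some \<open>R\<^sup>n\<close>, whose elements are cosets, that is, sets of functions
  from \<open>{..<n}\<close> to \<open>R\<close>. Hence modules with elements in \<open>(nat \<Rightarrow> 'r) set\<close> represent all of \<open>mod(R)\<close>.
\<close>

definition additive_generator :: "('r, 'x) ring_scheme \<Rightarrow> ('r, 't, 'y) module_scheme \<Rightarrow> bool"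
  where "additive_generator R T \<longleftrightarrow> fin_gen_module R T \<and>
    (\<forall>M :: ('r, (nat \<Rightarrow> 'r) set) module. fin_gen_module R M \<longleftrightarrow> in_add R T M)"


section \<open>Endomorphism rings\<close>

text \<open>Endomorphisms act on the right, so the product \<open>s\<^sub>1 s\<^sub>2\<close> is \<open>s\<^sub>2 \<circ> s\<^sub>1\<close>.\<close>

definition End_ring :: "('r, 'x) ring_scheme \<Rightarrow> ('r, 'm, 'y) module_scheme \<Rightarrow> ('m \<Rightarrow> 'm) ring"
  where "End_ring R M =
    \<lparr>carrier = lmod_hom R M M,
     monoid.mult = (\<lambda>s\<^sub>1 s\<^sub>2. compose (carrier M) s\<^sub>2 s\<^sub>1),
     monoid.one = (\<lambda>x\<in>carrier M. x),
     ring.zero = (\<lambda>x\<in>carrier M. \<zero>\<^bsub>M\<^esub>),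
     ring.add = (\<lambda>f g. \<lambda>x\<in>carrier M. f x \<oplus>\<^bsub>M\<^esub> g x)\<rparr>"


section \<open>The induced module \<open>A \<otimes>\<^sub>R T\<close>\<close>

text \<open>
  \<open>A \<otimes>\<^sub>R T\<close> is the quotient of the free abelian group on pairs by the subgroup generated by the
  bilinearity and balancing relations; \<open>A\<close> is a right \<open>R\<close>-module along \<open>\<iota>\<close>.
\<close>

abbreviation tensor_pairs ::
    "('a, 'y) ring_scheme \<Rightarrow> ('r, 't, 'z) module_scheme \<Rightarrow> ('a \<times> 't \<Rightarrow>\<^sub>0 int) monoid"
  where "tensor_pairs A T \<equiv> free_Abelian_group (carrier A \<times> carrier T)"

definition tensor_relations ::
    "('r, 'x) ring_scheme \<Rightarrow> ('a, 'y) ring_scheme \<Rightarrow> ('r \<Rightarrow> 'a) \<Rightarrow> ('r, 't, 'z) module_scheme \<Rightarrow>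
     ('a \<times> 't \<Rightarrow>\<^sub>0 int) set"
  where "tensor_relations R A \<iota> T =
    {frag_of (a \<oplus>\<^bsub>A\<^esub> a', t) - frag_of (a, t) - frag_of (a', t) | a a' t.
       a \<in> carrier A \<and> a' \<in> carrier A \<and> t \<in> carrier T} \<union>
    {frag_of (a, t \<oplus>\<^bsub>T\<^esub> t') - frag_of (a, t) - frag_of (a, t') | a t t'.
       a \<in> carrier A \<and> t \<in> carrier T \<and> t' \<in> carrier T} \<union>
    {frag_of (a \<otimes>\<^bsub>A\<^esub> \<iota> r, t) - frag_of (a, r \<odot>\<^bsub>T\<^esub> t) | a r t.
       a \<in> carrier A \<and> r \<in> carrier R \<and> t \<in> carrier T}"

definition tensor_null ::
    "('r, 'x) ring_scheme \<Rightarrow> ('a, 'y) ring_scheme \<Rightarrow> ('r \<Rightarrow> 'a) \<Rightarrow> ('r, 't, 'z) module_scheme \<Rightarrow>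
     ('a \<times> 't \<Rightarrow>\<^sub>0 int) set"
  where "tensor_null R A \<iota> T = generate (tensor_pairs A T) (tensor_relations R A \<iota> T)"

definition pure_tensor ::
    "('r, 'x) ring_scheme \<Rightarrow> ('a, 'y) ring_scheme \<Rightarrow> ('r \<Rightarrow> 'a) \<Rightarrow> ('r, 't, 'z) module_scheme \<Rightarrow>
     'a \<Rightarrow> 't \<Rightarrow> ('a \<times> 't \<Rightarrow>\<^sub>0 int) set"
  where "pure_tensor R A \<iota> T a t = tensor_null R A \<iota> T #>\<^bsub>tensor_pairs A T\<^esub> frag_of (a, t)"

text \<open>
  The map \<open>g \<otimes> h\<close> on cosets. The image of a coset under the map induced on pairs is only contained
  in a coset; adding \<open>tensor_null\<close> completes it.
\<close>

definition tensor_map ::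
    "('r, 'x) ring_scheme \<Rightarrow> ('a, 'y) ring_scheme \<Rightarrow> ('r \<Rightarrow> 'a) \<Rightarrow> ('r, 't, 'z) module_scheme \<Rightarrow>
     ('a \<Rightarrow> 'a) \<Rightarrow> ('t \<Rightarrow> 't) \<Rightarrow> ('a \<times> 't \<Rightarrow>\<^sub>0 int) set \<Rightarrow> ('a \<times> 't \<Rightarrow>\<^sub>0 int) set"
  where "tensor_map R A \<iota> T g h C =
    tensor_null R A \<iota> T <#>\<^bsub>tensor_pairs A T\<^esub>
      (frag_extend (\<lambda>(a, t). frag_of (g a, h t)) ` C)"

definition induced_module ::
    "('r, 'x) ring_scheme \<Rightarrow> ('a, 'y) ring_scheme \<Rightarrow> ('r \<Rightarrow> 'a) \<Rightarrow> ('r, 't, 'z) module_scheme \<Rightarrow>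
     ('a, ('a \<times> 't \<Rightarrow>\<^sub>0 int) set) module"
  where "induced_module R A \<iota> T =
    (let Q = tensor_pairs A T Mod tensor_null R A \<iota> T in
      \<lparr>carrier = carrier Q, monoid.mult = undefined, monoid.one = undefined,
       ring.zero = \<one>\<^bsub>Q\<^esub>, ring.add = monoid.mult Q,
       module.smult = (\<lambda>a. tensor_map R A \<iota> T (\<lambda>a'. a \<otimes>\<^bsub>A\<^esub> a') (\<lambda>t. t))\<rparr>)"

definition induced_End ::
    "('r, 'x) ring_scheme \<Rightarrow> ('a, 'y) ring_scheme \<Rightarrow> ('r \<Rightarrow> 'a) \<Rightarrow> ('r, 't, 'z) module_scheme \<Rightarrow>
     ('t \<Rightarrow> 't) \<Rightarrow> (('a \<times> 't \<Rightarrow>\<^sub>0 int) set \<Rightarrow> ('a \<times> 't \<Rightarrow>\<^sub>0 int) set)"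
  where "induced_End R A \<iota> T s =
    (\<lambda>C\<in>carrier (induced_module R A \<iota> T). tensor_map R A \<iota> T (\<lambda>a. a) s C)"

text \<open>
  The defining formulas \<open>a'(a \<otimes> t) = a'a \<otimes> t\<close> and \<open>(a \<otimes> t)\<rho>(s) = a \<otimes> ts\<close> on pure tensors.
\<close>

lemma tensor_relations_subset:
  assumes "ring A" "left_module R T" "\<iota> \<in> ring_hom R A"
  shows "tensor_relations R A \<iota> T \<subseteq> carrier (tensor_pairs A T)"
proof -
  interpret A: ring A by fact
  interpret T: left_module R T by fact
  note \<iota> = ring_hom_closed[OF assms(3)]
  have of: "frag_of (a, t) \<in> carrier (tensor_pairs A T)" if "a \<in> carrier A" "t \<in> carrier T" for a t
    using that by simp
  have diff: "x - y \<in> carrier (tensor_pairs A T)"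
    if "x \<in> carrier (tensor_pairs A T)" "y \<in> carrier (tensor_pairs A T)" for x y
    using that keys_diff[of x y] by (auto simp: free_Abelian_group_def)
  show ?thesis
    unfolding tensor_relations_def by (auto intro!: diff of \<iota>)
qed

lemma tensor_map_pure_tensor:
  assumes "ring A" "left_module R T" "\<iota> \<in> ring_hom R A"
    and g: "g \<in> carrier A \<rightarrow> carrier A"
      "\<And>a b. a \<in> carrier A \<Longrightarrow> b \<in> carrier A \<Longrightarrow> g (a \<oplus>\<^bsub>A\<^esub> b) = g a \<oplus>\<^bsub>A\<^esub> g b"
      "\<And>a r. a \<in> carrier A \<Longrightarrow> r \<in> carrier R \<Longrightarrow> g (a \<otimes>\<^bsub>A\<^esub> \<iota> r) = g a \<otimes>\<^bsub>A\<^esub> \<iota> r"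
    and h: "h \<in> carrier T \<rightarrow> carrier T"
      "\<And>t u. t \<in> carrier T \<Longrightarrow> u \<in> carrier T \<Longrightarrow> h (t \<oplus>\<^bsub>T\<^esub> u) = h t \<oplus>\<^bsub>T\<^esub> h u"
      "\<And>r t. r \<in> carrier R \<Longrightarrow> t \<in> carrier T \<Longrightarrow> h (r \<odot>\<^bsub>T\<^esub> t) = r \<odot>\<^bsub>T\<^esub> h t"
    and at: "a \<in> carrier A" "t \<in> carrier T"
  shows "tensor_map R A \<iota> T g h (pure_tensor R A \<iota> T a t) = pure_tensor R A \<iota> T (g a) (h t)"
proof -
  let ?G = "tensor_pairs A T"
  let ?N = "tensor_null R A \<iota> T"
  let ?F = "frag_extend (\<lambda>(a, t). frag_of (g a, h t))"
  interpret A: ring A by fact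
  interpret T: left_module R T by fact
  note rel = tensor_relations_subset[OF assms(1-3)]
  have F_rel: "?F x \<in> tensor_relations R A \<iota> T" if "x \<in> tensor_relations R A \<iota> T" for x
    using that unfolding tensor_relations_def
  proof (elim UnE CollectE exE conjE, goal_cases)
    case (1 a a' t)
    then show ?case
      by (intro UnI1 CollectI exI[of _ "g a"] exI[of _ "g a'"] exI[of _ "h t"])
        (use g h in \<open>auto simp: frag_extend_diff\<close>)
  next
    case (2 a t t')
    then show ?case
      by (intro UnI1[OF UnI2] CollectI exI[of _ "g a"] exI[of _ "h t"] exI[of _ "h t'"])
        (use g h in \<open>auto simp: frag_extend_diff\<close>)
  next
    case (3 a r t)
    then show ?case
      by (intro UnI2 CollectI exI[of _ "g a"] exI[of _ r] exI[of _ "h t"])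
        (use g h in \<open>auto simp: frag_extend_diff\<close>)
  qed
  have F_null: "?F x \<in> ?N" if "x \<in> ?N" for x
    using that unfolding tensor_null_def
  proof (induction rule: generate.induct)
    case one
    then show ?case by (metis generate.one frag_extend_0 one_free_Abelian_group)
  next
    case (incl x)
    then show ?case by (simp add: F_rel generate.incl)
  next
    case (inv x)
    then have "inv\<^bsub>?G\<^esub> ?F x \<in> generate ?G (tensor_relations R A \<iota> T)"
      by (simp add: F_rel generate.inv)
    moreover have "x \<in> carrier ?G" "?F x \<in> carrier ?G"
      using inv rel F_rel by blast+
    ultimately show ?case by (simp add: frag_extend_minus)
  next
    case (eng x y)
    then show ?case using generate.eng by (fastforce simp: frag_extend_add)
  qed
  have zero: "0 \<in> ?N" unfolding tensor_null_def
    by (metis generate.one one_free_Abelian_group)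
  have add: "x + y \<in> ?N" if "x \<in> ?N" "y \<in> ?N" for x y
    using that generate.eng unfolding tensor_null_def by fastforce
  have of: "?F (n + frag_of (a, t)) = ?F n + frag_of (g a, h t)" for n
    by (simp add: frag_extend_add)
  show ?thesis
  proof (intro equalityI subsetI)
    fix x assume "x \<in> tensor_map R A \<iota> T g h (pure_tensor R A \<iota> T a t)"
    then obtain m n where "m \<in> ?N" "n \<in> ?N" "x = m + (?F n + frag_of (g a, h t))"
      unfolding tensor_map_def pure_tensor_def set_mult_def r_coset_def by (auto simp: of)
    moreover from this have "x = (m + ?F n) + frag_of (g a, h t)"
      by (simp add: add.assoc)
    ultimately show "x \<in> pure_tensor R A \<iota> T (g a) (h t)"
      using add F_null unfolding pure_tensor_def r_coset_def by auto
  next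
    fix x assume "x \<in> pure_tensor R A \<iota> T (g a) (h t)"
    then obtain m where m: "m \<in> ?N" "x = m + frag_of (g a, h t)"
      unfolding pure_tensor_def r_coset_def by auto
    then have "x = m + ?F (0 + frag_of (a, t))" by (simp add: of)
    moreover have "0 + frag_of (a, t) \<in> pure_tensor R A \<iota> T a t"
      using zero unfolding pure_tensor_def r_coset_def by force
    ultimately show "x \<in> tensor_map R A \<iota> T g h (pure_tensor R A \<iota> T a t)"
      using m(1) unfolding tensor_map_def set_mult_def mult_free_Abelian_group by blast
  qed
qed

lemma induced_module_smult_pure_tensor:
  assumes "ring A" "left_module R T" "\<iota> \<in> ring_hom R A"
    and "a' \<in> carrier A" "a \<in> carrier A" "t \<in> carrier T"
  shows "a' \<odot>\<^bsub>induced_module R A \<iota> T\<^esub> pure_tensor R A \<iota> T a t =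
    pure_tensor R A \<iota> T (a' \<otimes>\<^bsub>A\<^esub> a) t"
proof -
  interpret A: ring A by fact
  show ?thesis
    using tensor_map_pure_tensor[OF assms(1-3), of "\<lambda>x. a' \<otimes>\<^bsub>A\<^esub> x" "\<lambda>t. t" a t]
      assms ring_hom_closed[OF assms(3)]
    by (simp add: induced_module_def Let_def A.r_distr A.m_assoc)
qed

lemma induced_End_pure_tensor:
  assumes "ring A" "left_module R T" "\<iota> \<in> ring_hom R A"
    and "s \<in> lmod_hom R T T" "a \<in> carrier A" "t \<in> carrier T"
  shows "induced_End R A \<iota> T s (pure_tensor R A \<iota> T a t) = pure_tensor R A \<iota> T a (s t)"
proof -
  have "pure_tensor R A \<iota> T a t \<in> carrier (induced_module R A \<iota> T)"
    using assms(5,6)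
    by (auto simp: induced_module_def Let_def pure_tensor_def FactGroup_def RCOSETS_def)
  then show ?thesis
    using tensor_map_pure_tensor[OF assms(1-3), of "\<lambda>a. a" s a t] assms(4-)
    by (auto simp: induced_End_def lmod_hom_def)
qed

end

theory Submission
  imports Defs
begin

text \<open>
  A ring extension \<open>R \<rightarrow> A\<close> is Frobenius iff it has a Frobenius system: an \<open>R\<close>-\<open>R\<close>-bilinear
  map \<open>E : A \<rightarrow> R\<close> and finite families \<open>a\<^sub>i, b\<^sub>i\<close> with
  \<open>x = \<Sum> E(x b\<^sub>i) a\<^sub>i = \<Sum> b\<^sub>i E(a\<^sub>i x)\<close>. Put \<open>M = A \<otimes>\<^sub>R T\<close> and \<open>\<epsilon> : M \<rightarrow> T\<close>, \<open>\<epsilon>(a \<otimes> t) = E(a) t\<close>.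
  As an \<open>R\<close>-module \<open>M\<close> is finitely generated, so it lies in \<open>add(T)\<close>, which gives maps
  \<open>p\<^sub>j : T \<rightarrow> M\<close> and \<open>q\<^sub>j : M \<rightarrow> T\<close> with \<open>\<Sum> p\<^sub>j \<circ> q\<^sub>j = id\<close>. Then \<open>E\<^sub>B(\<beta>)(t) = \<epsilon>(\<beta>(1 \<otimes> t))\<close>,
  \<open>x\<^sub>j(a \<otimes> t) = a p\<^sub>j(t)\<close> and \<open>y\<^sub>j(w) = \<Sum>\<^sub>i b\<^sub>i \<otimes> q\<^sub>j(a\<^sub>i w)\<close> form a Frobenius system of
  \<open>End\<^sub>R(T) \<rightarrow> End\<^sub>A(M)\<close>.
\<close>

section \<open>Additive maps and finite sums\<close>

text \<open>The formulas come from two descriptions of \<open>B\<close>. By the tensor-hom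
  adjunction an \<open>A\<close>-endomorphism \<beta> of \<open>M\<close> amounts to the
  \<open>R\<close>-map \<open>t \<mapsto> \<beta> (1 \<otimes> t)\<close> from \<open>T\<close> to
  \<open>M\<close>. Since \<open>A\<close> is Frobenius over \<open>R\<close>, \<open>M\<close> is
  also the coinduced module Hom_R(A, T), so \<beta> amounts equally to the \<open>R\<close>-map
  \<epsilon> \<circ> \<beta> from \<open>M\<close> to \<open>T\<close>. In the first description
  \<open>x j\<close> is \<open>p j\<close>; in the second \<open>y j\<close> is \<open>q j\<close>.
  As \<open>M\<close> is a summand of a finite power of \<open>T\<close>, Hom_R(T, M) is a summand
  of a finite power of \<open>S\<close>, whence the dual basis, and Hom_R(M, T) is its dual over
  \<open>S\<close>. Two obstacles shape the text. The hypothesis on \<open>T\<close> speaks only of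
  modules with elements in one fixed type, so \<open>M\<close> is reached through an isomorphic
  copy. The elements of \<open>M\<close> are cosets in a free abelian group, so identities between
  maps on \<open>M\<close> are reduced to additivity and a check on pure tensors.\<close>

lemma additive_zero:
  assumes "abelian_group G" "abelian_group H" "f \<in> hom (add_monoid G) (add_monoid H)"
  shows "f \<zero>\<^bsub>G\<^esub> = \<zero>\<^bsub>H\<^esub>"
  using hom_one[OF assms(3)] assms(1,2) by (simp add: abelian_group.a_group)

lemma additive_minus:
  assumes "abelian_group G" "abelian_group H" "f \<in> hom (add_monoid G) (add_monoid H)"
    and "x \<in> carrier G"
  shows "f (\<ominus>\<^bsub>G\<^esub> x) = \<ominus>\<^bsub>H\<^esub> f x"
  using group_hom.hom_inv[of "add_monoid G" "add_monoid H" f x] assms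
  by (simp add: group_hom_def group_hom_axioms_def abelian_group.a_group a_inv_def)

lemma additiveD:
  assumes "f \<in> hom (add_monoid G) (add_monoid H)"
  shows "x \<in> carrier G \<Longrightarrow> f x \<in> carrier H"
    and "\<lbrakk>x \<in> carrier G; y \<in> carrier G\<rbrakk> \<Longrightarrow> f (x \<oplus>\<^bsub>G\<^esub> y) = f x \<oplus>\<^bsub>H\<^esub> f y"
  using assms by (auto simp: hom_def)

text \<open>Additive maps are taken in \<open>hom\<close> of the additive monoids rather than in
  \<open>lmod_hom\<close>, so that unrestricted terms such as scalar multiplication by a fixed
  element qualify. Over an infinite index set both sums default to zero.\<close>

lemma additive_finsum:
  assumes G: "abelian_group G" and H: "abelian_group H"
    and f: "f \<in> hom (add_monoid G) (add_monoid H)" and g: "g \<in> I \<rightarrow> carrier G"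
  shows "f (\<Oplus>\<^bsub>G\<^esub>i\<in>I. g i) = (\<Oplus>\<^bsub>H\<^esub>i\<in>I. f (g i))"
proof -
  interpret G: abelian_group G by fact
  interpret H: abelian_group H by fact
  note fD = additiveD[OF f]
  show ?thesis
    using g
  proof (induction I rule: infinite_finite_induct)
    case (insert i I)
    then show ?case by (auto simp: fD Pi_iff)
  qed (use additive_zero[OF assms(1-3)] in auto)
qed

lemma additiveI:
  assumes "\<And>x. x \<in> carrier G \<Longrightarrow> f x \<in> carrier H"
    and "\<And>x y. \<lbrakk>x \<in> carrier G; y \<in> carrier G\<rbrakk> \<Longrightarrow> f (x \<oplus>\<^bsub>G\<^esub> y) = f x \<oplus>\<^bsub>H\<^esub> f y"
  shows "f \<in> hom (add_monoid G) (add_monoid H)"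
  using assms by (auto simp: hom_def)

lemma (in abelian_group) additive_of_finsum:
  assumes "\<And>i. i \<in> I \<Longrightarrow> f i \<in> hom (add_monoid H) (add_monoid G)"
  shows "(\<lambda>x. \<Oplus>i\<in>I. f i x) \<in> hom (add_monoid H) (add_monoid G)"
proof (rule additiveI)
  fix x y assume "x \<in> carrier H" "y \<in> carrier H"
  then have "(\<lambda>i. f i x) \<in> I \<rightarrow> carrier G" "(\<lambda>i. f i y) \<in> I \<rightarrow> carrier G"
      "\<And>i. i \<in> I \<Longrightarrow> f i (x \<oplus>\<^bsub>H\<^esub> y) = f i x \<oplus> f i y"
    using assms by (auto dest: additiveD)
  moreover from this have "(\<Oplus>i\<in>I. f i (x \<oplus>\<^bsub>H\<^esub> y)) = (\<Oplus>i\<in>I. f i x \<oplus> f i y)"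
    by (intro finsum_cong') auto
  ultimately show "(\<Oplus>i\<in>I. f i (x \<oplus>\<^bsub>H\<^esub> y)) = (\<Oplus>i\<in>I. f i x) \<oplus> (\<Oplus>i\<in>I. f i y)"
    by (simp add: finsum_addf)
next
  fix x assume "x \<in> carrier H"
  then show "(\<Oplus>i\<in>I. f i x) \<in> carrier G"
    using assms by (auto intro!: finsum_closed dest: additiveD)
qed

lemma (in abelian_group) finsum_swap:
  assumes "finite I" "\<And>i j. \<lbrakk>i \<in> I; j \<in> J\<rbrakk> \<Longrightarrow> f i j \<in> carrier G"
  shows "(\<Oplus>i\<in>I. \<Oplus>j\<in>J. f i j) = (\<Oplus>j\<in>J. \<Oplus>i\<in>I. f i j)"
  using assms
proof (induction I)
  case empty
  then show ?case by simp
next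
  case (insert k I)
  have "(\<Oplus>i\<in>insert k I. \<Oplus>j\<in>J. f i j) = (\<Oplus>j\<in>J. f k j) \<oplus> (\<Oplus>i\<in>I. \<Oplus>j\<in>J. f i j)"
    using insert.hyps insert.prems by (intro finsum_insert) (auto intro!: finsum_closed)
  also have "\<dots> = (\<Oplus>j\<in>J. f k j) \<oplus> (\<Oplus>j\<in>J. \<Oplus>i\<in>I. f i j)"
    using insert by simp
  also have "\<dots> = (\<Oplus>j\<in>J. f k j \<oplus> (\<Oplus>i\<in>I. f i j))"
    using insert.prems by (subst finsum_addf) (auto intro!: finsum_closed)
  also have "\<dots> = (\<Oplus>j\<in>J. \<Oplus>i\<in>insert k I. f i j)"
    using insert.hyps insert.prems by (intro finsum_cong') (auto intro!: finsum_closed)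
  finally show ?case .
qed

text \<open>Serves families with repeated values: a free module indexed by the set of values has one
  coefficient per value, which gathers the terms of a whole fibre.\<close>

lemma (in abelian_group) finsum_fibres:
  assumes "finite I" "f \<in> I \<rightarrow> carrier G"
  shows "(\<Oplus>i\<in>I. f i) = (\<Oplus>x\<in>h ` I. \<Oplus>i\<in>{i \<in> I. h i = x}. f i)"
proof -
  have "I = (\<Union>x\<in>h ` I. {i \<in> I. h i = x})" by auto
  moreover have "finsum G f (\<Union>x\<in>h ` I. {i \<in> I. h i = x}) = (\<Oplus>x\<in>h ` I. \<Oplus>i\<in>{i \<in> I. h i = x}. f i)"
    using assms by (intro add.finprod_UN_disjoint) (auto simp: pairwise_def disjnt_def)
  ultimately show ?thesis by simp
qed

lemma additive_comp:
  "\<lbrakk>f \<in> hom (add_monoid G) (add_monoid H); g \<in> hom (add_monoid H) (add_monoid K)\<rbrakk> \<Longrightarrow>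
    (\<lambda>x. g (f x)) \<in> hom (add_monoid G) (add_monoid K)"
  by (rule additiveI) (auto simp: additiveD)

lemma (in abelian_group) additive_add:
  "\<lbrakk>f \<in> hom (add_monoid H) (add_monoid G); g \<in> hom (add_monoid H) (add_monoid G)\<rbrakk> \<Longrightarrow>
    (\<lambda>x. f x \<oplus> g x) \<in> hom (add_monoid H) (add_monoid G)"
  by (rule additiveI) (auto simp: additiveD a_ac)

lemma additive_id: "(\<lambda>x. x) \<in> hom (add_monoid G) (add_monoid G)"
  by (rule additiveI) auto

section \<open>Left modules and finite generation\<close>

lemma lmod_homI:
  assumes "f \<in> extensional (carrier M)"
    and "\<And>x. x \<in> carrier M \<Longrightarrow> f x \<in> carrier N"
    and "\<And>x y. \<lbrakk>x \<in> carrier M; y \<in> carrier M\<rbrakk> \<Longrightarrow> f (x \<oplus>\<^bsub>M\<^esub> y) = f x \<oplus>\<^bsub>N\<^esub> f y"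
    and "\<And>r x. \<lbrakk>r \<in> carrier R; x \<in> carrier M\<rbrakk> \<Longrightarrow> f (r \<odot>\<^bsub>M\<^esub> x) = r \<odot>\<^bsub>N\<^esub> f x"
  shows "f \<in> lmod_hom R M N"
  using assms by (auto simp: lmod_hom_def PiE_iff)

lemma lmod_homD:
  assumes "f \<in> lmod_hom R M N"
  shows "f \<in> extensional (carrier M)"
    and "x \<in> carrier M \<Longrightarrow> f x \<in> carrier N"
    and "\<lbrakk>x \<in> carrier M; y \<in> carrier M\<rbrakk> \<Longrightarrow> f (x \<oplus>\<^bsub>M\<^esub> y) = f x \<oplus>\<^bsub>N\<^esub> f y"
    and "\<lbrakk>r \<in> carrier R; x \<in> carrier M\<rbrakk> \<Longrightarrow> f (r \<odot>\<^bsub>M\<^esub> x) = r \<odot>\<^bsub>N\<^esub> f x"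
  using assms by (auto simp: lmod_hom_def PiE_iff)

lemma lmod_hom_additive: "f \<in> lmod_hom R M N \<Longrightarrow> f \<in> hom (add_monoid M) (add_monoid N)"
  by (auto intro!: additiveI dest: lmod_homD)

lemma lmod_hom_compose:
  assumes "f \<in> lmod_hom R M N" "g \<in> lmod_hom R N P"
    and "\<And>x y. \<lbrakk>x \<in> carrier M; y \<in> carrier M\<rbrakk> \<Longrightarrow> x \<oplus>\<^bsub>M\<^esub> y \<in> carrier M"
    and "\<And>r x. \<lbrakk>r \<in> carrier R; x \<in> carrier M\<rbrakk> \<Longrightarrow> r \<odot>\<^bsub>M\<^esub> x \<in> carrier M"
  shows "compose (carrier M) g f \<in> lmod_hom R M P"
  using assms by (intro lmod_homI) (auto simp: compose_def lmod_homD)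

lemma left_moduleI:
  assumes "ring R" "abelian_group M"
    and "\<And>a x. \<lbrakk>a \<in> carrier R; x \<in> carrier M\<rbrakk> \<Longrightarrow> a \<odot>\<^bsub>M\<^esub> x \<in> carrier M"
    and "\<And>a b x. \<lbrakk>a \<in> carrier R; b \<in> carrier R; x \<in> carrier M\<rbrakk> \<Longrightarrow>
        (a \<oplus>\<^bsub>R\<^esub> b) \<odot>\<^bsub>M\<^esub> x = a \<odot>\<^bsub>M\<^esub> x \<oplus>\<^bsub>M\<^esub> b \<odot>\<^bsub>M\<^esub> x"
    and "\<And>a x y. \<lbrakk>a \<in> carrier R; x \<in> carrier M; y \<in> carrier M\<rbrakk> \<Longrightarrow>
        a \<odot>\<^bsub>M\<^esub> (x \<oplus>\<^bsub>M\<^esub> y) = a \<odot>\<^bsub>M\<^esub> x \<oplus>\<^bsub>M\<^esub> a \<odot>\<^bsub>M\<^esub> y"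
    and "\<And>a b x. \<lbrakk>a \<in> carrier R; b \<in> carrier R; x \<in> carrier M\<rbrakk> \<Longrightarrow>
        (a \<otimes>\<^bsub>R\<^esub> b) \<odot>\<^bsub>M\<^esub> x = a \<odot>\<^bsub>M\<^esub> (b \<odot>\<^bsub>M\<^esub> x)"
    and "\<And>x. x \<in> carrier M \<Longrightarrow> \<one>\<^bsub>R\<^esub> \<odot>\<^bsub>M\<^esub> x = x"
  shows "left_module R M"
  using assms by (simp add: left_module_def left_module_axioms_def)

context left_module
begin

lemma left_smult_additive:
  "a \<in> carrier R \<Longrightarrow> (\<lambda>x. a \<odot>\<^bsub>M\<^esub> x) \<in> hom (add_monoid M) (add_monoid M)"
  by (auto intro!: additiveI simp: smult_r_distr)

lemma right_smult_additive:
  "x \<in> carrier M \<Longrightarrow> (\<lambda>a. a \<odot>\<^bsub>M\<^esub> x) \<in> hom (add_monoid R) (add_monoid M)"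
  by (auto intro!: additiveI simp: smult_l_distr)

lemmas smult_finsum =
  additive_finsum[OF M.abelian_group_axioms M.abelian_group_axioms left_smult_additive]
lemmas finsum_smult =
  additive_finsum[OF R.is_abelian_group M.abelian_group_axioms right_smult_additive]

lemma smult_l_null [simp]: "x \<in> carrier M \<Longrightarrow> \<zero>\<^bsub>R\<^esub> \<odot>\<^bsub>M\<^esub> x = \<zero>\<^bsub>M\<^esub>"
  by (rule additive_zero[OF R.is_abelian_group M.abelian_group_axioms right_smult_additive])

lemma smult_r_null [simp]: "a \<in> carrier R \<Longrightarrow> a \<odot>\<^bsub>M\<^esub> \<zero>\<^bsub>M\<^esub> = \<zero>\<^bsub>M\<^esub>"
  by (rule additive_zero[OF M.abelian_group_axioms M.abelian_group_axioms left_smult_additive])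

lemma minus_one_smult: "x \<in> carrier M \<Longrightarrow> (\<ominus>\<^bsub>R\<^esub> \<one>\<^bsub>R\<^esub>) \<odot>\<^bsub>M\<^esub> x = \<ominus>\<^bsub>M\<^esub> x"
  using additive_minus[OF R.is_abelian_group M.abelian_group_axioms right_smult_additive, of x "\<one>\<^bsub>R\<^esub>"]
  by simp

text \<open>Closure under negatives, which \<open>submodule\<close> demands, comes from the scalar
  -1.\<close>

lemma submoduleI:
  assumes "H \<subseteq> carrier M" "\<zero>\<^bsub>M\<^esub> \<in> H"
    and "\<And>x y. \<lbrakk>x \<in> H; y \<in> H\<rbrakk> \<Longrightarrow> x \<oplus>\<^bsub>M\<^esub> y \<in> H"
    and smult: "\<And>a x. \<lbrakk>a \<in> carrier R; x \<in> H\<rbrakk> \<Longrightarrow> a \<odot>\<^bsub>M\<^esub> x \<in> H"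
  shows "submodule H R M"
proof -
  have "\<ominus>\<^bsub>M\<^esub> x \<in> H" if "x \<in> H" for x
    using smult[of "\<ominus>\<^bsub>R\<^esub> \<one>\<^bsub>R\<^esub>" x] that assms(1) minus_one_smult by auto
  then show ?thesis
    using assms by (auto intro!: submodule.intro subgroup.intro submodule_axioms.intro simp: a_inv_def)
qed

lemma submoduleD:
  assumes "submodule H R M"
  shows "H \<subseteq> carrier M" "\<zero>\<^bsub>M\<^esub> \<in> H"
    and "\<And>x y. \<lbrakk>x \<in> H; y \<in> H\<rbrakk> \<Longrightarrow> x \<oplus>\<^bsub>M\<^esub> y \<in> H"
    and "\<And>a x. \<lbrakk>a \<in> carrier R; x \<in> H\<rbrakk> \<Longrightarrow> a \<odot>\<^bsub>M\<^esub> x \<in> H"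
    and "\<And>x. x \<in> H \<Longrightarrow> \<ominus>\<^bsub>M\<^esub> x \<in> H"
  using subgroup.subset[OF submodule.axioms(1)[OF assms]]
    subgroup.one_closed[OF submodule.axioms(1)[OF assms]]
    subgroup.m_closed[OF submodule.axioms(1)[OF assms]]
    subgroup.m_inv_closed[OF submodule.axioms(1)[OF assms]]
    submodule.smult_closed[OF assms]
  by (auto simp: a_inv_def)

lemma submodule_finsum_closed:
  assumes "submodule H R M" "f \<in> I \<rightarrow> H"
  shows "(\<Oplus>\<^bsub>M\<^esub>i\<in>I. f i) \<in> H"
  using assms(2)
proof (induction I rule: infinite_finite_induct)
  case (insert i I)
  then have "f \<in> I \<rightarrow> carrier M" "f i \<in> carrier M"
    using submoduleD(1)[OF assms(1)] by auto
  with insert show ?case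
    using submoduleD(3)[OF assms(1)] by auto
qed (use submoduleD(2)[OF assms(1)] in auto)

text \<open>Generation is tested against submodules containing \<open>X\<close>, which suits
  arguments by preimages of submodules. The span stays inside the carrier because the carrier is one
  of the submodules intersected.\<close>

lemma finitely_generatedI:
  assumes "finite X" "X \<subseteq> carrier M"
    and "\<And>N. \<lbrakk>submodule N R M; X \<subseteq> N\<rbrakk> \<Longrightarrow> carrier M \<subseteq> N"
  shows "finitely_generated R M"
proof -
  have "submodule (carrier M) R M" by (rule submoduleI) auto
  then have "lmod_span R M X = carrier M"
    using assms by (auto simp: lmod_span_def)
  with assms show ?thesis by (auto simp: finitely_generated_def)
qed

lemma finitely_generatedE:
  assumes "finitely_generated R M"
  obtains X where "finite X" "X \<subseteq> carrier M"
    "\<forall>N. submodule N R M \<longrightarrow> X \<subseteq> N \<longrightarrow> carrier M \<subseteq> N"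
  using assms unfolding finitely_generated_def lmod_span_def by blast

text \<open>The linear combinations of a generating set form a submodule containing it. The explicit
  coefficients are what later encodes module elements by coordinate vectors.\<close>

lemma finitely_generated_combinations:
  assumes "finitely_generated R M"
  obtains X where "finite X" "X \<subseteq> carrier M"
    "\<And>m. m \<in> carrier M \<Longrightarrow> \<exists>c\<in>X \<rightarrow> carrier R. m = (\<Oplus>\<^bsub>M\<^esub>x\<in>X. c x \<odot>\<^bsub>M\<^esub> x)"
proof -
  obtain X where X: "finite X" "X \<subseteq> carrier M"
    and min: "\<forall>N. submodule N R M \<longrightarrow> X \<subseteq> N \<longrightarrow> carrier M \<subseteq> N"
    by (rule finitely_generatedE[OF assms])
  have XM: "x \<in> carrier M" if "x \<in> X" for x using that X by blast
  let ?N = "{m. \<exists>c\<in>X \<rightarrow> carrier R. m = (\<Oplus>\<^bsub>M\<^esub>x\<in>X. c x \<odot>\<^bsub>M\<^esub> x)}"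
  have "submodule ?N R M"
  proof (rule submoduleI)
    show "?N \<subseteq> carrier M"
      using XM by (fastforce intro!: finsum_closed)
    have "\<zero>\<^bsub>M\<^esub> = (\<Oplus>\<^bsub>M\<^esub>x\<in>X. \<zero>\<^bsub>R\<^esub> \<odot>\<^bsub>M\<^esub> x)"
      using XM by (subst add.finprod_one_eqI) auto
    then show "\<zero>\<^bsub>M\<^esub> \<in> ?N" by (auto intro!: bexI[of _ "\<lambda>_. \<zero>\<^bsub>R\<^esub>"])
  next
    fix m n assume "m \<in> ?N" "n \<in> ?N"
    then obtain c d where c: "c \<in> X \<rightarrow> carrier R" "m = (\<Oplus>\<^bsub>M\<^esub>x\<in>X. c x \<odot>\<^bsub>M\<^esub> x)"
      and d: "d \<in> X \<rightarrow> carrier R" "n = (\<Oplus>\<^bsub>M\<^esub>x\<in>X. d x \<odot>\<^bsub>M\<^esub> x)" by blast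
    have "m \<oplus>\<^bsub>M\<^esub> n = (\<Oplus>\<^bsub>M\<^esub>x\<in>X. c x \<odot>\<^bsub>M\<^esub> x \<oplus>\<^bsub>M\<^esub> d x \<odot>\<^bsub>M\<^esub> x)"
      unfolding c d using c d XM by (subst M.finsum_addf) auto
    also have "\<dots> = (\<Oplus>\<^bsub>M\<^esub>x\<in>X. (c x \<oplus>\<^bsub>R\<^esub> d x) \<odot>\<^bsub>M\<^esub> x)"
      using c d XM by (intro M.finsum_cong') (auto simp: smult_l_distr Pi_iff)
    finally show "m \<oplus>\<^bsub>M\<^esub> n \<in> ?N"
      using c d by (auto intro!: bexI[of _ "\<lambda>x. c x \<oplus>\<^bsub>R\<^esub> d x"])
  next
    fix a m assume a: "a \<in> carrier R" and "m \<in> ?N"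
    then obtain c where c: "c \<in> X \<rightarrow> carrier R" "m = (\<Oplus>\<^bsub>M\<^esub>x\<in>X. c x \<odot>\<^bsub>M\<^esub> x)" by blast
    have "a \<odot>\<^bsub>M\<^esub> m = (\<Oplus>\<^bsub>M\<^esub>x\<in>X. a \<odot>\<^bsub>M\<^esub> (c x \<odot>\<^bsub>M\<^esub> x))"
      unfolding c using c a XM by (subst smult_finsum) auto
    also have "\<dots> = (\<Oplus>\<^bsub>M\<^esub>x\<in>X. (a \<otimes>\<^bsub>R\<^esub> c x) \<odot>\<^bsub>M\<^esub> x)"
      using c a XM by (intro M.finsum_cong') (auto simp: smult_assoc1 Pi_iff)
    finally show "a \<odot>\<^bsub>M\<^esub> m \<in> ?N"
      using c a by (auto intro!: bexI[of _ "\<lambda>x. a \<otimes>\<^bsub>R\<^esub> c x"])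
  qed
  moreover have "X \<subseteq> ?N"
  proof
    fix y assume y: "y \<in> X"
    have "(\<Oplus>\<^bsub>M\<^esub>x\<in>X. (if x = y then \<one>\<^bsub>R\<^esub> else \<zero>\<^bsub>R\<^esub>) \<odot>\<^bsub>M\<^esub> x) = (\<Oplus>\<^bsub>M\<^esub>x\<in>X. if y = x then x else \<zero>\<^bsub>M\<^esub>)"
      using XM by (intro M.finsum_cong') auto
    also have "\<dots> = y"
      using M.finsum_singleton[of y X "\<lambda>x. x"] y X XM by auto
    finally show "y \<in> ?N"
      by (auto intro!: bexI[of _ "\<lambda>x. if x = y then \<one>\<^bsub>R\<^esub> else \<zero>\<^bsub>R\<^esub>"])
  qed
  ultimately have "carrier M \<subseteq> ?N" using min by blast
  then show ?thesis using that[OF X] by blast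
qed

end

section \<open>Direct summands of copies of a module\<close>

lemma copies_simps [simp]:
  "carrier (copies M I) = {f \<in> I \<rightarrow>\<^sub>E carrier M. finite {i \<in> I. f i \<noteq> \<zero>\<^bsub>M\<^esub>}}"
  "\<zero>\<^bsub>copies M I\<^esub> = (\<lambda>i\<in>I. \<zero>\<^bsub>M\<^esub>)"
  "f \<oplus>\<^bsub>copies M I\<^esub> g = (\<lambda>i\<in>I. f i \<oplus>\<^bsub>M\<^esub> g i)"
  "r \<odot>\<^bsub>copies M I\<^esub> f = (\<lambda>i\<in>I. r \<odot>\<^bsub>M\<^esub> f i)"
  by (simp_all add: copies_def)

lemma left_module_copies:
  assumes "left_module R M"
  shows "left_module R (copies M I)"
proof -
  interpret left_module R M by fact
  \<comment> \<open>One finiteness argument serves sums, multiples and negatives: \<open>h\<close>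
    vanishes wherever both \<open>f\<close> and \<open>g\<close> do. Unary operations take
    \<open>f\<close> twice.\<close>
  have supp: "finite {i \<in> I. h i \<noteq> \<zero>\<^bsub>M\<^esub>}"
    if "finite {i \<in> I. f i \<noteq> \<zero>\<^bsub>M\<^esub>}" "finite {i \<in> I. g i \<noteq> \<zero>\<^bsub>M\<^esub>}"
      "\<And>i. \<lbrakk>i \<in> I; f i = \<zero>\<^bsub>M\<^esub>; g i = \<zero>\<^bsub>M\<^esub>\<rbrakk> \<Longrightarrow> h i = \<zero>\<^bsub>M\<^esub>" for f g h :: "_ \<Rightarrow> _"
    by (rule finite_subset[OF _ finite_UnI[OF that(1,2)]]) (use that(3) in auto)
  have closed: "f \<oplus>\<^bsub>copies M I\<^esub> g \<in> carrier (copies M I)"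
    if "f \<in> carrier (copies M I)" "g \<in> carrier (copies M I)" for f g
    using that supp[of f g "\<lambda>i\<in>I. f i \<oplus>\<^bsub>M\<^esub> g i"] by (auto simp: PiE_iff)
  have smult_closed: "r \<odot>\<^bsub>copies M I\<^esub> f \<in> carrier (copies M I)"
    if "r \<in> carrier R" "f \<in> carrier (copies M I)" for r f
    using that supp[of f f "\<lambda>i\<in>I. r \<odot>\<^bsub>M\<^esub> f i"] by (auto simp: PiE_iff)
  have "abelian_group (copies M I)"
  proof (rule abelian_groupI)
    fix f assume f: "f \<in> carrier (copies M I)"
    have "(\<lambda>i\<in>I. \<ominus>\<^bsub>M\<^esub> f i) \<in> carrier (copies M I)"
      using f supp[of f f "\<lambda>i\<in>I. \<ominus>\<^bsub>M\<^esub> f i"] by (auto simp: PiE_iff)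
    moreover have "(\<lambda>i\<in>I. \<ominus>\<^bsub>M\<^esub> f i) \<oplus>\<^bsub>copies M I\<^esub> f = \<zero>\<^bsub>copies M I\<^esub>"
      using f by (auto simp: PiE_iff M.l_neg fun_eq_iff)
    ultimately show "\<exists>g\<in>carrier (copies M I). g \<oplus>\<^bsub>copies M I\<^esub> f = \<zero>\<^bsub>copies M I\<^esub>" by blast
  next
    fix f g h
    assume "f \<in> carrier (copies M I)" "g \<in> carrier (copies M I)" "h \<in> carrier (copies M I)"
    then show "f \<oplus>\<^bsub>copies M I\<^esub> g \<oplus>\<^bsub>copies M I\<^esub> h = f \<oplus>\<^bsub>copies M I\<^esub> (g \<oplus>\<^bsub>copies M I\<^esub> h)"
      by (auto simp: PiE_iff fun_eq_iff M.a_assoc)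
  next
    fix f g
    assume "f \<in> carrier (copies M I)" "g \<in> carrier (copies M I)"
    then show "f \<oplus>\<^bsub>copies M I\<^esub> g = g \<oplus>\<^bsub>copies M I\<^esub> f"
      by (auto simp: PiE_iff fun_eq_iff M.a_comm)
  next
    fix f assume "f \<in> carrier (copies M I)"
    then show "\<zero>\<^bsub>copies M I\<^esub> \<oplus>\<^bsub>copies M I\<^esub> f = f"
      by (auto simp: PiE_iff fun_eq_iff extensional_def)
  next
    show "\<zero>\<^bsub>copies M I\<^esub> \<in> carrier (copies M I)" by auto
  qed (rule closed)
  then show ?thesis
    by (rule left_moduleI[OF R.ring_axioms])
      (simp_all only: smult_closed,
        auto simp: PiE_iff fun_eq_iff extensional_def smult_l_distr smult_r_distr smult_assoc1)
qed

text \<open>The image of \<sigma> is complemented by the kernel of \<pi>: each \<open>p\<close> is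
  the sum of \<open>\<sigma> (\<pi> p)\<close> and \<open>p - \<sigma> (\<pi> p)\<close>, and the
  latter is killed by \<pi>.\<close>

lemma direct_summandI_retraction:
  assumes "left_module R M" "left_module R P"
    and \<sigma>: "\<sigma> \<in> lmod_hom R M P" and \<pi>: "\<pi> \<in> lmod_hom R P M"
    and inv: "\<And>m. m \<in> carrier M \<Longrightarrow> \<pi> (\<sigma> m) = m"
  shows "direct_summand R M P"
proof -
  interpret M: left_module R M by fact
  interpret P: left_module R P by fact
  note \<sigma>D = lmod_homD(2-)[OF \<sigma>] and \<pi>D = lmod_homD(2-)[OF \<pi>]
  have zero: "\<sigma> \<zero>\<^bsub>M\<^esub> = \<zero>\<^bsub>P\<^esub>" "\<pi> \<zero>\<^bsub>P\<^esub> = \<zero>\<^bsub>M\<^esub>"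
    using additive_zero[OF M.M.abelian_group_axioms P.M.abelian_group_axioms lmod_hom_additive[OF \<sigma>]]
      additive_zero[OF P.M.abelian_group_axioms M.M.abelian_group_axioms lmod_hom_additive[OF \<pi>]] by auto
  let ?U = "\<sigma> ` carrier M" and ?V = "{p \<in> carrier P. \<pi> p = \<zero>\<^bsub>M\<^esub>}"
  have U: "submodule ?U R P"
  proof (rule P.submoduleI)
    show "\<zero>\<^bsub>P\<^esub> \<in> ?U" using zero(1) M.M.zero_closed by (metis imageI)
    show "x \<oplus>\<^bsub>P\<^esub> y \<in> ?U" if "x \<in> ?U" "y \<in> ?U" for x y
      using that \<sigma>D(2) M.M.a_closed by (smt (verit) image_iff)
    show "r \<odot>\<^bsub>P\<^esub> x \<in> ?U" if "r \<in> carrier R" "x \<in> ?U" for r x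
      using that \<sigma>D(3) M.smult_closed by (smt (verit) image_iff)
  qed (use \<sigma>D in auto)
  have V: "submodule ?V R P"
    by (rule P.submoduleI) (use \<pi>D zero in auto)
  have "?U \<inter> ?V = {\<zero>\<^bsub>P\<^esub>}"
    using inv zero by (auto intro: rev_image_eqI[of "\<zero>\<^bsub>M\<^esub>"])
  moreover have "p \<in> ?U <+>\<^bsub>P\<^esub> ?V" if p: "p \<in> carrier P" for p
  proof -
    have "\<pi> (p \<oplus>\<^bsub>P\<^esub> \<ominus>\<^bsub>P\<^esub> \<sigma> (\<pi> p)) = \<zero>\<^bsub>M\<^esub>"
      using p inv \<sigma>D \<pi>D additive_minus[OF P.M.abelian_group_axioms M.M.abelian_group_axioms lmod_hom_additive[OF \<pi>]]
      by (simp add: M.M.r_neg)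
    moreover have "p = \<sigma> (\<pi> p) \<oplus>\<^bsub>P\<^esub> (p \<oplus>\<^bsub>P\<^esub> \<ominus>\<^bsub>P\<^esub> \<sigma> (\<pi> p))"
      using p \<sigma>D \<pi>D by (simp add: P.M.a_lcomm P.M.r_neg)
    ultimately show ?thesis
      using imageI[of "\<pi> p" "carrier M" \<sigma>] p \<sigma>D(1) \<pi>D(1) unfolding set_add_def set_mult_def
      by (intro UN_I[of "\<sigma> (\<pi> p)"] UN_I[of "p \<oplus>\<^bsub>P\<^esub> \<ominus>\<^bsub>P\<^esub> \<sigma> (\<pi> p)"]) auto
  qed
  then have "?U <+>\<^bsub>P\<^esub> ?V = carrier P"
    using \<sigma>D unfolding set_add_def set_mult_def by auto
  moreover have "lmod_isomorphic R M (P\<lparr>carrier := ?U\<rparr>)"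
    unfolding lmod_isomorphic_def
  proof
    show "\<sigma> \<in> lmod_hom R M (P\<lparr>carrier := ?U\<rparr>)"
      using \<sigma> by (auto simp: lmod_hom_def PiE_iff)
    show "bij_betw \<sigma> (carrier M) (carrier (P\<lparr>carrier := ?U\<rparr>))"
      using inv by (auto simp: bij_betw_def intro: inj_on_inverseI)
  qed
  ultimately show ?thesis
    using U V unfolding direct_summand_def by blast
qed

text \<open>Here \<pi> is the projection onto \<open>U\<close> along \<open>V\<close>, followed by
  the inverse of \<sigma>. It is obtained by choice, and its linearity follows from uniqueness of
  the decomposition.\<close>

lemma direct_summandE_retraction:
  assumes "left_module R M" "left_module R P" "direct_summand R M P"
  obtains \<sigma> \<pi> where "\<sigma> \<in> lmod_hom R M P" "\<pi> \<in> lmod_hom R P M"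
    "\<And>m. m \<in> carrier M \<Longrightarrow> \<pi> (\<sigma> m) = m"
proof -
  interpret M: left_module R M by fact
  interpret P: left_module R P by fact
  obtain U V \<sigma> where U: "submodule U R P" and V: "submodule V R P"
    and UV: "U \<inter> V = {\<zero>\<^bsub>P\<^esub>}" "U <+>\<^bsub>P\<^esub> V = carrier P"
    and \<sigma>: "\<sigma> \<in> lmod_hom R M (P\<lparr>carrier := U\<rparr>)" and bij: "bij_betw \<sigma> (carrier M) U"
    using assms(3) unfolding direct_summand_def lmod_isomorphic_def by auto
  note UD = P.submoduleD[OF U] and VD = P.submoduleD[OF V]
  have \<sigma>U: "\<sigma> m \<in> U" if "m \<in> carrier M" for m
    using lmod_homD(2)[OF \<sigma>] that by simp
  have \<sigma>': "\<sigma> \<in> lmod_hom R M P"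
    using \<sigma> UD(1) by (auto simp: lmod_hom_def PiE_iff)
  note \<sigma>D = lmod_homD[OF \<sigma>']
  have ex: "\<exists>m\<in>carrier M. \<exists>v\<in>V. p = \<sigma> m \<oplus>\<^bsub>P\<^esub> v" if "p \<in> carrier P" for p
  proof -
    have "\<exists>u\<in>U. \<exists>v\<in>V. p = u \<oplus>\<^bsub>P\<^esub> v"
    proof -
      have "p \<in> U <+>\<^bsub>P\<^esub> V" using that UV(2) by simp
      then show ?thesis unfolding set_add_def set_mult_def by auto
    qed
    then show ?thesis using bij unfolding bij_betw_def by blast
  qed
  \<comment> \<open>Subtracting the two decompositions equates an element of \<open>U\<close> with
    an element of \<open>V\<close>; both are then zero, and \<sigma> is injective.\<close>
  have unique: "m = m'"
    if "m \<in> carrier M" "m' \<in> carrier M" "v \<in> V" "v' \<in> V" "\<sigma> m \<oplus>\<^bsub>P\<^esub> v = \<sigma> m' \<oplus>\<^bsub>P\<^esub> v'" for m m' v v'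
  proof -
    have c: "\<sigma> m \<in> carrier P" "\<sigma> m' \<in> carrier P" "v \<in> carrier P" "v' \<in> carrier P"
      using that \<sigma>U UD(1) VD(1) by auto
    have "\<sigma> m \<oplus>\<^bsub>P\<^esub> \<ominus>\<^bsub>P\<^esub> \<sigma> m' = (\<sigma> m \<oplus>\<^bsub>P\<^esub> v) \<oplus>\<^bsub>P\<^esub> (\<ominus>\<^bsub>P\<^esub> v \<oplus>\<^bsub>P\<^esub> \<ominus>\<^bsub>P\<^esub> \<sigma> m')"
      using c by (simp add: P.M.a_assoc P.M.r_neg2)
    also have "\<dots> = \<sigma> m' \<oplus>\<^bsub>P\<^esub> (\<ominus>\<^bsub>P\<^esub> \<sigma> m' \<oplus>\<^bsub>P\<^esub> (v' \<oplus>\<^bsub>P\<^esub> \<ominus>\<^bsub>P\<^esub> v))"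
      using c unfolding that(5) by (simp only: P.M.a_ac P.M.a_closed P.M.a_inv_closed)
    also have "\<dots> = v' \<oplus>\<^bsub>P\<^esub> \<ominus>\<^bsub>P\<^esub> v"
      using c by (simp add: P.M.r_neg2)
    finally have eq: "\<sigma> m \<oplus>\<^bsub>P\<^esub> \<ominus>\<^bsub>P\<^esub> \<sigma> m' = v' \<oplus>\<^bsub>P\<^esub> \<ominus>\<^bsub>P\<^esub> v" .
    have "\<sigma> m \<oplus>\<^bsub>P\<^esub> \<ominus>\<^bsub>P\<^esub> \<sigma> m' \<in> U" using that \<sigma>U UD by simp
    moreover have "v' \<oplus>\<^bsub>P\<^esub> \<ominus>\<^bsub>P\<^esub> v \<in> V" using that VD by simp
    ultimately have "\<sigma> m \<oplus>\<^bsub>P\<^esub> \<ominus>\<^bsub>P\<^esub> \<sigma> m' = \<zero>\<^bsub>P\<^esub>" using eq UV(1) by auto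
    then have "\<sigma> m = \<sigma> m'" using c by (metis P.M.minus_equality P.M.minus_minus P.M.a_inv_closed)
    then show ?thesis using bij that by (auto simp: bij_betw_def inj_on_def)
  qed
  define \<pi> where "\<pi> = (\<lambda>p\<in>carrier P. SOME m. m \<in> carrier M \<and> (\<exists>v\<in>V. p = \<sigma> m \<oplus>\<^bsub>P\<^esub> v))"
  have \<pi>: "\<pi> p \<in> carrier M \<and> (\<exists>v\<in>V. p = \<sigma> (\<pi> p) \<oplus>\<^bsub>P\<^esub> v)" if "p \<in> carrier P" for p
    using someI_ex[of "\<lambda>m. m \<in> carrier M \<and> (\<exists>v\<in>V. p = \<sigma> m \<oplus>\<^bsub>P\<^esub> v)"] ex[OF that] that
    by (simp add: \<pi>_def Bex_def)
  have \<pi>_eq: "\<pi> (\<sigma> m \<oplus>\<^bsub>P\<^esub> v) = m" if "m \<in> carrier M" "v \<in> V" for m v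
    using \<pi>[of "\<sigma> m \<oplus>\<^bsub>P\<^esub> v"] unique[of "\<pi> (\<sigma> m \<oplus>\<^bsub>P\<^esub> v)" m] that \<sigma>D VD by fastforce
  have "\<pi> \<in> lmod_hom R P M"
  proof (rule lmod_homI)
    fix p p' assume p: "p \<in> carrier P" "p' \<in> carrier P"
    obtain v v' where v: "v \<in> V" "p = \<sigma> (\<pi> p) \<oplus>\<^bsub>P\<^esub> v" "v' \<in> V" "p' = \<sigma> (\<pi> p') \<oplus>\<^bsub>P\<^esub> v'"
      using \<pi> p by blast
    have c: "\<pi> p \<in> carrier M" "\<pi> p' \<in> carrier M" "v \<in> carrier P" "v' \<in> carrier P"
      using \<pi> p v VD(1) by auto
    have "p \<oplus>\<^bsub>P\<^esub> p' = (\<sigma> (\<pi> p) \<oplus>\<^bsub>P\<^esub> v) \<oplus>\<^bsub>P\<^esub> (\<sigma> (\<pi> p') \<oplus>\<^bsub>P\<^esub> v')" using v by simp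
    also have "\<dots> = \<sigma> (\<pi> p \<oplus>\<^bsub>M\<^esub> \<pi> p') \<oplus>\<^bsub>P\<^esub> (v \<oplus>\<^bsub>P\<^esub> v')"
      using c \<sigma>D by (simp add: P.M.a_ac)
    finally show "\<pi> (p \<oplus>\<^bsub>P\<^esub> p') = \<pi> p \<oplus>\<^bsub>M\<^esub> \<pi> p'" using \<pi>_eq c v VD by simp
  next
    fix r p assume r: "r \<in> carrier R" and p: "p \<in> carrier P"
    obtain v where v: "v \<in> V" "p = \<sigma> (\<pi> p) \<oplus>\<^bsub>P\<^esub> v" using \<pi> p by blast
    have c: "\<pi> p \<in> carrier M" "v \<in> carrier P" using \<pi> p v VD(1) by auto
    have "r \<odot>\<^bsub>P\<^esub> p = r \<odot>\<^bsub>P\<^esub> (\<sigma> (\<pi> p) \<oplus>\<^bsub>P\<^esub> v)" using v by simp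
    also have "\<dots> = \<sigma> (r \<odot>\<^bsub>M\<^esub> \<pi> p) \<oplus>\<^bsub>P\<^esub> r \<odot>\<^bsub>P\<^esub> v"
      using c r \<sigma>D by (simp add: P.smult_r_distr)
    finally show "\<pi> (r \<odot>\<^bsub>P\<^esub> p) = r \<odot>\<^bsub>M\<^esub> \<pi> p" using \<pi>_eq c v VD r by simp
  qed (use \<pi> in \<open>auto simp: \<pi>_def\<close>)
  moreover have "\<pi> (\<sigma> m) = m" if "m \<in> carrier M" for m
    using \<pi>_eq[OF that VD(2)] \<sigma>D that by simp
  ultimately show thesis using that[OF \<sigma>'] by blast
qed

text \<open>The identity of \<open>M\<close> is \<pi> \<circ> \<sigma>, and splitting it along the
  coordinates of the direct sum gives the maps \<open>p j\<close> and \<open>q j\<close>. Finite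
  generation leaves only finitely many coordinates. The case where \<open>N\<close> is the regular
  module yields a dual basis of a projective module; the case where \<open>N\<close> is
  \<open>T\<close> yields the maps for add(T).\<close>

lemma summand_of_copies_decomposition:
  assumes M: "left_module R M" and N: "left_module R N"
    and summand: "direct_summand R M (copies N (X :: 'i set))" and fg: "finitely_generated R M"
  obtains F :: "'i set" and p q where "finite F"
    "\<forall>j\<in>F. p j \<in> lmod_hom R N M" "\<forall>j\<in>F. q j \<in> lmod_hom R M N"
    "\<forall>m\<in>carrier M. (\<Oplus>\<^bsub>M\<^esub>j\<in>F. p j (q j m)) = m"
proof -
  let ?P = "copies N X"
  interpret M: left_module R M by fact
  interpret N: left_module R N by fact
  interpret P: left_module R ?P using N by (rule left_module_copies)
  obtain \<sigma> \<pi> where \<sigma>: "\<sigma> \<in> lmod_hom R M ?P" and \<pi>: "\<pi> \<in> lmod_hom R ?P M"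
    and inv: "\<And>m. m \<in> carrier M \<Longrightarrow> \<pi> (\<sigma> m) = m"
    by (rule direct_summandE_retraction[OF M P.left_module_axioms summand]) blast
  note \<sigma>D = lmod_homD(2-)[OF \<sigma>] and \<pi>D = lmod_homD(2-)[OF \<pi>]
  have \<sigma>N: "\<sigma> m x \<in> carrier N" if "m \<in> carrier M" "x \<in> X" for m x
    using \<sigma>D(1)[OF that(1)] that(2) by auto
  have \<sigma>0: "\<sigma> \<zero>\<^bsub>M\<^esub> = \<zero>\<^bsub>?P\<^esub>"
    by (rule additive_zero[OF M.M.abelian_group_axioms P.M.abelian_group_axioms lmod_hom_additive[OF \<sigma>]])
  obtain G where G: "finite G" "G \<subseteq> carrier M"
    and gen: "\<forall>N. submodule N R M \<longrightarrow> G \<subseteq> N \<longrightarrow> carrier M \<subseteq> N"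
    by (rule M.finitely_generatedE[OF fg])
  \<comment> \<open>The coordinates in which the image of some generator is nonzero; finitely many,
    since each image has finite support.\<close>
  define F where "F = (\<Union>g\<in>G. {x \<in> X. \<sigma> g x \<noteq> \<zero>\<^bsub>N\<^esub>})"
  have F: "finite F" "F \<subseteq> X"
    using G \<sigma>D(1) unfolding F_def by auto
  \<comment> \<open>Vanishing off \<open>F\<close> is a submodule condition that holds for the
    generators, so it holds on all of \<open>M\<close>.\<close>
  have "submodule {m \<in> carrier M. \<forall>x\<in>X - F. \<sigma> m x = \<zero>\<^bsub>N\<^esub>} R M"
    by (rule M.submoduleI) (use \<sigma>D \<sigma>0 in auto)
  then have supp: "\<sigma> m x = \<zero>\<^bsub>N\<^esub>" if "m \<in> carrier M" "x \<in> X - F" for m x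
    using gen G that unfolding F_def by blast
  \<comment> \<open>The injection of the summand with index \<open>j\<close>.\<close>
  define e where "e j n = (\<lambda>x\<in>X. if j = x then n else \<zero>\<^bsub>N\<^esub>)" for j n
  have e: "e j \<in> carrier N \<rightarrow> carrier ?P" if "j \<in> X" for j
    using that by (auto simp: e_def intro: finite_subset[of _ "{j}"])
  have eval: "(\<lambda>f. f x) \<in> hom (add_monoid ?P) (add_monoid N)" if "x \<in> X" for x
    using that by (intro additiveI) auto
  have sum: "(\<Oplus>\<^bsub>?P\<^esub>j\<in>F. e j (\<sigma> m j)) = \<sigma> m" if m: "m \<in> carrier M" for m
  proof
    fix x
    have eF: "(\<lambda>j. e j (\<sigma> m j)) \<in> F \<rightarrow> carrier ?P"
      using e F(2) \<sigma>N m by blast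
    show "(\<Oplus>\<^bsub>?P\<^esub>j\<in>F. e j (\<sigma> m j)) x = \<sigma> m x"
    proof (cases "x \<in> X")
      case True
      have "(\<Oplus>\<^bsub>?P\<^esub>j\<in>F. e j (\<sigma> m j)) x = (\<Oplus>\<^bsub>N\<^esub>j\<in>F. e j (\<sigma> m j) x)"
        by (rule additive_finsum[OF P.M.abelian_group_axioms N.M.abelian_group_axioms eval[OF True] eF])
      also have "\<dots> = (\<Oplus>\<^bsub>N\<^esub>j\<in>F. if x = j then \<sigma> m j else \<zero>\<^bsub>N\<^esub>)"
        using F(2) \<sigma>N m True by (intro N.M.finsum_cong') (auto simp: e_def)
      also have "\<dots> = \<sigma> m x"
      proof (cases "x \<in> F")
        case True
        then show ?thesis using N.M.finsum_singleton[of x F "\<sigma> m"] F \<sigma>N m by auto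
      next
        case False
        then have "(\<Oplus>\<^bsub>N\<^esub>j\<in>F. if x = j then \<sigma> m j else \<zero>\<^bsub>N\<^esub>) = \<zero>\<^bsub>N\<^esub>"
          by (intro N.add.finprod_one_eqI) auto
        then show ?thesis using supp m True False by simp
      qed
      finally show ?thesis .
    next
      case False
      have "(\<Oplus>\<^bsub>?P\<^esub>j\<in>F. e j (\<sigma> m j)) \<in> carrier ?P" using eF by (rule P.M.finsum_closed)
      then show ?thesis
        using False \<sigma>D(1)[OF m] by (auto simp: PiE_iff extensional_def)
    qed
  qed
  show thesis
  proof (rule that[OF F(1)]; intro ballI)
    show "(\<lambda>n\<in>carrier N. \<pi> (e j n)) \<in> lmod_hom R N M" if j: "j \<in> F" for j
    proof (rule lmod_homI)
      fix n n' assume n: "n \<in> carrier N" "n' \<in> carrier N"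
      have "e j (n \<oplus>\<^bsub>N\<^esub> n') = e j n \<oplus>\<^bsub>?P\<^esub> e j n'"
        by (auto simp: e_def fun_eq_iff)
      then show "(\<lambda>n\<in>carrier N. \<pi> (e j n)) (n \<oplus>\<^bsub>N\<^esub> n') =
          (\<lambda>n\<in>carrier N. \<pi> (e j n)) n \<oplus>\<^bsub>M\<^esub> (\<lambda>n\<in>carrier N. \<pi> (e j n)) n'"
        using n \<pi>D(2)[of "e j n" "e j n'"] e F(2) that by auto
    next
      fix r n assume n: "r \<in> carrier R" "n \<in> carrier N"
      have "e j (r \<odot>\<^bsub>N\<^esub> n) = r \<odot>\<^bsub>?P\<^esub> e j n"
        using n by (auto simp: e_def fun_eq_iff)
      then show "(\<lambda>n\<in>carrier N. \<pi> (e j n)) (r \<odot>\<^bsub>N\<^esub> n) = r \<odot>\<^bsub>M\<^esub> (\<lambda>n\<in>carrier N. \<pi> (e j n)) n"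
        using n \<pi>D(3)[of r "e j n"] e F(2) that by auto
    qed (use \<pi>D(1) e F(2) that in auto)
    show "(\<lambda>m\<in>carrier M. \<sigma> m j) \<in> lmod_hom R M N" if "j \<in> F" for j
      using \<sigma>D(2,3) \<sigma>N F(2) that by (intro lmod_homI) auto
    show "(\<Oplus>\<^bsub>M\<^esub>j\<in>F. (\<lambda>n\<in>carrier N. \<pi> (e j n)) ((\<lambda>m\<in>carrier M. \<sigma> m j) m)) = m"
      if m: "m \<in> carrier M" for m
    proof -
      have eF: "(\<lambda>j. e j (\<sigma> m j)) \<in> F \<rightarrow> carrier ?P"
        using e F(2) \<sigma>N m by blast
      then have "\<pi> (e j (\<sigma> m j)) \<in> carrier M" if "j \<in> F" for j
        using \<pi>D(1) that by blast
      then have "(\<Oplus>\<^bsub>M\<^esub>j\<in>F. (\<lambda>n\<in>carrier N. \<pi> (e j n)) ((\<lambda>m\<in>carrier M. \<sigma> m j) m)) = (\<Oplus>\<^bsub>M\<^esub>j\<in>F. \<pi> (e j (\<sigma> m j)))"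
        using m \<sigma>N F(2) by (intro M.M.finsum_cong') auto
      also have "\<dots> = \<pi> (\<Oplus>\<^bsub>?P\<^esub>j\<in>F. e j (\<sigma> m j))"
        by (rule additive_finsum[OF P.M.abelian_group_axioms M.M.abelian_group_axioms
              lmod_hom_additive[OF \<pi>] eF, symmetric])
      also have "\<dots> = m" using sum inv m by simp
      finally show ?thesis .
    qed
  qed
qed

section \<open>Frobenius systems\<close>

lemma ring_as_module_simps [simp]:
  "carrier (ring_as_module A \<iota>) = carrier A"
  "\<zero>\<^bsub>ring_as_module A \<iota>\<^esub> = \<zero>\<^bsub>A\<^esub>"
  "x \<oplus>\<^bsub>ring_as_module A \<iota>\<^esub> y = x \<oplus>\<^bsub>A\<^esub> y"
  "r \<odot>\<^bsub>ring_as_module A \<iota>\<^esub> x = \<iota> r \<otimes>\<^bsub>A\<^esub> x"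
  "finsum (ring_as_module A \<iota>) = finsum A"
  by (simp_all add: ring_as_module_def finsum_def finprod_def fun_eq_iff)

lemma left_module_ring_as_module:
  assumes "ring R" "ring A" "\<iota> \<in> ring_hom R A"
  shows "left_module R (ring_as_module A \<iota>)"
proof -
  interpret A: ring A by fact
  note \<iota> = ring_hom_closed[OF assms(3)] ring_hom_add[OF assms(3)] ring_hom_mult[OF assms(3)]
    ring_hom_one[OF assms(3)]
  have "abelian_group (ring_as_module A \<iota>)"
    by (rule abelian_groupI) (auto simp: A.a_ac intro: A.l_neg)
  then show ?thesis
    by (rule left_moduleI[OF assms(1)]) (auto simp: \<iota> A.l_distr A.r_distr A.m_assoc)
qed

lemma left_module_regular: "ring R \<Longrightarrow> left_module R (regular_module R)"
  by (rule left_module_ring_as_module) (auto simp: ring_hom_def)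

locale ring_extension = R?: ring R + A?: ring A for R (structure) and A (structure) +
  fixes \<iota> :: "_ \<Rightarrow> _"
  assumes \<iota>_hom: "\<iota> \<in> ring_hom R A"
begin

lemmas \<iota>_simps [simp] = ring_hom_closed[OF \<iota>_hom] ring_hom_add[OF \<iota>_hom]
  ring_hom_mult[OF \<iota>_hom] ring_hom_one[OF \<iota>_hom]

lemma \<iota>_additive: "\<iota> \<in> hom (add_monoid R) (add_monoid A)"
  by (auto intro!: additiveI)

lemmas \<iota>_finsum = additive_finsum[OF R.is_abelian_group A.is_abelian_group \<iota>_additive]

end

text \<open>\<open>E\<close> is the Frobenius homomorphism, corresponding to 1 under the isomorphism
  of \<open>A\<close> with its dual. \<open>left_dual\<close> says that the \<open>a i\<close> and
  the functionals \<open>x \<mapsto> E (x b\<^sub>i)\<close> are a dual basis of the left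
  \<open>R\<close>-module \<open>A\<close>; \<open>right_dual\<close> is its mirror image for the
  right module structure.\<close>

locale frobenius_system = ring_extension R A \<iota> for R (structure) and A (structure) and \<iota> +
  fixes E :: "_ \<Rightarrow> _" and I :: "'i set" and a b :: "'i \<Rightarrow> _"
  assumes E_closed [simp, intro]: "x \<in> carrier A \<Longrightarrow> E x \<in> carrier R"
    and E_add [simp]: "\<lbrakk>x \<in> carrier A; y \<in> carrier A\<rbrakk> \<Longrightarrow> E (x \<oplus>\<^bsub>A\<^esub> y) = E x \<oplus>\<^bsub>R\<^esub> E y"
    and E_left [simp]: "\<lbrakk>r \<in> carrier R; x \<in> carrier A\<rbrakk> \<Longrightarrow> E (\<iota> r \<otimes>\<^bsub>A\<^esub> x) = r \<otimes>\<^bsub>R\<^esub> E x"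
    and E_right [simp]: "\<lbrakk>r \<in> carrier R; x \<in> carrier A\<rbrakk> \<Longrightarrow> E (x \<otimes>\<^bsub>A\<^esub> \<iota> r) = E x \<otimes>\<^bsub>R\<^esub> r"
    and finite_index [simp, intro]: "finite I"
    and a_closed [simp, intro]: "i \<in> I \<Longrightarrow> a i \<in> carrier A"
    and b_closed [simp, intro]: "i \<in> I \<Longrightarrow> b i \<in> carrier A"
    and left_dual: "x \<in> carrier A \<Longrightarrow> (\<Oplus>\<^bsub>A\<^esub>i\<in>I. \<iota> (E (x \<otimes>\<^bsub>A\<^esub> b i)) \<otimes>\<^bsub>A\<^esub> a i) = x"
    and right_dual: "x \<in> carrier A \<Longrightarrow> (\<Oplus>\<^bsub>A\<^esub>i\<in>I. b i \<otimes>\<^bsub>A\<^esub> \<iota> (E (a i \<otimes>\<^bsub>A\<^esub> x))) = x"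
begin

section \<open>From a Frobenius system to a Frobenius extension\<close>

lemma E_additive: "E \<in> hom (add_monoid A) (add_monoid R)"
  by (auto intro!: additiveI)

lemmas E_finsum = additive_finsum[OF A.is_abelian_group R.is_abelian_group E_additive]

lemma left_module_A: "left_module R (ring_as_module A \<iota>)"
  by (rule left_module_ring_as_module[OF R.ring_axioms A.ring_axioms \<iota>_hom])

lemma finitely_generated_extension: "finitely_generated R (ring_as_module A \<iota>)"
proof -
  interpret M: left_module R "ring_as_module A \<iota>" by (rule left_module_A)
  show ?thesis
  proof (rule M.finitely_generatedI)
    fix N assume N: "submodule N R (ring_as_module A \<iota>)" "a ` I \<subseteq> N"
    show "carrier (ring_as_module A \<iota>) \<subseteq> N"
    proof
      fix x assume x: "x \<in> carrier (ring_as_module A \<iota>)"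
      then have "(\<Oplus>\<^bsub>ring_as_module A \<iota>\<^esub>i\<in>I. E (x \<otimes>\<^bsub>A\<^esub> b i) \<odot>\<^bsub>ring_as_module A \<iota>\<^esub> a i) \<in> N"
        using N(2) by (intro M.submodule_finsum_closed[OF N(1)] Pi_I M.submoduleD(4)[OF N(1)]) auto
      then show "x \<in> N" using x by (simp add: left_dual)
    qed
  qed auto
qed

text \<open>The dual basis splits \<open>A\<close> off a free module. Since
  \<open>projective_module\<close> asks for a basis inside the type of \<open>A\<close>, while
  \<open>I\<close> has an arbitrary index type, the free module is indexed by the set of values of
  \<open>a\<close>; the coefficient at a value sums \<open>E (m b\<^sub>i)\<close> over its fibre,
  because \<open>a\<close> may fail to be injective.\<close>

lemma projective_extension: "projective_module R (ring_as_module A \<iota>)"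
proof -
  let ?M = "ring_as_module A \<iota>" and ?X = "a ` I"
  let ?P = "copies (regular_module R) ?X"
  interpret P: left_module R ?P
    by (rule left_module_copies[OF left_module_regular[OF R.ring_axioms]])
  let ?c = "\<lambda>m x. \<Oplus>\<^bsub>R\<^esub>i\<in>{i \<in> I. a i = x}. E (m \<otimes>\<^bsub>A\<^esub> b i)"
  define \<sigma> where "\<sigma> = (\<lambda>m\<in>carrier A. \<lambda>x\<in>?X. ?c m x)"
  define \<pi> where "\<pi> = (\<lambda>f\<in>carrier ?P. \<Oplus>\<^bsub>A\<^esub>x\<in>?X. \<iota> (f x) \<otimes>\<^bsub>A\<^esub> x)"
  have c: "?c m x \<in> carrier R" if "m \<in> carrier A" for m x
    using that by (intro R.finsum_closed) auto
  have "direct_summand R ?M ?P"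
  proof (rule direct_summandI_retraction[OF left_module_A P.left_module_axioms])
    show "\<sigma> \<in> lmod_hom R ?M ?P"
    proof (rule lmod_homI)
      fix m n assume m: "m \<in> carrier ?M" "n \<in> carrier ?M"
      have "?c (m \<oplus>\<^bsub>A\<^esub> n) x = ?c m x \<oplus>\<^bsub>R\<^esub> ?c n x" for x
      proof -
        have "?c (m \<oplus>\<^bsub>A\<^esub> n) x = (\<Oplus>\<^bsub>R\<^esub>i\<in>{i \<in> I. a i = x}. E (m \<otimes>\<^bsub>A\<^esub> b i) \<oplus>\<^bsub>R\<^esub> E (n \<otimes>\<^bsub>A\<^esub> b i))"
          using m by (intro R.finsum_cong') (auto simp: A.l_distr)
        then show ?thesis using m by (subst (asm) R.finsum_addf) auto
      qed
      then show "\<sigma> (m \<oplus>\<^bsub>?M\<^esub> n) = \<sigma> m \<oplus>\<^bsub>?P\<^esub> \<sigma> n"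
        using m by (simp add: \<sigma>_def fun_eq_iff)
    next
      fix r m assume r: "r \<in> carrier R" and m: "m \<in> carrier ?M"
      have "?c (\<iota> r \<otimes>\<^bsub>A\<^esub> m) x = r \<otimes>\<^bsub>R\<^esub> ?c m x" for x
      proof -
        have "?c (\<iota> r \<otimes>\<^bsub>A\<^esub> m) x = (\<Oplus>\<^bsub>R\<^esub>i\<in>{i \<in> I. a i = x}. r \<otimes>\<^bsub>R\<^esub> E (m \<otimes>\<^bsub>A\<^esub> b i))"
          using m r by (intro R.finsum_cong') (auto simp: A.m_assoc)
        then show ?thesis using m r by (subst R.finsum_rdistr) auto
      qed
      then show "\<sigma> (r \<odot>\<^bsub>?M\<^esub> m) = r \<odot>\<^bsub>?P\<^esub> \<sigma> m"
        using m r by (simp add: \<sigma>_def fun_eq_iff)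
    qed (use c in \<open>auto simp: \<sigma>_def\<close>)
    show "\<pi> \<in> lmod_hom R ?P ?M"
    proof (rule lmod_homI)
      fix f g assume f: "f \<in> carrier ?P" "g \<in> carrier ?P"
      then have "f \<oplus>\<^bsub>?P\<^esub> g \<in> carrier ?P" by (rule P.M.a_closed)
      then have "\<pi> (f \<oplus>\<^bsub>?P\<^esub> g) = (\<Oplus>\<^bsub>A\<^esub>x\<in>?X. \<iota> ((f \<oplus>\<^bsub>?P\<^esub> g) x) \<otimes>\<^bsub>A\<^esub> x)"
        by (simp only: \<pi>_def restrict_apply')
      also have "\<dots> = (\<Oplus>\<^bsub>A\<^esub>x\<in>?X. \<iota> (f x) \<otimes>\<^bsub>A\<^esub> x \<oplus>\<^bsub>A\<^esub> \<iota> (g x) \<otimes>\<^bsub>A\<^esub> x)"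
        using f by (intro A.finsum_cong') (auto simp: PiE_iff A.l_distr)
      also have "\<dots> = \<pi> f \<oplus>\<^bsub>A\<^esub> \<pi> g"
        using f by (subst A.finsum_addf) (auto simp: PiE_iff \<pi>_def)
      finally show "\<pi> (f \<oplus>\<^bsub>?P\<^esub> g) = \<pi> f \<oplus>\<^bsub>?M\<^esub> \<pi> g" by simp
    next
      fix r f assume r: "r \<in> carrier R" and f: "f \<in> carrier ?P"
      then have "r \<odot>\<^bsub>?P\<^esub> f \<in> carrier ?P" by (rule P.smult_closed)
      then have "\<pi> (r \<odot>\<^bsub>?P\<^esub> f) = (\<Oplus>\<^bsub>A\<^esub>x\<in>?X. \<iota> ((r \<odot>\<^bsub>?P\<^esub> f) x) \<otimes>\<^bsub>A\<^esub> x)"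
        by (simp only: \<pi>_def restrict_apply')
      also have "\<dots> = (\<Oplus>\<^bsub>A\<^esub>x\<in>?X. \<iota> r \<otimes>\<^bsub>A\<^esub> (\<iota> (f x) \<otimes>\<^bsub>A\<^esub> x))"
        using f r by (intro A.finsum_cong') (auto simp: PiE_iff A.m_assoc)
      also have "\<dots> = \<iota> r \<otimes>\<^bsub>A\<^esub> \<pi> f"
        using f r by (subst A.finsum_rdistr[symmetric]) (auto simp: PiE_iff \<pi>_def)
      finally show "\<pi> (r \<odot>\<^bsub>?P\<^esub> f) = r \<odot>\<^bsub>?M\<^esub> \<pi> f" by simp
    next
      fix f assume "f \<in> carrier ?P"
      then show "\<pi> f \<in> carrier ?M"
        by (auto simp: \<pi>_def PiE_iff intro!: A.finsum_closed)
    qed (simp add: \<pi>_def del: copies_simps)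
    fix m assume m: "m \<in> carrier ?M"
    then have "\<sigma> m \<in> carrier ?P" using c by (auto simp: \<sigma>_def)
    then have "\<pi> (\<sigma> m) = (\<Oplus>\<^bsub>A\<^esub>x\<in>?X. \<iota> (\<sigma> m x) \<otimes>\<^bsub>A\<^esub> x)"
      by (simp only: \<pi>_def restrict_apply')
    also have "\<dots> = (\<Oplus>\<^bsub>A\<^esub>x\<in>?X. \<Oplus>\<^bsub>A\<^esub>i\<in>{i \<in> I. a i = x}. \<iota> (E (m \<otimes>\<^bsub>A\<^esub> b i)) \<otimes>\<^bsub>A\<^esub> a i)"
    proof (intro A.finsum_cong')
      fix x assume x: "x \<in> ?X"
      have "\<iota> (\<sigma> m x) \<otimes>\<^bsub>A\<^esub> x = (\<Oplus>\<^bsub>A\<^esub>i\<in>{i \<in> I. a i = x}. \<iota> (E (m \<otimes>\<^bsub>A\<^esub> b i))) \<otimes>\<^bsub>A\<^esub> x"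
        using m x by (subst \<iota>_finsum[symmetric]) (auto simp: \<sigma>_def)
      also have "\<dots> = (\<Oplus>\<^bsub>A\<^esub>i\<in>{i \<in> I. a i = x}. \<iota> (E (m \<otimes>\<^bsub>A\<^esub> b i)) \<otimes>\<^bsub>A\<^esub> x)"
        using m x by (intro A.finsum_ldistr) auto
      also have "\<dots> = (\<Oplus>\<^bsub>A\<^esub>i\<in>{i \<in> I. a i = x}. \<iota> (E (m \<otimes>\<^bsub>A\<^esub> b i)) \<otimes>\<^bsub>A\<^esub> a i)"
        using m by (intro A.finsum_cong') auto
      finally show "\<iota> (\<sigma> m x) \<otimes>\<^bsub>A\<^esub> x = \<dots>" .
    qed (use m in \<open>auto intro!: A.finsum_closed\<close>)
    also have "\<dots> = (\<Oplus>\<^bsub>A\<^esub>i\<in>I. \<iota> (E (m \<otimes>\<^bsub>A\<^esub> b i)) \<otimes>\<^bsub>A\<^esub> a i)"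
      using m by (subst A.finsum_fibres[of I _ a]) auto
    also have "\<dots> = m" using m by (simp add: left_dual)
    finally show "\<pi> (\<sigma> m) = m" .
  qed
  then show ?thesis
    unfolding projective_module_def using left_module_A by blast
qed

text \<open>The isomorphism sends \<open>y\<close> to the functional
  \<open>x \<mapsto> E (x y)\<close>. It is injective since \<open>right_dual\<close> recovers
  \<open>y\<close> from the values \<open>E (a\<^sub>i y)\<close>, and surjective since by
  \<open>left_dual\<close> a functional is determined by its values on the
  \<open>a i\<close>.\<close>

lemma bimodule_isomorphic_dual: "bimodule_isomorphic A R (ring_as_bimodule A \<iota>) (dual_bimodule R A \<iota>)"
proof -
  let ?D = "lmod_hom R (ring_as_module A \<iota>) (regular_module R)"
  define \<phi> where "\<phi> = (\<lambda>y\<in>carrier A. \<lambda>x\<in>carrier A. E (x \<otimes>\<^bsub>A\<^esub> y))"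
  have \<phi>D: "\<phi> y \<in> ?D" if "y \<in> carrier A" for y
    using that by (intro lmod_homI) (auto simp: \<phi>_def A.l_distr A.m_assoc)
  have "\<phi> \<in> lmod_hom A (ring_as_bimodule A \<iota>) (dual_bimodule R A \<iota>)"
    using \<phi>D by (intro lmod_homI)
      (auto simp: ring_as_bimodule_def dual_bimodule_def \<phi>_def A.r_distr A.m_assoc fun_eq_iff)
  moreover have "inj_on \<phi> (carrier A)"
  proof (rule inj_onI)
    fix y z assume y: "y \<in> carrier A" and z: "z \<in> carrier A" and "\<phi> y = \<phi> z"
    then have "E (x \<otimes>\<^bsub>A\<^esub> y) = E (x \<otimes>\<^bsub>A\<^esub> z)" if "x \<in> carrier A" for x
      using that by (auto simp: \<phi>_def fun_eq_iff split: if_splits)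
    then have "(\<Oplus>\<^bsub>A\<^esub>i\<in>I. b i \<otimes>\<^bsub>A\<^esub> \<iota> (E (a i \<otimes>\<^bsub>A\<^esub> y))) = (\<Oplus>\<^bsub>A\<^esub>i\<in>I. b i \<otimes>\<^bsub>A\<^esub> \<iota> (E (a i \<otimes>\<^bsub>A\<^esub> z)))"
      using y z by (intro A.finsum_cong') auto
    then show "y = z" using y z by (simp add: right_dual)
  qed
  moreover have "f \<in> \<phi> ` carrier A" if f: "f \<in> ?D" for f
  proof
    note fD = lmod_homD[OF f, simplified]
    \<comment> \<open>The only candidate: if \<open>f\<close> is \<open>x \<mapsto> E (x y)\<close>,
      then \<open>right_dual\<close> expresses \<open>y\<close> by the values of \<open>f\<close> on
      the \<open>a i\<close>.\<close>
    let ?y = "\<Oplus>\<^bsub>A\<^esub>i\<in>I. b i \<otimes>\<^bsub>A\<^esub> \<iota> (f (a i))"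
    show y: "?y \<in> carrier A" using fD by (intro A.finsum_closed) auto
    show "f = \<phi> ?y"
    proof
      fix x
      show "f x = \<phi> ?y x"
      proof (cases "x \<in> carrier A")
        case x: True
        have "f x = f (\<Oplus>\<^bsub>A\<^esub>i\<in>I. \<iota> (E (x \<otimes>\<^bsub>A\<^esub> b i)) \<otimes>\<^bsub>A\<^esub> a i)"
          using x by (simp add: left_dual)
        also have "\<dots> = (\<Oplus>\<^bsub>R\<^esub>i\<in>I. f (\<iota> (E (x \<otimes>\<^bsub>A\<^esub> b i)) \<otimes>\<^bsub>A\<^esub> a i))"
          using x fD by (intro additive_finsum[OF A.is_abelian_group R.is_abelian_group] additiveI) auto
        \<comment> \<open>Left linearity of \<open>f\<close> takes \<open>E (x b\<^sub>i)\<close>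
          out on the left; \<open>E_right\<close> then moves \<open>f (a i)\<close> inside
          \<open>E\<close>.\<close>
        also have "\<dots> = (\<Oplus>\<^bsub>R\<^esub>i\<in>I. E (x \<otimes>\<^bsub>A\<^esub> (b i \<otimes>\<^bsub>A\<^esub> \<iota> (f (a i)))))"
          using x fD by (intro R.finsum_cong') (auto simp flip: A.m_assoc)
        also have "\<dots> = E (\<Oplus>\<^bsub>A\<^esub>i\<in>I. x \<otimes>\<^bsub>A\<^esub> (b i \<otimes>\<^bsub>A\<^esub> \<iota> (f (a i))))"
          using x fD by (intro E_finsum[symmetric]) auto
        also have "\<dots> = E (x \<otimes>\<^bsub>A\<^esub> ?y)"
          using x fD by (subst A.finsum_rdistr) auto
        finally show ?thesis using x y by (simp add: \<phi>_def)
      qed (use fD(1) y in \<open>simp add: \<phi>_def extensional_def\<close>)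
    qed
  qed
  then have "\<phi> ` carrier A = ?D" using \<phi>D by blast
  moreover have "\<phi> (x \<otimes>\<^bsub>A\<^esub> \<iota> r) = (\<lambda>y\<in>carrier A. \<phi> x y \<otimes>\<^bsub>R\<^esub> r)"
    if "x \<in> carrier A" "r \<in> carrier R" for x r
    using that by (auto simp: \<phi>_def fun_eq_iff simp flip: A.m_assoc)
  ultimately show ?thesis
    unfolding bimodule_isomorphic_def bij_betw_def
    by (intro bexI[of _ \<phi>]) (auto simp: ring_as_bimodule_def dual_bimodule_def)
qed

lemma frobenius_extensionI: "frobenius_extension R A \<iota>"
  unfolding frobenius_extension_def
  using R.ring_axioms A.ring_axioms \<iota>_hom finitely_generated_extension projective_extension bimodule_isomorphic_dual
  by blast

end

text \<open>\<open>E\<close> is the image of 1 under the given isomorphism \<phi>. A dual basis of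
  the projective module \<open>A\<close> supplies the \<open>a j\<close>, and its functionals take
  the form \<open>x \<mapsto> E (x b\<^sub>j)\<close> because \<phi> is onto. This is
  \<open>left_dual\<close>; \<open>right_dual\<close> follows from it by injectivity of
  \<phi>.\<close>

lemma frobenius_extensionE:
  assumes "frobenius_extension R A \<iota>"
  obtains E I and a b :: "'a \<Rightarrow> 'a" where "frobenius_system R (A :: ('a, 'x) ring_scheme) \<iota> E I a b"
proof -
  let ?M = "ring_as_module A \<iota>"
  have "ring R" "ring A" and \<iota>: "\<iota> \<in> ring_hom R A" and fg: "finitely_generated R ?M"
    and "projective_module R ?M"
    and bi: "bimodule_isomorphic A R (ring_as_bimodule A \<iota>) (dual_bimodule R A \<iota>)"
    using assms by (auto simp: frobenius_extension_def)
  then obtain X :: "'a set" where M: "left_module R ?M"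
    and X: "direct_summand R ?M (copies (regular_module R) X)"
    unfolding projective_module_def by blast
  interpret R: ring R by fact
  interpret A: ring A by fact
  interpret ring_extension R A \<iota> by unfold_locales (rule \<iota>)
  obtain F :: "'a set" and p q where F: "finite F"
    and p: "\<forall>j\<in>F. p j \<in> lmod_hom R (regular_module R) ?M"
    and q: "\<forall>j\<in>F. q j \<in> lmod_hom R ?M (regular_module R)"
    and pq: "\<forall>m\<in>carrier ?M. (\<Oplus>\<^bsub>?M\<^esub>j\<in>F. p j (q j m)) = m"
    by (rule summand_of_copies_decomposition[OF M left_module_regular[OF R.ring_axioms] X fg])
  let ?D = "lmod_hom R ?M (regular_module R)"
  obtain \<phi> where hom: "\<phi> \<in> lmod_hom A (ring_as_bimodule A \<iota>) (dual_bimodule R A \<iota>)"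
    and bij: "bij_betw \<phi> (carrier (ring_as_bimodule A \<iota>)) (carrier (dual_bimodule R A \<iota>))"
    and right: "\<forall>x\<in>carrier (ring_as_bimodule A \<iota>). \<forall>r\<in>carrier R.
      \<phi> (rsmult (ring_as_bimodule A \<iota>) x r) = rsmult (dual_bimodule R A \<iota>) (\<phi> x) r"
    using bi unfolding bimodule_isomorphic_def by blast
  have \<phi>r: "\<phi> (x \<otimes>\<^bsub>A\<^esub> \<iota> r) = (\<lambda>y\<in>carrier A. \<phi> x y \<otimes>\<^bsub>R\<^esub> r)" if "x \<in> carrier A" "r \<in> carrier R" for x r
    using bspec[OF bspec[OF right, of x], of r] that by (simp add: ring_as_bimodule_def dual_bimodule_def)
  have inj: "inj_on \<phi> (carrier A)" and onto: "\<phi> ` carrier A = ?D"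
    using bij by (simp_all add: bij_betw_def ring_as_bimodule_def dual_bimodule_def)
  have \<phi>_smult: "\<phi> (x \<otimes>\<^bsub>A\<^esub> y) = (\<lambda>z\<in>carrier A. \<phi> y (z \<otimes>\<^bsub>A\<^esub> x))" if "x \<in> carrier A" "y \<in> carrier A" for x y
    using lmod_homD(4)[OF hom, of x y] that by (simp add: ring_as_bimodule_def dual_bimodule_def)
  have \<phi>D: "\<phi> x \<in> ?D" if "x \<in> carrier A" for x using onto that by blast
  define E where "E = \<phi> \<one>\<^bsub>A\<^esub>"
  note ED = lmod_homD[OF \<phi>D[OF A.one_closed, folded E_def], simplified]
  have \<phi>_eq: "\<phi> y z = E (z \<otimes>\<^bsub>A\<^esub> y)" if "y \<in> carrier A" "z \<in> carrier A" for y z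
    using \<phi>_smult[of y "\<one>\<^bsub>A\<^esub>"] that by (simp add: E_def)
  \<comment> \<open>Both linearities of \<phi> meet here: \<open>\<phi> (\<iota> r)\<close> is
    \<open>E\<close> acted on by \<open>\<iota> r\<close> from the left and also by \<open>r\<close>
    from the right.\<close>
  have Er: "E (x \<otimes>\<^bsub>A\<^esub> \<iota> r) = E x \<otimes>\<^bsub>R\<^esub> r" if "x \<in> carrier A" "r \<in> carrier R" for x r
    using \<phi>_eq[of "\<iota> r" x] \<phi>r[of "\<one>\<^bsub>A\<^esub>" r] that by (simp add: E_def)
  \<comment> \<open>An \<open>R\<close>-map from the regular module is determined by its value at 1,
    so \<open>p j\<close> is \<open>r \<mapsto> \<iota> r \<otimes> a j\<close>.\<close>
  define a where "a j = p j \<one>\<^bsub>R\<^esub>" for j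
  define b where "b j = inv_into (carrier A) \<phi> (q j)" for j
  have a: "a j \<in> carrier A" if "j \<in> F" for j
    using lmod_homD(2)[OF bspec[OF p that]] by (simp add: a_def)
  have b: "b j \<in> carrier A" "\<phi> (b j) = q j" if "j \<in> F" for j
    using bspec[OF q that] onto by (auto simp: b_def inv_into_into f_inv_into_f)
  have qE: "q j x = E (x \<otimes>\<^bsub>A\<^esub> b j)" if "j \<in> F" "x \<in> carrier A" for j x
    using b[OF that(1)] \<phi>_eq[of "b j" x] that by simp
  have pa: "p j r = \<iota> r \<otimes>\<^bsub>A\<^esub> a j" if "j \<in> F" "r \<in> carrier R" for j r
    using lmod_homD(4)[OF bspec[OF p that(1)], of r "\<one>\<^bsub>R\<^esub>"] that by (simp add: a_def)
  have left: "(\<Oplus>\<^bsub>A\<^esub>i\<in>F. \<iota> (E (x \<otimes>\<^bsub>A\<^esub> b i)) \<otimes>\<^bsub>A\<^esub> a i) = x" if x: "x \<in> carrier A" for x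
  proof -
    have "(\<Oplus>\<^bsub>A\<^esub>i\<in>F. \<iota> (E (x \<otimes>\<^bsub>A\<^esub> b i)) \<otimes>\<^bsub>A\<^esub> a i) = (\<Oplus>\<^bsub>A\<^esub>i\<in>F. p i (q i x))"
      using x a b ED by (intro A.finsum_cong') (auto simp: pa qE)
    then show ?thesis using bspec[OF pq, of x] x by simp
  qed
  have right: "(\<Oplus>\<^bsub>A\<^esub>i\<in>F. b i \<otimes>\<^bsub>A\<^esub> \<iota> (E (a i \<otimes>\<^bsub>A\<^esub> x))) = x" (is "?s = x") if x: "x \<in> carrier A" for x
  proof -
    have s: "?s \<in> carrier A" using x a b ED by (intro A.finsum_closed) auto
    have E_add: "E \<in> hom (add_monoid A) (add_monoid R)" using ED by (auto intro!: additiveI)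
    \<comment> \<open>Equality for every \<open>y\<close> says that the sum and \<open>x\<close>
      have the same image under \<phi>. The factor \<open>E (a\<^sub>i x)\<close> leaves
      \<open>E\<close> on the right, \<open>E (y b\<^sub>i)\<close> enters on the left, and
      \<open>left\<close> applied to \<open>y\<close> collapses the sum.\<close>
    have "E (y \<otimes>\<^bsub>A\<^esub> ?s) = E (y \<otimes>\<^bsub>A\<^esub> x)" if y: "y \<in> carrier A" for y
    proof -
      have swap: "E (y \<otimes>\<^bsub>A\<^esub> (b i \<otimes>\<^bsub>A\<^esub> \<iota> (E (a i \<otimes>\<^bsub>A\<^esub> x)))) =
          E (\<iota> (E (y \<otimes>\<^bsub>A\<^esub> b i)) \<otimes>\<^bsub>A\<^esub> a i \<otimes>\<^bsub>A\<^esub> x)" if "i \<in> F" for i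
        using that x y a[OF that] b(1)[OF that] ED(2) ED(4)[of "E (y \<otimes>\<^bsub>A\<^esub> b i)" "a i \<otimes>\<^bsub>A\<^esub> x"]
          Er[of "y \<otimes>\<^bsub>A\<^esub> b i" "E (a i \<otimes>\<^bsub>A\<^esub> x)"]
          A.m_assoc[of y "b i" "\<iota> (E (a i \<otimes>\<^bsub>A\<^esub> x))"] A.m_assoc[of "\<iota> (E (y \<otimes>\<^bsub>A\<^esub> b i))" "a i" x]
        by simp
      have "E (y \<otimes>\<^bsub>A\<^esub> ?s) = E (\<Oplus>\<^bsub>A\<^esub>i\<in>F. y \<otimes>\<^bsub>A\<^esub> (b i \<otimes>\<^bsub>A\<^esub> \<iota> (E (a i \<otimes>\<^bsub>A\<^esub> x))))"
        using x y a b ED F by (subst A.finsum_rdistr) auto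
      also have "\<dots> = (\<Oplus>\<^bsub>R\<^esub>i\<in>F. E (y \<otimes>\<^bsub>A\<^esub> (b i \<otimes>\<^bsub>A\<^esub> \<iota> (E (a i \<otimes>\<^bsub>A\<^esub> x)))))"
        using x y a b ED by (intro additive_finsum[OF A.is_abelian_group R.is_abelian_group E_add]) auto
      also have "\<dots> = (\<Oplus>\<^bsub>R\<^esub>i\<in>F. E (\<iota> (E (y \<otimes>\<^bsub>A\<^esub> b i)) \<otimes>\<^bsub>A\<^esub> a i \<otimes>\<^bsub>A\<^esub> x))"
        using x y a b ED by (intro R.finsum_cong') (auto simp: swap)
      also have "\<dots> = E (\<Oplus>\<^bsub>A\<^esub>i\<in>F. \<iota> (E (y \<otimes>\<^bsub>A\<^esub> b i)) \<otimes>\<^bsub>A\<^esub> a i \<otimes>\<^bsub>A\<^esub> x)"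
        using x y a b ED by (intro additive_finsum[OF A.is_abelian_group R.is_abelian_group E_add, symmetric]) auto
      also have "(\<Oplus>\<^bsub>A\<^esub>i\<in>F. \<iota> (E (y \<otimes>\<^bsub>A\<^esub> b i)) \<otimes>\<^bsub>A\<^esub> a i \<otimes>\<^bsub>A\<^esub> x) = y \<otimes>\<^bsub>A\<^esub> x"
        using x y a b ED F by (subst A.finsum_ldistr[symmetric]) (auto simp: left)
      finally show ?thesis .
    qed
    then have "\<phi> ?s = \<phi> x"
      using lmod_homD(1)[OF \<phi>D[OF x]] lmod_homD(1)[OF \<phi>D[OF s]] x s
      by (intro extensionalityI[of _ "carrier A"]) (auto simp: \<phi>_eq)
    then show ?thesis using inj x s by (auto simp: inj_on_def)
  qed
  have "frobenius_system R A \<iota> E F a b"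
    by unfold_locales (use F a b ED Er left right in auto)
  then show thesis by (rule that)
qed

section \<open>Endomorphism rings\<close>

lemma End_ring_simps [simp]:
  "carrier (End_ring R M) = lmod_hom R M M"
  "s\<^sub>1 \<otimes>\<^bsub>End_ring R M\<^esub> s\<^sub>2 = compose (carrier M) s\<^sub>2 s\<^sub>1"
  "\<one>\<^bsub>End_ring R M\<^esub> = (\<lambda>x\<in>carrier M. x)"
  "\<zero>\<^bsub>End_ring R M\<^esub> = (\<lambda>x\<in>carrier M. \<zero>\<^bsub>M\<^esub>)"
  "s\<^sub>1 \<oplus>\<^bsub>End_ring R M\<^esub> s\<^sub>2 = (\<lambda>x\<in>carrier M. s\<^sub>1 x \<oplus>\<^bsub>M\<^esub> s\<^sub>2 x)"
  by (simp_all add: End_ring_def)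

lemma lmod_hom_eqI:
  assumes "f \<in> lmod_hom R M N" "g \<in> lmod_hom R M N" "\<And>x. x \<in> carrier M \<Longrightarrow> f x = g x"
  shows "f = g"
  using assms by (intro extensionalityI[of f "carrier M"]) (auto dest: lmod_homD)

context left_module
begin

lemma lmod_hom_compose' [intro]:
  assumes "f \<in> lmod_hom R M N" "g \<in> lmod_hom R N P"
  shows "compose (carrier M) g f \<in> lmod_hom R M P"
  using assms by (rule lmod_hom_compose) auto

lemma lmod_hom_add:
  assumes "f \<in> lmod_hom R N M" "g \<in> lmod_hom R N M" "left_module R N"
  shows "(\<lambda>x\<in>carrier N. f x \<oplus>\<^bsub>M\<^esub> g x) \<in> lmod_hom R N M"
proof -
  interpret N: left_module R N by fact
  show ?thesis
    using assms(1,2) by (intro lmod_homI) (auto simp: lmod_homD M.a_ac smult_r_distr)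
qed

lemma ring_End_ring: "ring (End_ring R M)"
proof -
  have add: "f \<oplus>\<^bsub>End_ring R M\<^esub> g \<in> carrier (End_ring R M)"
    if "f \<in> carrier (End_ring R M)" "g \<in> carrier (End_ring R M)" for f g
    using that lmod_hom_add left_module_axioms by simp
  have mult: "f \<otimes>\<^bsub>End_ring R M\<^esub> g \<in> carrier (End_ring R M)"
    if "f \<in> carrier (End_ring R M)" "g \<in> carrier (End_ring R M)" for f g
    using that by auto
  have zero: "\<zero>\<^bsub>End_ring R M\<^esub> \<in> carrier (End_ring R M)"
    and one: "\<one>\<^bsub>End_ring R M\<^esub> \<in> carrier (End_ring R M)"
    by (auto intro!: lmod_homI)
  have eqI: "f = g" if "f \<in> carrier (End_ring R M)" "g \<in> carrier (End_ring R M)"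
    "\<And>x. x \<in> carrier M \<Longrightarrow> f x = g x" for f g
    using lmod_hom_eqI[of f R M M g] that by simp
  have closed: "f x \<in> carrier M" if "f \<in> carrier (End_ring R M)" "x \<in> carrier M" for f x
    using lmod_homD(2) that by simp
  show ?thesis
  proof (rule ringI)
    show "abelian_group (End_ring R M)"
    proof (rule abelian_groupI)
      fix f assume f: "f \<in> carrier (End_ring R M)"
      have "(\<lambda>x\<in>carrier M. \<ominus>\<^bsub>M\<^esub> f x) \<in> carrier (End_ring R M)"
        unfolding End_ring_simps
      proof (rule lmod_homI)
        fix r x assume "r \<in> carrier R" "x \<in> carrier M"
        then show "(\<lambda>x\<in>carrier M. \<ominus>\<^bsub>M\<^esub> f x) (r \<odot>\<^bsub>M\<^esub> x) = r \<odot>\<^bsub>M\<^esub> (\<lambda>x\<in>carrier M. \<ominus>\<^bsub>M\<^esub> f x) x"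
          using f additive_minus[OF M.abelian_group_axioms M.abelian_group_axioms left_smult_additive, of r "f x"]
          by (simp add: lmod_homD)
      qed (use f in \<open>auto simp: lmod_homD M.minus_add\<close>)
      moreover have "(\<lambda>x\<in>carrier M. \<ominus>\<^bsub>M\<^esub> f x) \<oplus>\<^bsub>End_ring R M\<^esub> f = \<zero>\<^bsub>End_ring R M\<^esub>"
        using f by (auto simp: fun_eq_iff lmod_homD M.l_neg)
      ultimately show "\<exists>g\<in>carrier (End_ring R M). g \<oplus>\<^bsub>End_ring R M\<^esub> f = \<zero>\<^bsub>End_ring R M\<^esub>" by blast
    next
      fix f g h
      assume *: "f \<in> carrier (End_ring R M)" "g \<in> carrier (End_ring R M)" "h \<in> carrier (End_ring R M)"
      show "f \<oplus>\<^bsub>End_ring R M\<^esub> g \<oplus>\<^bsub>End_ring R M\<^esub> h = f \<oplus>\<^bsub>End_ring R M\<^esub> (g \<oplus>\<^bsub>End_ring R M\<^esub> h)"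
        using closed[OF *(1)] closed[OF *(2)] closed[OF *(3)] by (auto simp: fun_eq_iff M.a_assoc)
    next
      fix f g
      assume *: "f \<in> carrier (End_ring R M)" "g \<in> carrier (End_ring R M)"
      show "f \<oplus>\<^bsub>End_ring R M\<^esub> g = g \<oplus>\<^bsub>End_ring R M\<^esub> f"
        using closed[OF *(1)] closed[OF *(2)] by (auto simp: fun_eq_iff M.a_comm)
    next
      fix f
      assume *: "f \<in> carrier (End_ring R M)"
      show "\<zero>\<^bsub>End_ring R M\<^esub> \<oplus>\<^bsub>End_ring R M\<^esub> f = f"
        using closed[OF *] by (intro eqI add zero *) auto
    qed (rule add zero; assumption)+
    show "monoid (End_ring R M)"
    proof (rule monoidI)
      fix f g h
      assume *: "f \<in> carrier (End_ring R M)" "g \<in> carrier (End_ring R M)" "h \<in> carrier (End_ring R M)"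
      show "f \<otimes>\<^bsub>End_ring R M\<^esub> g \<otimes>\<^bsub>End_ring R M\<^esub> h = f \<otimes>\<^bsub>End_ring R M\<^esub> (g \<otimes>\<^bsub>End_ring R M\<^esub> h)"
        using closed[OF *(1)] by (intro eqI mult *) (auto simp: compose_def)
    next
      fix f
      assume *: "f \<in> carrier (End_ring R M)"
      show "\<one>\<^bsub>End_ring R M\<^esub> \<otimes>\<^bsub>End_ring R M\<^esub> f = f" "f \<otimes>\<^bsub>End_ring R M\<^esub> \<one>\<^bsub>End_ring R M\<^esub> = f"
        using closed[OF *] by (intro eqI mult one *; simp add: compose_def)+
    qed (rule mult one; assumption)+
    fix f g h
    assume *: "f \<in> carrier (End_ring R M)" "g \<in> carrier (End_ring R M)" "h \<in> carrier (End_ring R M)"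
    \<comment> \<open>In the product \<open>h\<close> acts last, so this distributive law rests on
      additivity of \<open>h\<close>; the next one holds by the pointwise definition of the
      sum.\<close>
    show "(f \<oplus>\<^bsub>End_ring R M\<^esub> g) \<otimes>\<^bsub>End_ring R M\<^esub> h = f \<otimes>\<^bsub>End_ring R M\<^esub> h \<oplus>\<^bsub>End_ring R M\<^esub> g \<otimes>\<^bsub>End_ring R M\<^esub> h"
      using closed[OF *(1)] closed[OF *(2)] *(3)
      by (intro eqI mult add *) (auto simp: compose_def lmod_homD)
    show "h \<otimes>\<^bsub>End_ring R M\<^esub> (f \<oplus>\<^bsub>End_ring R M\<^esub> g) = h \<otimes>\<^bsub>End_ring R M\<^esub> f \<oplus>\<^bsub>End_ring R M\<^esub> h \<otimes>\<^bsub>End_ring R M\<^esub> g"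
      using closed[OF *(3)] by (intro eqI mult add *) (auto simp: compose_def)
  qed
qed

text \<open>Evaluation at a point is additive on the endomorphism ring. This allows the dual basis
  identities of \<open>B\<close> to be checked elementwise.\<close>

lemma End_ring_finsum_apply:
  assumes "f \<in> J \<rightarrow> carrier (End_ring R M)" "x \<in> carrier M"
  shows "(\<Oplus>\<^bsub>End_ring R M\<^esub>j\<in>J. f j) x = (\<Oplus>\<^bsub>M\<^esub>j\<in>J. f j x)"
proof (rule additive_finsum[OF ring.is_abelian_group[OF ring_End_ring] M.abelian_group_axioms _ assms(1)])
  show "(\<lambda>f. f x) \<in> hom (add_monoid (End_ring R M)) (add_monoid M)"
    using assms(2) by (intro additiveI) (auto simp: lmod_homD)
qed

text \<open>The preimage of a submodule that contains the images of the generators contains the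
  generators, hence is everything.\<close>

lemma finitely_generated_image:
  assumes N: "left_module R N" and f: "f \<in> lmod_hom R M N" "carrier N \<subseteq> f ` carrier M"
    and fg: "finitely_generated R M"
  shows "finitely_generated R N"
proof -
  interpret N: left_module R N by fact
  note fD = lmod_homD(2-)[OF f(1)]
  have f0: "f \<zero>\<^bsub>M\<^esub> = \<zero>\<^bsub>N\<^esub>"
    by (rule additive_zero[OF M.abelian_group_axioms N.M.abelian_group_axioms lmod_hom_additive[OF f(1)]])
  obtain X where X: "finite X" "X \<subseteq> carrier M"
    and gen: "\<forall>U. submodule U R M \<longrightarrow> X \<subseteq> U \<longrightarrow> carrier M \<subseteq> U"
    by (rule finitely_generatedE[OF fg])
  show ?thesis
  proof (rule N.finitely_generatedI)
    fix U assume U: "submodule U R N" "f ` X \<subseteq> U"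
    have "submodule {m \<in> carrier M. f m \<in> U} R M"
      by (rule submoduleI) (use N.submoduleD[OF U(1)] fD f0 in auto)
    then have "carrier M \<subseteq> {m \<in> carrier M. f m \<in> U}"
      using gen X U(2) by blast
    then show "carrier N \<subseteq> U" using f(2) by auto
  qed (use X fD in auto)
qed

end

section \<open>Additive generators\<close>

text \<open>Transport of structure along a map \<open>h\<close>, meant to be injective on the
  carrier: an isomorphic copy of \<open>M\<close> in another type, where the quantifier in
  \<open>additive_generator\<close> applies.\<close>

definition image_module :: "('m \<Rightarrow> 'n) \<Rightarrow> ('r, 'm, 'y) module_scheme \<Rightarrow> ('r, 'n) module"
  where "image_module h M =
    \<lparr>carrier = h ` carrier M, monoid.mult = undefined, monoid.one = undefined,
     ring.zero = h \<zero>\<^bsub>M\<^esub>,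
     ring.add = (\<lambda>x y. h (inv_into (carrier M) h x \<oplus>\<^bsub>M\<^esub> inv_into (carrier M) h y)),
     module.smult = (\<lambda>r x. h (r \<odot>\<^bsub>M\<^esub> inv_into (carrier M) h x))\<rparr>"

lemma left_module_image:
  assumes "left_module R M" and inj: "inj_on h (carrier M)"
  shows "left_module R (image_module h M)"
    and "restrict h (carrier M) \<in> lmod_hom R M (image_module h M)"
    and "restrict (inv_into (carrier M) h) (h ` carrier M) \<in> lmod_hom R (image_module h M) M"
proof -
  interpret left_module R M by fact
  note [simp] = inv_into_f_f[OF inj] inj_on_eq_iff[OF inj]
  have simps: "carrier (image_module h M) = h ` carrier M" "\<zero>\<^bsub>image_module h M\<^esub> = h \<zero>\<^bsub>M\<^esub>"
    "\<And>x y. \<lbrakk>x \<in> carrier M; y \<in> carrier M\<rbrakk> \<Longrightarrow> h x \<oplus>\<^bsub>image_module h M\<^esub> h y = h (x \<oplus>\<^bsub>M\<^esub> y)"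
    "\<And>r x. x \<in> carrier M \<Longrightarrow> r \<odot>\<^bsub>image_module h M\<^esub> h x = h (r \<odot>\<^bsub>M\<^esub> x)"
    by (auto simp: image_module_def)
  have "abelian_group (image_module h M)"
    by (rule abelian_groupI) (auto simp: simps M.a_ac intro: M.l_neg)
  then show "left_module R (image_module h M)"
    by (rule left_moduleI[OF R.ring_axioms])
      (auto simp: simps smult_l_distr smult_r_distr smult_assoc1)
  show "restrict h (carrier M) \<in> lmod_hom R M (image_module h M)"
    by (rule lmod_homI) (auto simp: simps)
  show "restrict (inv_into (carrier M) h) (h ` carrier M) \<in> lmod_hom R (image_module h M) M"
    by (rule lmod_homI) (auto simp: simps)
qed

text \<open>An element of \<open>M\<close> is encoded by the set of its coordinate vectors.\<close>

lemma (in left_module) finitely_generated_embedding: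
  assumes "finitely_generated R M"
  obtains h :: "_ \<Rightarrow> (nat \<Rightarrow> 'a) set" where "inj_on h (carrier M)"
proof -
  obtain X where X: "finite X" "X \<subseteq> carrier M"
    and comb: "\<And>m. m \<in> carrier M \<Longrightarrow> \<exists>c\<in>X \<rightarrow> carrier R. m = (\<Oplus>\<^bsub>M\<^esub>x\<in>X. c x \<odot>\<^bsub>M\<^esub> x)"
    using finitely_generated_combinations[OF assms] by metis
  obtain k :: "_ \<Rightarrow> nat" where k: "inj_on k X"
    using finite_imp_inj_to_nat_seg[OF X(1)] by metis
  \<comment> \<open>The injection \<open>k\<close> numbers the generators, so coordinate vectors
    become functions on \<open>nat\<close>. A vector determines one value, so the sets of distinct
    elements are disjoint and nonemptiness yields injectivity. Entries off the image of
    \<open>k\<close> or outside \<open>R\<close> are unconstrained, which does no harm.\<close>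
  define h where "h m = {d. m = (\<Oplus>\<^bsub>M\<^esub>x\<in>X. d (k x) \<odot>\<^bsub>M\<^esub> x)}" for m
  have "h m \<noteq> {}" if m: "m \<in> carrier M" for m
  proof -
    obtain c where c: "c \<in> X \<rightarrow> carrier R" "m = (\<Oplus>\<^bsub>M\<^esub>x\<in>X. c x \<odot>\<^bsub>M\<^esub> x)"
      using comb[OF m] by blast
    have "(\<Oplus>\<^bsub>M\<^esub>x\<in>X. c (inv_into X k (k x)) \<odot>\<^bsub>M\<^esub> x) = m"
      unfolding c(2) using c(1) X(2) by (intro M.finsum_cong') (auto simp: inv_into_f_f[OF k])
    then have "c \<circ> inv_into X k \<in> h m" by (simp add: h_def)
    then show ?thesis by blast
  qed
  then have "inj_on h (carrier M)"
    unfolding inj_on_def h_def by blast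
  then show thesis by (rule that)
qed

text \<open>The generator hypothesis covers modules with elements in one type only. It is applied to
  the copy \<open>?M'\<close> of \<open>M\<close> in that type, and the resulting maps are composed
  with the isomorphism and its inverse.\<close>

lemma additive_generator_decomposition:
  fixes R :: "('r, 'x) ring_scheme" and M :: "('r, 'm, 'y) module_scheme"
  assumes T: "additive_generator R T" and M: "left_module R M" and fg: "finitely_generated R M"
  obtains F :: "nat set" and p q where "finite F"
    "\<forall>j\<in>F. p j \<in> lmod_hom R T M" "\<forall>j\<in>F. q j \<in> lmod_hom R M T"
    "\<forall>m\<in>carrier M. (\<Oplus>\<^bsub>M\<^esub>j\<in>F. p j (q j m)) = m"
proof -
  interpret M: left_module R M by fact
  interpret T: left_module R T
    using T by (simp add: additive_generator_def fin_gen_module_def)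
  obtain h :: "'m \<Rightarrow> (nat \<Rightarrow> 'r) set" where inj: "inj_on h (carrier M)"
    by (rule M.finitely_generated_embedding[OF fg])
  let ?M' = "image_module h M"
  let ?f = "restrict h (carrier M)" and ?g = "restrict (inv_into (carrier M) h) (h ` carrier M)"
  note image = left_module_image[OF M inj]
  interpret M': left_module R ?M' by (rule image(1))
  note gD = lmod_homD(2)[OF image(3)] and fD = lmod_homD(2)[OF image(2)]
  have gf: "?g (?f m) = m" if "m \<in> carrier M" for m
    using that inj by simp
  have fg': "finitely_generated R ?M'"
    by (rule M.finitely_generated_image[OF image(1,2) _ fg]) (auto simp: image_module_def)
  then have "in_add R T ?M'"
    using T image(1) unfolding additive_generator_def fin_gen_module_def by blast
  then obtain n :: nat where summand: "direct_summand R ?M' (copies T {..<n})"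
    by (auto simp: in_add_def)
  obtain F :: "nat set" and p q where F: "finite F"
    and p: "\<forall>j\<in>F. p j \<in> lmod_hom R T ?M'" and q: "\<forall>j\<in>F. q j \<in> lmod_hom R ?M' T"
    and pq: "\<forall>m\<in>carrier ?M'. (\<Oplus>\<^bsub>?M'\<^esub>j\<in>F. p j (q j m)) = m"
    by (rule summand_of_copies_decomposition[OF image(1) T.left_module_axioms summand fg'])
  show thesis
  proof (rule that[OF F])
    show "\<forall>j\<in>F. compose (carrier T) ?g (p j) \<in> lmod_hom R T M"
      using p image(3) T.lmod_hom_compose' by blast
    show "\<forall>j\<in>F. compose (carrier M) (q j) ?f \<in> lmod_hom R M T"
      using q image(2) M.lmod_hom_compose' by blast
    show "\<forall>m\<in>carrier M. (\<Oplus>\<^bsub>M\<^esub>j\<in>F. compose (carrier T) ?g (p j) (compose (carrier M) (q j) ?f m)) = m"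
    proof
      fix m assume m: "m \<in> carrier M"
      have c: "q j (?f m) \<in> carrier T" "p j (q j (?f m)) \<in> carrier ?M'" if "j \<in> F" for j
        using that p q fD[OF m] lmod_homD(2) by metis+
      have "(\<Oplus>\<^bsub>M\<^esub>j\<in>F. compose (carrier T) ?g (p j) (compose (carrier M) (q j) ?f m)) =
          (\<Oplus>\<^bsub>M\<^esub>j\<in>F. ?g (p j (q j (?f m))))"
        using c m gD by (intro M.M.finsum_cong') (simp_all add: compose_eq del: restrict_apply restrict_apply')
      also have "\<dots> = ?g (\<Oplus>\<^bsub>?M'\<^esub>j\<in>F. p j (q j (?f m)))"
        using c by (intro additive_finsum[OF M'.M.abelian_group_axioms M.M.abelian_group_axioms
            lmod_hom_additive[OF image(3)], symmetric]) auto
      also have "\<dots> = m" using pq fD[OF m] gf[OF m] by (simp del: restrict_apply restrict_apply')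
      finally show "(\<Oplus>\<^bsub>M\<^esub>j\<in>F. compose (carrier T) ?g (p j) (compose (carrier M) (q j) ?f m)) = m" .
    qed
  qed
qed

section \<open>Tensor products\<close>

locale tensor_product = ring_extension R A \<iota> + T: left_module R T
  for R :: "('r, 'x) ring_scheme" (structure) and A :: "('a, 'y) ring_scheme" (structure)
    and \<iota> and T :: "('r, 't, 'z) module_scheme" (structure)
begin

abbreviation M where "M \<equiv> induced_module R A \<iota> T"
abbreviation \<tau> where "\<tau> \<equiv> pure_tensor R A \<iota> T"
abbreviation G where "G \<equiv> tensor_pairs A T"
abbreviation N where "N \<equiv> tensor_null R A \<iota> T"
abbreviation \<pi> where "\<pi> x \<equiv> N #>\<^bsub>G\<^esub> x"

section \<open>The quotient group and the relations between pure tensors\<close>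

lemma comm_group_pairs: "comm_group G"
  by (rule abelian_free_Abelian_group)

lemma relations_subset: "tensor_relations R A \<iota> T \<subseteq> carrier G"
  by (rule tensor_relations_subset[OF A.ring_axioms T.left_module_axioms \<iota>_hom])

lemma subgroup_null: "subgroup N G"
  unfolding tensor_null_def by (rule group.generate_is_subgroup[OF _ relations_subset]) simp

lemma normal_null: "N \<lhd> G"
  using comm_group.subgroup_imp_normal[OF comm_group_pairs subgroup_null] .

lemma diff_closed_pairs: "\<lbrakk>x \<in> carrier G; y \<in> carrier G\<rbrakk> \<Longrightarrow> x - y \<in> carrier G"
  using keys_diff[of x y] by auto

lemma induced_module_simps:
  "carrier M = \<pi> ` carrier G" "\<zero>\<^bsub>M\<^esub> = N" "x \<oplus>\<^bsub>M\<^esub> y = x <#>\<^bsub>G\<^esub> y"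
  "c \<odot>\<^bsub>M\<^esub> x = tensor_map R A \<iota> T (\<lambda>a. c \<otimes>\<^bsub>A\<^esub> a) (\<lambda>t. t) x"
  by (simp_all add: induced_module_def Let_def carrier_FactGroup)

lemma abelian_group_tensor: "abelian_group M"
proof -
  interpret Q: comm_group "G Mod N"
    by (rule comm_group.abelian_FactGroup[OF comm_group_pairs subgroup_null])
  have M: "carrier M = carrier (G Mod N)" "\<zero>\<^bsub>M\<^esub> = \<one>\<^bsub>G Mod N\<^esub>" "x \<oplus>\<^bsub>M\<^esub> y = x \<otimes>\<^bsub>G Mod N\<^esub> y" for x y
    by (simp_all add: induced_module_def Let_def)
  show ?thesis
    by (rule abelian_groupI; unfold M)
      (rule Q.m_closed Q.one_closed Q.m_assoc Q.m_comm Q.l_one Q.l_inv_ex; assumption)+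
qed

sublocale M: abelian_group M by (rule abelian_group_tensor)

lemma proj_closed: "x \<in> carrier G \<Longrightarrow> \<pi> x \<in> carrier M"
  by (simp add: induced_module_simps del: carrier_free_Abelian_group_iff)

lemma proj_add: "\<lbrakk>x \<in> carrier G; y \<in> carrier G\<rbrakk> \<Longrightarrow> \<pi> (x + y) = \<pi> x \<oplus>\<^bsub>M\<^esub> \<pi> y"
  using normal.rcos_sum[OF normal_null, of x y]
  by (simp add: induced_module_simps del: carrier_free_Abelian_group_iff)

lemma proj_null: "n \<in> N \<Longrightarrow> \<pi> n = \<zero>\<^bsub>M\<^esub>"
  using group.coset_join2[OF group_free_Abelian_group _ subgroup_null, of n]
    subgroup.mem_carrier[OF subgroup_null, of n]
  by (simp add: induced_module_simps)

lemma proj_eq_zero: "\<lbrakk>x \<in> carrier G; \<pi> x = \<zero>\<^bsub>M\<^esub>\<rbrakk> \<Longrightarrow> x \<in> N"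
  using group.coset_join1[OF group_free_Abelian_group _ _ subgroup_null]
  by (simp add: induced_module_simps)

lemma proj_diff:
  assumes "x \<in> carrier G" "y \<in> carrier G"
  shows "\<pi> (x - y) = \<pi> x \<ominus>\<^bsub>M\<^esub> \<pi> y"
proof -
  have "\<pi> x = \<pi> (x - y) \<oplus>\<^bsub>M\<^esub> \<pi> y"
    using proj_add[OF diff_closed_pairs[OF assms] assms(2)] by simp
  then show ?thesis
    using proj_closed[OF diff_closed_pairs[OF assms]] proj_closed[OF assms(2)]
    by (simp add: a_minus_def M.a_assoc M.r_neg)
qed

lemma pure_tensor_eq: "\<tau> a t = \<pi> (frag_of (a, t))"
  by (simp add: pure_tensor_def)

lemma pure_tensor_closed [simp, intro]: "\<lbrakk>a \<in> carrier A; t \<in> carrier T\<rbrakk> \<Longrightarrow> \<tau> a t \<in> carrier M"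
  unfolding pure_tensor_eq by (rule proj_closed) simp

lemma proj_eqI:
  assumes "x \<in> carrier G" "y \<in> carrier G" "x - y \<in> tensor_relations R A \<iota> T"
  shows "\<pi> x = \<pi> y"
proof -
  have "x - y \<in> N" using assms(3) by (simp add: tensor_null_def generate.incl)
  then have "\<pi> x \<ominus>\<^bsub>M\<^esub> \<pi> y = \<zero>\<^bsub>M\<^esub>"
    using proj_diff[OF assms(1,2)] proj_null by simp
  then show ?thesis
    using proj_closed[OF assms(1)] proj_closed[OF assms(2)]
    by (metis M.add.inv_closed M.add.inv_equality M.add.inv_inv a_minus_def)
qed

lemma add_closed_pairs: "\<lbrakk>x \<in> carrier G; y \<in> carrier G\<rbrakk> \<Longrightarrow> x + y \<in> carrier G"
  using keys_add[of x y] by auto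

lemma pure_tensor_add_left:
  assumes "a \<in> carrier A" "a' \<in> carrier A" "t \<in> carrier T"
  shows "\<tau> (a \<oplus>\<^bsub>A\<^esub> a') t = \<tau> a t \<oplus>\<^bsub>M\<^esub> \<tau> a' t"
proof -
  have "\<pi> (frag_of (a \<oplus>\<^bsub>A\<^esub> a', t)) = \<pi> (frag_of (a, t) + frag_of (a', t))"
    using assms by (intro proj_eqI add_closed_pairs) (auto simp: tensor_relations_def diff_diff_eq[symmetric])
  then show ?thesis using assms by (subst (asm) proj_add) (auto simp: pure_tensor_eq)
qed

lemma pure_tensor_add_right:
  assumes "a \<in> carrier A" "t \<in> carrier T" "t' \<in> carrier T"
  shows "\<tau> a (t \<oplus>\<^bsub>T\<^esub> t') = \<tau> a t \<oplus>\<^bsub>M\<^esub> \<tau> a t'"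
proof -
  have "\<pi> (frag_of (a, t \<oplus>\<^bsub>T\<^esub> t')) = \<pi> (frag_of (a, t) + frag_of (a, t'))"
    using assms by (intro proj_eqI add_closed_pairs) (auto simp: tensor_relations_def diff_diff_eq[symmetric])
  then show ?thesis using assms by (subst (asm) proj_add) (auto simp: pure_tensor_eq)
qed

lemma pure_tensor_balanced:
  assumes "a \<in> carrier A" "r \<in> carrier R" "t \<in> carrier T"
  shows "\<tau> (a \<otimes>\<^bsub>A\<^esub> \<iota> r) t = \<tau> a (r \<odot>\<^bsub>T\<^esub> t)"
  unfolding pure_tensor_eq using assms by (intro proj_eqI) (auto simp: tensor_relations_def)

lemma pure_tensor_additive_left:
  "t \<in> carrier T \<Longrightarrow> (\<lambda>a. \<tau> a t) \<in> hom (add_monoid A) (add_monoid M)"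
  by (auto intro!: additiveI simp: pure_tensor_add_left)

lemma pure_tensor_additive_right:
  "a \<in> carrier A \<Longrightarrow> (\<lambda>t. \<tau> a t) \<in> hom (add_monoid T) (add_monoid M)"
  by (auto intro!: additiveI simp: pure_tensor_add_right)

section \<open>Induction on tensors and the universal property\<close>

lemma tensor_induct [consumes 1, case_names zero diff pure]:
  assumes "w \<in> carrier M" "P \<zero>\<^bsub>M\<^esub>"
    and diff: "\<And>x y. \<lbrakk>x \<in> carrier M; y \<in> carrier M; P x; P y\<rbrakk> \<Longrightarrow> P (x \<ominus>\<^bsub>M\<^esub> y)"
    and pure: "\<And>a t. \<lbrakk>a \<in> carrier A; t \<in> carrier T\<rbrakk> \<Longrightarrow> P (\<tau> a t)"
  shows "P w"
proof -
  obtain x where x: "x \<in> carrier G" "w = \<pi> x"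
    using assms(1) unfolding induced_module_simps by blast
  then have "Poly_Mapping.keys x \<subseteq> carrier A \<times> carrier T" by simp
  then have "P (\<pi> x)"
  \<comment> \<open>A free abelian group is reached from zero and its generators by differences,
    which also produce the negative coefficients.\<close>
  proof (rule free_Abelian_group_induct[where P = "\<lambda>x. P (\<pi> x)"])
    have "(0 :: _ \<Rightarrow>\<^sub>0 int) \<in> N"
      using subgroup.one_closed[OF subgroup_null] by simp
    then show "P (\<pi> 0)" using assms(2) by (simp add: proj_null)
  next
    fix x y :: "'a \<times> 't \<Rightarrow>\<^sub>0 int"
    assume "Poly_Mapping.keys x \<subseteq> carrier A \<times> carrier T" "Poly_Mapping.keys y \<subseteq> carrier A \<times> carrier T"
      "P (\<pi> x)" "P (\<pi> y)"
    then show "P (\<pi> (x - y))" using diff[of "\<pi> x" "\<pi> y"] proj_closed proj_diff by simp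
  next
    fix p assume "p \<in> carrier A \<times> carrier T"
    then show "P (\<pi> (frag_of p))" using pure[of "fst p" "snd p"] by (auto simp: pure_tensor_eq)
  qed
  then show ?thesis using x by simp
qed

text \<open>The pure tensors generate \<open>M\<close> as an abelian group. Most later identities
  between maps on \<open>M\<close> are proved by this rule.\<close>

lemma tensor_ext:
  assumes H: "abelian_group H"
    and f: "f \<in> hom (add_monoid M) (add_monoid H)" and k: "k \<in> hom (add_monoid M) (add_monoid H)"
    and pure: "\<And>a t. \<lbrakk>a \<in> carrier A; t \<in> carrier T\<rbrakk> \<Longrightarrow> f (\<tau> a t) = k (\<tau> a t)"
    and w: "w \<in> carrier M"
  shows "f w = k w"
  using w
proof (induction rule: tensor_induct)
  case zero
  then show ?case
    using additive_zero[OF M.abelian_group_axioms H f] additive_zero[OF M.abelian_group_axioms H k] by simp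
next
  case (diff x y)
  then show ?case
    using additive_minus[OF M.abelian_group_axioms H f] additive_minus[OF M.abelian_group_axioms H k]
    by (simp add: a_minus_def additiveD[OF f] additiveD[OF k])
qed (rule pure)

text \<open>The universal property of the free abelian group gives a homomorphism on formal sums.
  Biadditivity and balancing put the relations into its kernel, so it descends to the
  quotient.\<close>

lemma tensor_universal:
  assumes H: "abelian_group H"
    and closed: "\<And>a t. \<lbrakk>a \<in> carrier A; t \<in> carrier T\<rbrakk> \<Longrightarrow> f a t \<in> carrier H"
    and left: "\<And>a a' t. \<lbrakk>a \<in> carrier A; a' \<in> carrier A; t \<in> carrier T\<rbrakk> \<Longrightarrow>
      f (a \<oplus>\<^bsub>A\<^esub> a') t = f a t \<oplus>\<^bsub>H\<^esub> f a' t"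
    and right: "\<And>a t t'. \<lbrakk>a \<in> carrier A; t \<in> carrier T; t' \<in> carrier T\<rbrakk> \<Longrightarrow>
      f a (t \<oplus>\<^bsub>T\<^esub> t') = f a t \<oplus>\<^bsub>H\<^esub> f a t'"
    and balanced: "\<And>a r t. \<lbrakk>a \<in> carrier A; r \<in> carrier R; t \<in> carrier T\<rbrakk> \<Longrightarrow>
      f (a \<otimes>\<^bsub>A\<^esub> \<iota> r) t = f a (r \<odot>\<^bsub>T\<^esub> t)"
  obtains h where "h \<in> hom (add_monoid M) (add_monoid H)"
    "\<forall>a\<in>carrier A. \<forall>t\<in>carrier T. h (\<tau> a t) = f a t"
proof -
  interpret H: abelian_group H by fact
  obtain k where k: "k \<in> hom G (add_monoid H)"
    and kf: "\<And>p. p \<in> carrier A \<times> carrier T \<Longrightarrow> k (frag_of p) = case_prod f p"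
    using comm_group.free_Abelian_group_universal[OF H.a_comm_group, of "case_prod f" "carrier A \<times> carrier T"]
      closed by (auto simp: image_subset_iff)
  have k_add: "k (x + y) = k x \<oplus>\<^bsub>H\<^esub> k y" if "x \<in> carrier G" "y \<in> carrier G" for x y
    using hom_mult[OF k that] by simp
  have k_closed: "k x \<in> carrier H" if "x \<in> carrier G" for x
    using hom_in_carrier[OF k that] by simp
  have k_diff: "k (x - y) = k x \<ominus>\<^bsub>H\<^esub> k y" if "x \<in> carrier G" "y \<in> carrier G" for x y
    using k_add[OF diff_closed_pairs[OF that] that(2)] k_closed[OF diff_closed_pairs[OF that]] k_closed[OF that(2)]
    by (simp add: a_minus_def H.a_assoc H.r_neg)
  have of: "frag_of (a, t) \<in> carrier G" if "a \<in> carrier A" "t \<in> carrier T" for a t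
    using that by simp
  \<comment> \<open>The image of a biadditivity relation has exactly this shape; that of a balancing
    relation has the shape of \<open>self\<close>.\<close>
  have cancel: "u \<oplus>\<^bsub>H\<^esub> v \<ominus>\<^bsub>H\<^esub> u \<ominus>\<^bsub>H\<^esub> v = \<zero>\<^bsub>H\<^esub>"
    if "u \<in> carrier H" "v \<in> carrier H" for u v
  proof -
    have "u \<oplus>\<^bsub>H\<^esub> v \<ominus>\<^bsub>H\<^esub> u \<ominus>\<^bsub>H\<^esub> v = (u \<oplus>\<^bsub>H\<^esub> v) \<oplus>\<^bsub>H\<^esub> (\<ominus>\<^bsub>H\<^esub> u \<oplus>\<^bsub>H\<^esub> \<ominus>\<^bsub>H\<^esub> v)"
      using that by (simp add: a_minus_def H.a_assoc)
    also have "\<dots> = (u \<oplus>\<^bsub>H\<^esub> v) \<oplus>\<^bsub>H\<^esub> \<ominus>\<^bsub>H\<^esub> (u \<oplus>\<^bsub>H\<^esub> v)"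
      using that by (simp add: H.minus_add)
    also have "\<dots> = \<zero>\<^bsub>H\<^esub>" using that by (intro H.r_neg) simp
    finally show ?thesis .
  qed
  have self: "u \<ominus>\<^bsub>H\<^esub> u = \<zero>\<^bsub>H\<^esub>" if "u \<in> carrier H" for u
    using that by (simp add: a_minus_def H.r_neg)
  have rel: "k x = \<zero>\<^bsub>H\<^esub>" if "x \<in> tensor_relations R A \<iota> T" for x
    using that unfolding tensor_relations_def
    by (auto simp: k_diff kf of diff_closed_pairs left right balanced closed cancel self
        simp del: carrier_free_Abelian_group_iff)
  have null: "k n = \<zero>\<^bsub>H\<^esub>" if "n \<in> N" for n
  proof -
    interpret k: group_hom G "add_monoid H" k
      using k H.a_group by (simp add: group_hom_def group_hom_axioms_def)
    have "N \<subseteq> kernel G (add_monoid H) k"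
      unfolding tensor_null_def
      by (rule group.generate_subgroup_incl[OF group_free_Abelian_group _ k.subgroup_kernel])
        (use rel relations_subset in \<open>auto simp: kernel_def simp del: carrier_free_Abelian_group_iff\<close>)
    then show ?thesis using that by (auto simp: kernel_def)
  qed
  have "k x = k y" if "x \<in> carrier G" "y \<in> carrier G" "\<pi> x = \<pi> y" for x y
  proof -
    have "\<pi> (x - y) = \<zero>\<^bsub>M\<^esub>"
      using that(3) proj_diff[OF that(1,2)] proj_closed[OF that(2)] by (simp add: M.r_neg a_minus_def)
    then have "k x \<ominus>\<^bsub>H\<^esub> k y = \<zero>\<^bsub>H\<^esub>"
      using null proj_eq_zero[OF diff_closed_pairs[OF that(1,2)]] k_diff[OF that(1,2)] by simp
    then show ?thesis using k_closed[OF that(1)] k_closed[OF that(2)]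
      by (metis H.add.inv_closed H.add.inv_equality H.add.inv_inv a_minus_def)
  qed
  then obtain h where h: "h \<in> hom (G Mod N) (add_monoid H)" "\<And>x. x \<in> carrier G \<Longrightarrow> h (\<pi> x) = k x"
    using FactGroup_universal[OF k normal_null] by metis
  show thesis
  proof (rule that)
    show "h \<in> hom (add_monoid M) (add_monoid H)"
      using h(1) by (simp add: hom_def induced_module_def Let_def)
    show "\<forall>a\<in>carrier A. \<forall>t\<in>carrier T. h (\<tau> a t) = f a t"
      using h(2)[OF of] kf by (simp add: pure_tensor_eq)
  qed
qed

text \<open>\<open>tensor_map\<close> is a set operation on cosets, so additivity is not visible
  from it. It is shown to agree with the additive map \<open>k\<close> given by the universal
  property. The second alternative for \<open>h\<close> serves the scalar action: the plain identity
  is in general not extensional and so not in \<open>lmod_hom\<close>.\<close>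

lemma tensor_map_additive:
  assumes g: "g \<in> carrier A \<rightarrow> carrier A"
      "\<And>a b. \<lbrakk>a \<in> carrier A; b \<in> carrier A\<rbrakk> \<Longrightarrow> g (a \<oplus>\<^bsub>A\<^esub> b) = g a \<oplus>\<^bsub>A\<^esub> g b"
      "\<And>a r. \<lbrakk>a \<in> carrier A; r \<in> carrier R\<rbrakk> \<Longrightarrow> g (a \<otimes>\<^bsub>A\<^esub> \<iota> r) = g a \<otimes>\<^bsub>A\<^esub> \<iota> r"
    and h: "h \<in> lmod_hom R T T \<or> h = (\<lambda>t. t)"
  shows "tensor_map R A \<iota> T g h \<in> hom (add_monoid M) (add_monoid M)"
proof -
  let ?F = "frag_extend (\<lambda>(a, t). frag_of (g a, h t))"
  have h_closed: "h t \<in> carrier T" if "t \<in> carrier T" for t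
    using h that by (auto simp: lmod_homD)
  have h_add: "h (t \<oplus>\<^bsub>T\<^esub> t') = h t \<oplus>\<^bsub>T\<^esub> h t'" if "t \<in> carrier T" "t' \<in> carrier T" for t t'
    using h that by (auto simp: lmod_homD)
  have h_smult: "h (r \<odot>\<^bsub>T\<^esub> t) = r \<odot>\<^bsub>T\<^esub> h t" if "r \<in> carrier R" "t \<in> carrier T" for r t
    using h that by (auto simp: lmod_homD)
  have gA: "g a \<in> carrier A" if "a \<in> carrier A" for a using g(1) that by blast
  obtain k where k: "k \<in> hom (add_monoid M) (add_monoid M)"
    and kpure: "\<forall>a\<in>carrier A. \<forall>t\<in>carrier T. k (\<tau> a t) = \<tau> (g a) (h t)"
    by (rule tensor_universal[OF abelian_group_tensor, of "\<lambda>a t. \<tau> (g a) (h t)"])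
      (use gA g h_closed h_add h_smult in \<open>auto simp: pure_tensor_add_left pure_tensor_add_right pure_tensor_balanced\<close>)
  have F_closed: "?F x \<in> carrier G" if "x \<in> carrier G" for x
  proof -
    have "Poly_Mapping.keys ((\<lambda>(a, t). frag_of (g a, h t) :: _ \<Rightarrow>\<^sub>0 int) p) \<subseteq> carrier A \<times> carrier T"
      if "p \<in> Poly_Mapping.keys x" for p
    proof -
      have "p \<in> carrier A \<times> carrier T" using that \<open>x \<in> carrier G\<close> by auto
      then show ?thesis using gA h_closed by (cases p) simp
    qed
    then have "Poly_Mapping.keys (?F x) \<subseteq> carrier A \<times> carrier T"
      using keys_frag_extend by (rule order_trans[OF _ UN_least, rotated])
    then show ?thesis by simp
  qed
  have k_proj: "k (\<pi> x) = \<pi> (?F x)" if "x \<in> carrier G" for x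
  proof -
    have "Poly_Mapping.keys x \<subseteq> carrier A \<times> carrier T" using that by simp
    then show ?thesis
    proof (rule free_Abelian_group_induct[where P = "\<lambda>x. k (\<pi> x) = \<pi> (?F x)"])
      have "(0 :: _ \<Rightarrow>\<^sub>0 int) \<in> N"
        using subgroup.one_closed[OF subgroup_null] by simp
      then show "k (\<pi> 0) = \<pi> (?F 0)" using additive_zero[OF abelian_group_tensor abelian_group_tensor k]
        by (simp add: proj_null)
    next
      fix x y :: "'a \<times> 't \<Rightarrow>\<^sub>0 int"
      assume "Poly_Mapping.keys x \<subseteq> carrier A \<times> carrier T" "Poly_Mapping.keys y \<subseteq> carrier A \<times> carrier T"
        and IH: "k (\<pi> x) = \<pi> (?F x)" "k (\<pi> y) = \<pi> (?F y)"
      then have xy: "x \<in> carrier G" "y \<in> carrier G" by simp_all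
      show "k (\<pi> (x - y)) = \<pi> (?F (x - y))"
        using IH proj_diff[OF xy] proj_diff[OF F_closed[OF xy(1)] F_closed[OF xy(2)]]
          proj_closed[OF xy(1)] proj_closed[OF xy(2)]
          additive_minus[OF abelian_group_tensor abelian_group_tensor k]
        by (simp add: frag_extend_diff a_minus_def additiveD[OF k])
    next
      fix p assume "p \<in> carrier A \<times> carrier T"
      then show "k (\<pi> (frag_of p)) = \<pi> (?F (frag_of p))" using kpure by (auto simp: pure_tensor_eq)
    qed
  qed
  have F_null: "?F n \<in> N" if "n \<in> N" for n
  proof -
    have n: "n \<in> carrier G" using subgroup.mem_carrier[OF subgroup_null that] .
    have "\<pi> (?F n) = \<zero>\<^bsub>M\<^esub>"
      using k_proj[OF n] proj_null[OF that] additive_zero[OF abelian_group_tensor abelian_group_tensor k]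
      by simp
    then show ?thesis using proj_eq_zero F_closed[OF n] by blast
  qed
  have N_add: "x + y \<in> N" if "x \<in> N" "y \<in> N" for x y
    using subgroup.m_closed[OF subgroup_null that] by simp
  have N_zero: "0 \<in> N" using subgroup.one_closed[OF subgroup_null] by simp
  \<comment> \<open>The image of the coset of \<open>x\<close> lies inside the coset of
    \<open>?F x\<close> because \<open>?F\<close> preserves \<open>N\<close>; the extra summand
    \<open>N\<close> fills up that coset.\<close>
  have map: "tensor_map R A \<iota> T g h (\<pi> x) = \<pi> (?F x)" for x
  proof (intro equalityI subsetI)
    fix y assume "y \<in> tensor_map R A \<iota> T g h (\<pi> x)"
    then obtain m n where "m \<in> N" "n \<in> N" "y = m + ?F (n + x)"
      unfolding tensor_map_def set_mult_def r_coset_def by auto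
    then show "y \<in> \<pi> (?F x)"
      using N_add[OF _ F_null, of m n] by (auto simp: r_coset_def frag_extend_add add.assoc)
  next
    fix y assume "y \<in> \<pi> (?F x)"
    then obtain m where "m \<in> N" "y = m + ?F (0 + x)"
      by (auto simp: r_coset_def)
    then show "y \<in> tensor_map R A \<iota> T g h (\<pi> x)"
      using N_zero unfolding tensor_map_def set_mult_def r_coset_def mult_free_Abelian_group by blast
  qed
  have "tensor_map R A \<iota> T g h w = k w" if "w \<in> carrier M" for w
    using that map k_proj unfolding induced_module_simps(1) by auto
  then show ?thesis
    using k additiveD[OF k] by (intro additiveI) auto
qed

section \<open>The \<open>A\<close>-module structure and the adjunction with restriction of
  scalars\<close>

lemma smult_pure_tensor [simp]:
  "\<lbrakk>c \<in> carrier A; a \<in> carrier A; t \<in> carrier T\<rbrakk> \<Longrightarrow> c \<odot>\<^bsub>M\<^esub> \<tau> a t = \<tau> (c \<otimes>\<^bsub>A\<^esub> a) t"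
  by (rule induced_module_smult_pure_tensor[OF A.ring_axioms T.left_module_axioms \<iota>_hom])

text \<open>The laws involving products or sums of scalars compare two additive maps of the tensor,
  so \<open>tensor_ext\<close> reduces them to ring laws in the left factor.\<close>

lemma left_module_tensor: "left_module A M"
proof -
  have smult: "(\<lambda>w. c \<odot>\<^bsub>M\<^esub> w) \<in> hom (add_monoid M) (add_monoid M)" if "c \<in> carrier A" for c
    unfolding induced_module_simps
    using that by (intro tensor_map_additive[unfolded induced_module_simps]) (auto simp: A.r_distr A.m_assoc)
  note ext = tensor_ext[OF abelian_group_tensor]
  show ?thesis
  proof (rule left_moduleI[OF A.ring_axioms abelian_group_tensor])
    fix a b w assume *: "a \<in> carrier A" "b \<in> carrier A" "w \<in> carrier M"
    show "(a \<oplus>\<^bsub>A\<^esub> b) \<odot>\<^bsub>M\<^esub> w = a \<odot>\<^bsub>M\<^esub> w \<oplus>\<^bsub>M\<^esub> b \<odot>\<^bsub>M\<^esub> w"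
      by (rule ext[OF smult[OF A.a_closed[OF *(1,2)]] M.additive_add[OF smult[OF *(1)] smult[OF *(2)]]])
        (use * in \<open>auto simp: A.l_distr pure_tensor_add_left\<close>)
    show "(a \<otimes>\<^bsub>A\<^esub> b) \<odot>\<^bsub>M\<^esub> w = a \<odot>\<^bsub>M\<^esub> (b \<odot>\<^bsub>M\<^esub> w)"
      by (rule ext[OF smult[OF A.m_closed[OF *(1,2)]] additive_comp[OF smult[OF *(2)] smult[OF *(1)]]]) (use * in \<open>auto simp: A.m_assoc\<close>)
  next
    fix w assume w: "w \<in> carrier M"
    show "\<one>\<^bsub>A\<^esub> \<odot>\<^bsub>M\<^esub> w = w"
      by (rule ext[OF smult[OF A.one_closed] additive_id]) (use w in auto)
  qed (use additiveD[OF smult] in auto)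
qed

sublocale MA: left_module A M by (rule left_module_tensor)

text \<open>The existence half of the tensor-hom adjunction: an \<open>R\<close>-map from
  \<open>T\<close> to an \<open>A\<close>-module extends to an \<open>A\<close>-map on
  \<open>M\<close>. It turns \<open>p j\<close> into \<open>x j\<close>.\<close>

lemma tensor_lift:
  assumes P: "left_module A P"
    and f: "f \<in> hom (add_monoid T) (add_monoid P)"
      "\<And>r t. \<lbrakk>r \<in> carrier R; t \<in> carrier T\<rbrakk> \<Longrightarrow> f (r \<odot>\<^bsub>T\<^esub> t) = \<iota> r \<odot>\<^bsub>P\<^esub> f t"
  shows "\<exists>h\<in>lmod_hom A M P. \<forall>a\<in>carrier A. \<forall>t\<in>carrier T. h (\<tau> a t) = a \<odot>\<^bsub>P\<^esub> f t"
proof -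
  interpret P: left_module A P by fact
  obtain h where h: "h \<in> hom (add_monoid M) (add_monoid P)"
    and pure: "\<forall>a\<in>carrier A. \<forall>t\<in>carrier T. h (\<tau> a t) = a \<odot>\<^bsub>P\<^esub> f t"
    by (rule tensor_universal[OF P.M.abelian_group_axioms, of "\<lambda>a t. a \<odot>\<^bsub>P\<^esub> f t"])
      (auto simp: additiveD[OF f(1)] f(2) P.smult_l_distr P.smult_r_distr P.smult_assoc1)
  have smult: "h (c \<odot>\<^bsub>M\<^esub> w) = c \<odot>\<^bsub>P\<^esub> h w" if "c \<in> carrier A" "w \<in> carrier M" for c w
    by (rule tensor_ext[OF P.M.abelian_group_axioms additive_comp[OF MA.left_smult_additive[OF that(1)] h]
          additive_comp[OF h P.left_smult_additive[OF that(1)]]])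
      (use that in \<open>auto simp: pure P.smult_assoc1 additiveD[OF f(1)]\<close>)
  show ?thesis
    using pure smult by (intro bexI[of _ "restrict h (carrier M)"] lmod_homI) (auto simp: additiveD[OF h])
qed

lemma induced_End_pure [simp]:
  "\<lbrakk>s \<in> lmod_hom R T T; a \<in> carrier A; t \<in> carrier T\<rbrakk> \<Longrightarrow>
    induced_End R A \<iota> T s (\<tau> a t) = \<tau> a (s t)"
  by (rule induced_End_pure_tensor[OF A.ring_axioms T.left_module_axioms \<iota>_hom])

lemma induced_End_closed:
  assumes s: "s \<in> lmod_hom R T T"
  shows "induced_End R A \<iota> T s \<in> lmod_hom A M M"
proof -
  have hom: "tensor_map R A \<iota> T (\<lambda>a. a) s \<in> hom (add_monoid M) (add_monoid M)"
    using s by (intro tensor_map_additive) auto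
  have eq: "induced_End R A \<iota> T s w = tensor_map R A \<iota> T (\<lambda>a. a) s w" if "w \<in> carrier M" for w
    using that by (simp add: induced_End_def)
  have pure: "tensor_map R A \<iota> T (\<lambda>a. a) s (\<tau> a t) = \<tau> a (s t)" if "a \<in> carrier A" "t \<in> carrier T" for a t
    using induced_End_pure[OF s that] eq[OF pure_tensor_closed[OF that]] by simp
  have "tensor_map R A \<iota> T (\<lambda>a. a) s (c \<odot>\<^bsub>M\<^esub> w) = c \<odot>\<^bsub>M\<^esub> tensor_map R A \<iota> T (\<lambda>a. a) s w"
    if "c \<in> carrier A" "w \<in> carrier M" for c w
    by (rule tensor_ext[OF abelian_group_tensor additive_comp[OF MA.left_smult_additive[OF that(1)] hom]
          additive_comp[OF hom MA.left_smult_additive[OF that(1)]]])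
      (use that in \<open>auto simp: pure lmod_homD[OF s]\<close>)
  then show ?thesis
    by (intro lmod_homI) (auto simp: eq additiveD[OF hom], simp add: induced_End_def)
qed

text \<open>The tensors \<open>1 \<otimes> t\<close> generate \<open>M\<close> over
  \<open>A\<close>, since \<open>a \<otimes> t\<close> is \<open>a\<close> times
  \<open>1 \<otimes> t\<close>. This is the uniqueness half of the adjunction.\<close>

lemma tensor_lmod_ext:
  assumes "f \<in> lmod_hom A M P" "g \<in> lmod_hom A M P" "left_module A P"
    and "\<And>t. t \<in> carrier T \<Longrightarrow> f (\<tau> \<one>\<^bsub>A\<^esub> t) = g (\<tau> \<one>\<^bsub>A\<^esub> t)"
  shows "f = g"
proof (rule lmod_hom_eqI[OF assms(1,2)])
  interpret P: left_module A P by fact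
  have pure: "h (\<tau> a t) = a \<odot>\<^bsub>P\<^esub> h (\<tau> \<one>\<^bsub>A\<^esub> t)"
    if "h \<in> lmod_hom A M P" "a \<in> carrier A" "t \<in> carrier T" for h a t
    using lmod_homD(4)[OF that(1,2), of "\<tau> \<one>\<^bsub>A\<^esub> t"] that(2,3) by simp
  show "f w = g w" if "w \<in> carrier M" for w
    by (rule tensor_ext[OF P.M.abelian_group_axioms lmod_hom_additive[OF assms(1)] lmod_hom_additive[OF assms(2)] _ that])
      (metis pure[OF assms(1)] pure[OF assms(2)] assms(4))
qed

text \<open>Products are reversed composition in both rings, so functoriality of the tensor product
  makes the map multiplicative. Each identity is checked on the tensors
  \<open>1 \<otimes> t\<close>.\<close>

lemma induced_End_ring_hom: "induced_End R A \<iota> T \<in> ring_hom (End_ring R T) (End_ring A M)"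
proof (rule ring_hom_memI)
  interpret S: ring "End_ring R T" by (rule T.ring_End_ring)
  interpret B: ring "End_ring A M" by (rule MA.ring_End_ring)
  note closed = induced_End_closed
  note ext = tensor_lmod_ext[OF _ _ left_module_tensor]
  have eval: "induced_End R A \<iota> T s (\<tau> \<one>\<^bsub>A\<^esub> t) = \<tau> \<one>\<^bsub>A\<^esub> (s t)"
    if "s \<in> carrier (End_ring R T)" "t \<in> carrier T" for s t
    using that by simp
  fix s s' assume s: "s \<in> carrier (End_ring R T)" "s' \<in> carrier (End_ring R T)"
  show "induced_End R A \<iota> T s \<in> carrier (End_ring A M)" using s closed by simp
  have st: "s t \<in> carrier T" "s' t \<in> carrier T" if "t \<in> carrier T" for t
    using s that lmod_homD(2) by auto
  show "induced_End R A \<iota> T (s \<otimes>\<^bsub>End_ring R T\<^esub> s') =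
      induced_End R A \<iota> T s \<otimes>\<^bsub>End_ring A M\<^esub> induced_End R A \<iota> T s'"
  proof (rule ext)
    show "induced_End R A \<iota> T (s \<otimes>\<^bsub>End_ring R T\<^esub> s') \<in> lmod_hom A M M"
      using S.m_closed[OF s] closed by simp
    show "induced_End R A \<iota> T s \<otimes>\<^bsub>End_ring A M\<^esub> induced_End R A \<iota> T s' \<in> lmod_hom A M M"
      using s closed by auto
    show "induced_End R A \<iota> T (s \<otimes>\<^bsub>End_ring R T\<^esub> s') (\<tau> \<one>\<^bsub>A\<^esub> t) =
        (induced_End R A \<iota> T s \<otimes>\<^bsub>End_ring A M\<^esub> induced_End R A \<iota> T s') (\<tau> \<one>\<^bsub>A\<^esub> t)" if "t \<in> carrier T" for t
      using eval[OF S.m_closed[OF s] that] eval[OF s(1) that] eval[OF s(2) st(1)[OF that]] that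
      by (simp add: compose_eq)
  qed
  show "induced_End R A \<iota> T (s \<oplus>\<^bsub>End_ring R T\<^esub> s') =
      induced_End R A \<iota> T s \<oplus>\<^bsub>End_ring A M\<^esub> induced_End R A \<iota> T s'"
  proof (rule ext)
    show "induced_End R A \<iota> T (s \<oplus>\<^bsub>End_ring R T\<^esub> s') \<in> lmod_hom A M M"
      using S.a_closed[OF s] closed by simp
    show "induced_End R A \<iota> T s \<oplus>\<^bsub>End_ring A M\<^esub> induced_End R A \<iota> T s' \<in> lmod_hom A M M"
      using s closed B.a_closed by simp
    show "induced_End R A \<iota> T (s \<oplus>\<^bsub>End_ring R T\<^esub> s') (\<tau> \<one>\<^bsub>A\<^esub> t) =
        (induced_End R A \<iota> T s \<oplus>\<^bsub>End_ring A M\<^esub> induced_End R A \<iota> T s') (\<tau> \<one>\<^bsub>A\<^esub> t)" if "t \<in> carrier T" for t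
      using eval[OF S.a_closed[OF s] that] eval[OF s(1) that] eval[OF s(2) that] st[OF that] that
      by (simp add: pure_tensor_add_right)
  qed
next
  interpret S: ring "End_ring R T" by (rule T.ring_End_ring)
  interpret B: ring "End_ring A M" by (rule MA.ring_End_ring)
  show "induced_End R A \<iota> T \<one>\<^bsub>End_ring R T\<^esub> = \<one>\<^bsub>End_ring A M\<^esub>"
  proof (rule tensor_lmod_ext[OF _ _ left_module_tensor])
    show "induced_End R A \<iota> T \<one>\<^bsub>End_ring R T\<^esub> \<in> lmod_hom A M M"
      using S.one_closed induced_End_closed by simp
    show "\<one>\<^bsub>End_ring A M\<^esub> \<in> lmod_hom A M M" using B.one_closed by simp
    show "induced_End R A \<iota> T \<one>\<^bsub>End_ring R T\<^esub> (\<tau> \<one>\<^bsub>A\<^esub> t) = \<one>\<^bsub>End_ring A M\<^esub> (\<tau> \<one>\<^bsub>A\<^esub> t)" if "t \<in> carrier T" for t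
      using induced_End_pure[of "\<one>\<^bsub>End_ring R T\<^esub>" "\<one>\<^bsub>A\<^esub>" t] S.one_closed that by simp
  qed
qed

end

section \<open>The Frobenius system of the endomorphism rings\<close>

definition restrict_scalars :: "('r \<Rightarrow> 'a) \<Rightarrow> ('a, 'm, 'y) module_scheme \<Rightarrow> ('r, 'm) module"
  where "restrict_scalars \<iota> M =
    \<lparr>carrier = carrier M, monoid.mult = undefined, monoid.one = undefined,
     ring.zero = \<zero>\<^bsub>M\<^esub>, ring.add = ring.add M, module.smult = (\<lambda>r x. \<iota> r \<odot>\<^bsub>M\<^esub> x)\<rparr>"

lemma restrict_scalars_simps [simp]:
  "carrier (restrict_scalars \<iota> M) = carrier M"
  "\<zero>\<^bsub>restrict_scalars \<iota> M\<^esub> = \<zero>\<^bsub>M\<^esub>"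
  "x \<oplus>\<^bsub>restrict_scalars \<iota> M\<^esub> y = x \<oplus>\<^bsub>M\<^esub> y"
  "r \<odot>\<^bsub>restrict_scalars \<iota> M\<^esub> x = \<iota> r \<odot>\<^bsub>M\<^esub> x"
  "finsum (restrict_scalars \<iota> M) = finsum M"
  "a_inv (restrict_scalars \<iota> M) = a_inv M"
  by (simp_all add: restrict_scalars_def finsum_def finprod_def a_inv_def m_inv_def fun_eq_iff)

lemma (in ring_extension) left_module_restrict_scalars:
  assumes "left_module A M"
  shows "left_module R (restrict_scalars \<iota> M)"
proof -
  interpret M: left_module A M by fact
  have "abelian_group (restrict_scalars \<iota> M)"
    by (rule abelian_groupI) (auto simp: M.M.a_ac intro: M.M.l_neg)
  then show ?thesis
    by (rule left_moduleI[OF R.ring_axioms])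
      (auto simp: M.smult_l_distr M.smult_r_distr M.smult_assoc1)
qed

locale frobenius_tensor = frobenius_system R A \<iota> E I a b + tensor_product R A \<iota> T
  for R :: "('r, 'x) ring_scheme" (structure) and A :: "('a, 'y) ring_scheme" (structure)
    and \<iota> E and I :: "'i set" and a b and T :: "('r, 't, 'z) module_scheme" (structure)
begin

abbreviation M\<^sub>R where "M\<^sub>R \<equiv> restrict_scalars \<iota> M"

sublocale MR: left_module R M\<^sub>R
  by (rule left_module_restrict_scalars[OF left_module_tensor])

text \<open>By \<open>left_dual\<close>, \<open>c \<otimes> t\<close> is the sum of the
  \<open>E (c b\<^sub>i)\<close>-multiples of \<open>a\<^sub>i \<otimes> t\<close>. Hence the
  tensors \<open>a\<^sub>i \<otimes> t\<close>, with \<open>t\<close> from a generating set of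
  \<open>T\<close>, generate \<open>M\<close> over \<open>R\<close>.\<close>

lemma finitely_generated_tensor:
  assumes "finitely_generated R T"
  shows "finitely_generated R M\<^sub>R"
proof -
  obtain X where X: "finite X" "X \<subseteq> carrier T"
    and gen: "\<forall>N. submodule N R T \<longrightarrow> X \<subseteq> N \<longrightarrow> carrier T \<subseteq> N"
    by (rule T.finitely_generatedE[OF assms])
  let ?Y = "(\<lambda>(i, t). \<tau> (a i) t) ` (I \<times> X)"
  show ?thesis
  proof (rule MR.finitely_generatedI)
    fix U assume U: "submodule U R M\<^sub>R" and Y: "?Y \<subseteq> U"
    note UD = MR.submoduleD[OF U, simplified]
    have "\<tau> c t \<in> U" if "c \<in> carrier A" "t \<in> X" for c t
    proof -
      have t: "t \<in> carrier T" using that X by blast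
      have "(\<Oplus>\<^bsub>M\<^sub>R\<^esub>i\<in>I. E (c \<otimes>\<^bsub>A\<^esub> b i) \<odot>\<^bsub>M\<^sub>R\<^esub> \<tau> (a i) t) \<in> U"
        by (rule MR.submodule_finsum_closed[OF U]) (use that Y in \<open>auto intro!: UD(4)\<close>)
      also have "(\<Oplus>\<^bsub>M\<^sub>R\<^esub>i\<in>I. E (c \<otimes>\<^bsub>A\<^esub> b i) \<odot>\<^bsub>M\<^sub>R\<^esub> \<tau> (a i) t) = (\<Oplus>\<^bsub>M\<^esub>i\<in>I. \<tau> (\<iota> (E (c \<otimes>\<^bsub>A\<^esub> b i)) \<otimes>\<^bsub>A\<^esub> a i) t)"
        using that t by (simp, intro M.finsum_cong') auto
      also have "\<dots> = \<tau> (\<Oplus>\<^bsub>A\<^esub>i\<in>I. \<iota> (E (c \<otimes>\<^bsub>A\<^esub> b i)) \<otimes>\<^bsub>A\<^esub> a i) t"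
        by (rule additive_finsum[OF A.is_abelian_group abelian_group_tensor pure_tensor_additive_left, symmetric])
          (use that t in auto)
      finally show ?thesis using that by (simp add: left_dual)
    qed
    then have "X \<subseteq> {t \<in> carrier T. \<forall>c\<in>carrier A. \<tau> c t \<in> U}" using X by blast
    \<comment> \<open>Quantifying over all \<open>c\<close> at once makes the set closed under
      scalars: \<open>c \<otimes> r t\<close> equals \<open>c \<iota>(r) \<otimes> t\<close>, whose
      left factor has changed.\<close>
    moreover have "submodule {t \<in> carrier T. \<forall>c\<in>carrier A. \<tau> c t \<in> U} R T"
    proof (rule T.submoduleI)
      have "\<tau> c \<zero>\<^bsub>T\<^esub> = \<zero>\<^bsub>M\<^esub>" if "c \<in> carrier A" for c
        using additive_zero[OF T.M.abelian_group_axioms abelian_group_tensor pure_tensor_additive_right[OF that]] .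
      then show "\<zero>\<^bsub>T\<^esub> \<in> {t \<in> carrier T. \<forall>c\<in>carrier A. \<tau> c t \<in> U}" using UD(2) by simp
    qed (use UD(3) in \<open>auto simp: pure_tensor_add_right simp flip: pure_tensor_balanced\<close>)
    ultimately have pure: "\<tau> c t \<in> U" if "c \<in> carrier A" "t \<in> carrier T" for c t
      using gen that by blast
    show "carrier M\<^sub>R \<subseteq> U"
    proof
      fix w assume "w \<in> carrier M\<^sub>R"
      then have "w \<in> carrier M" by simp
      then show "w \<in> U"
        by (induction rule: tensor_induct) (auto simp: a_minus_def intro: UD pure)
    qed
  qed (use X in auto)
qed

text \<open>Right linearity of \<open>E\<close> makes \<open>E c \<odot> t\<close> balanced, and
  left linearity makes the resulting map \<open>R\<close>-linear. With \<open>M\<close> seen as a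
  coinduced module, this map is evaluation at 1, the counit of restriction and coinduction.\<close>

lemma counit_exists:
  "\<exists>\<epsilon>\<in>lmod_hom R M\<^sub>R T. \<forall>c\<in>carrier A. \<forall>t\<in>carrier T. \<epsilon> (\<tau> c t) = E c \<odot>\<^bsub>T\<^esub> t"
proof -
  obtain h where h: "h \<in> hom (add_monoid M) (add_monoid T)"
    and pure: "\<forall>c\<in>carrier A. \<forall>t\<in>carrier T. h (\<tau> c t) = E c \<odot>\<^bsub>T\<^esub> t"
    by (rule tensor_universal[OF T.M.abelian_group_axioms, of "\<lambda>c t. E c \<odot>\<^bsub>T\<^esub> t"])
      (auto simp: T.smult_l_distr T.smult_r_distr T.smult_assoc1)
  have smult: "h (\<iota> r \<odot>\<^bsub>M\<^esub> w) = r \<odot>\<^bsub>T\<^esub> h w" if "r \<in> carrier R" "w \<in> carrier M" for r w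
    by (rule tensor_ext[OF T.M.abelian_group_axioms
          additive_comp[OF MA.left_smult_additive[OF ring_hom_closed[OF \<iota>_hom that(1)]] h]
          additive_comp[OF h T.left_smult_additive[OF that(1)]] _ that(2)])
      (use that in \<open>auto simp: pure T.smult_assoc1\<close>)
  show ?thesis
    using pure smult by (intro bexI[of _ "restrict h (carrier M)"] lmod_homI) (auto simp: additiveD[OF h])
qed

definition \<epsilon> where
  "\<epsilon> = (SOME \<epsilon>. \<epsilon> \<in> lmod_hom R M\<^sub>R T \<and> (\<forall>c\<in>carrier A. \<forall>t\<in>carrier T. \<epsilon> (\<tau> c t) = E c \<odot>\<^bsub>T\<^esub> t))"

lemma \<epsilon>_hom: "\<epsilon> \<in> lmod_hom R M\<^sub>R T"
  and \<epsilon>_pure [simp]: "\<lbrakk>c \<in> carrier A; t \<in> carrier T\<rbrakk> \<Longrightarrow> \<epsilon> (\<tau> c t) = E c \<odot>\<^bsub>T\<^esub> t"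
  using someI_ex[OF counit_exists[unfolded Bex_def]] unfolding \<epsilon>_def by blast+

lemmas \<epsilon>_simps [simp] = lmod_homD(2-)[OF \<epsilon>_hom, simplified]

lemma \<epsilon>_additive: "\<epsilon> \<in> hom (add_monoid M) (add_monoid T)"
  by (rule additiveI) auto

text \<open>The adjoint \<open>w \<mapsto> (a \<mapsto> q(a w))\<close> of \<open>q\<close>, followed by the isomorphism
  \<open>f \<mapsto> \<Sum> b\<^sub>i \<otimes> f(a\<^sub>i)\<close> from \<open>Hom\<^sub>R(A, T)\<close> to \<open>A \<otimes>\<^sub>R T\<close>.\<close>

definition coinduced_map where
  "coinduced_map q = (\<lambda>w\<in>carrier M. \<Oplus>\<^bsub>M\<^esub>i\<in>I. \<tau> (b i) (q (a i \<odot>\<^bsub>M\<^esub> w)))"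

context
  fixes q assumes q: "q \<in> lmod_hom R M\<^sub>R T"
begin

lemmas q_simps = lmod_homD(2-)[OF q, simplified]

lemma q_additive: "q \<in> hom (add_monoid M) (add_monoid T)"
  using q_simps by (auto intro!: additiveI)

lemma coinduced_summand_additive:
  "i \<in> I \<Longrightarrow> (\<lambda>w. \<tau> (b i) (q (a i \<odot>\<^bsub>M\<^esub> w))) \<in> hom (add_monoid M) (add_monoid M)"
  by (intro additive_comp[OF _ pure_tensor_additive_right] additive_comp[OF _ q_additive]
      MA.left_smult_additive) auto

lemma coinduced_map_additive:
  "(\<lambda>w. \<Oplus>\<^bsub>M\<^esub>i\<in>I. \<tau> (b i) (q (a i \<odot>\<^bsub>M\<^esub> w))) \<in> hom (add_monoid M) (add_monoid M)"
  by (rule M.additive_of_finsum) (rule coinduced_summand_additive)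

text \<open>Linearity over \<open>A\<close> is the centrality of the Casimir element \<Sum>
  \<open>b\<^sub>i \<otimes> a\<^sub>i\<close>: expanding \<open>a\<^sub>i c\<close> by
  \<open>left_dual\<close>, moving the coefficients across the tensor sign and summing over
  \<open>i\<close> by \<open>right_dual\<close> moves \<open>c\<close> from the right of
  \<open>a\<^sub>i\<close> to the left of \<open>b\<^sub>i\<close>.\<close>

lemma coinduced_map_hom: "coinduced_map q \<in> lmod_hom A M M"
proof (rule lmod_homI)
  fix c w assume c: "c \<in> carrier A" and w: "w \<in> carrier M"
  \<comment> \<open>The coefficient of \<open>a k\<close> in the expansion of
    \<open>a\<^sub>i c\<close> by \<open>left_dual\<close>, and equally that of \<open>b i\<close>
    in the expansion of \<open>c b\<^sub>k\<close> by \<open>right_dual\<close>.\<close>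
  let ?s = "\<lambda>i k. E (a i \<otimes>\<^bsub>A\<^esub> (c \<otimes>\<^bsub>A\<^esub> b k))"
  have expand: "q (a i \<odot>\<^bsub>M\<^esub> (c \<odot>\<^bsub>M\<^esub> w)) = (\<Oplus>\<^bsub>T\<^esub>k\<in>I. ?s i k \<odot>\<^bsub>T\<^esub> q (a k \<odot>\<^bsub>M\<^esub> w))" if i: "i \<in> I" for i
  proof -
    have "(\<Oplus>\<^bsub>A\<^esub>k\<in>I. \<iota> (?s i k) \<otimes>\<^bsub>A\<^esub> a k) =
        (\<Oplus>\<^bsub>A\<^esub>k\<in>I. \<iota> (E (a i \<otimes>\<^bsub>A\<^esub> c \<otimes>\<^bsub>A\<^esub> b k)) \<otimes>\<^bsub>A\<^esub> a k)"
      using i c by (intro A.finsum_cong') (auto simp: A.m_assoc)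
    then have "a i \<odot>\<^bsub>M\<^esub> (c \<odot>\<^bsub>M\<^esub> w) = (\<Oplus>\<^bsub>A\<^esub>k\<in>I. \<iota> (?s i k) \<otimes>\<^bsub>A\<^esub> a k) \<odot>\<^bsub>M\<^esub> w"
      using i c w by (simp add: left_dual MA.smult_assoc1)
    also have "\<dots> = (\<Oplus>\<^bsub>M\<^esub>k\<in>I. (\<iota> (?s i k) \<otimes>\<^bsub>A\<^esub> a k) \<odot>\<^bsub>M\<^esub> w)"
      using i c w by (intro MA.finsum_smult) auto
    also have "\<dots> = (\<Oplus>\<^bsub>M\<^esub>k\<in>I. \<iota> (?s i k) \<odot>\<^bsub>M\<^esub> (a k \<odot>\<^bsub>M\<^esub> w))"
      using i c w by (intro M.finsum_cong') (auto simp: MA.smult_assoc1)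
    finally have "q (a i \<odot>\<^bsub>M\<^esub> (c \<odot>\<^bsub>M\<^esub> w)) = q (\<Oplus>\<^bsub>M\<^esub>k\<in>I. \<iota> (?s i k) \<odot>\<^bsub>M\<^esub> (a k \<odot>\<^bsub>M\<^esub> w))" by simp
    also have "\<dots> = (\<Oplus>\<^bsub>T\<^esub>k\<in>I. q (\<iota> (?s i k) \<odot>\<^bsub>M\<^esub> (a k \<odot>\<^bsub>M\<^esub> w)))"
      using i c w by (intro additive_finsum[OF abelian_group_tensor T.M.abelian_group_axioms q_additive]) auto
    also have "\<dots> = (\<Oplus>\<^bsub>T\<^esub>k\<in>I. ?s i k \<odot>\<^bsub>T\<^esub> q (a k \<odot>\<^bsub>M\<^esub> w))"
      using i c w by (intro T.M.finsum_cong') (auto simp: q_simps)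
    finally show ?thesis .
  qed
  have "coinduced_map q (c \<odot>\<^bsub>M\<^esub> w) = (\<Oplus>\<^bsub>M\<^esub>i\<in>I. \<tau> (b i) (q (a i \<odot>\<^bsub>M\<^esub> (c \<odot>\<^bsub>M\<^esub> w))))"
    using c w by (simp add: coinduced_map_def)
  also have "\<dots> = (\<Oplus>\<^bsub>M\<^esub>i\<in>I. \<Oplus>\<^bsub>M\<^esub>k\<in>I. \<tau> (b i \<otimes>\<^bsub>A\<^esub> \<iota> (?s i k)) (q (a k \<odot>\<^bsub>M\<^esub> w)))"
  proof (rule M.finsum_cong')
    fix i assume i: "i \<in> I"
    have "\<tau> (b i) (q (a i \<odot>\<^bsub>M\<^esub> (c \<odot>\<^bsub>M\<^esub> w))) = (\<Oplus>\<^bsub>M\<^esub>k\<in>I. \<tau> (b i) (?s i k \<odot>\<^bsub>T\<^esub> q (a k \<odot>\<^bsub>M\<^esub> w)))"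
      unfolding expand[OF i]
      by (rule additive_finsum[OF T.M.abelian_group_axioms abelian_group_tensor pure_tensor_additive_right])
        (use i c w in \<open>auto simp: q_simps\<close>)
    also have "\<dots> = (\<Oplus>\<^bsub>M\<^esub>k\<in>I. \<tau> (b i \<otimes>\<^bsub>A\<^esub> \<iota> (?s i k)) (q (a k \<odot>\<^bsub>M\<^esub> w)))"
      using i c w by (intro M.finsum_cong') (auto simp: q_simps pure_tensor_balanced)
    finally show "\<tau> (b i) (q (a i \<odot>\<^bsub>M\<^esub> (c \<odot>\<^bsub>M\<^esub> w))) = \<dots>" .
  qed (use c w in \<open>auto simp: q_simps intro!: M.finsum_closed\<close>)
  also have "\<dots> = (\<Oplus>\<^bsub>M\<^esub>k\<in>I. \<Oplus>\<^bsub>M\<^esub>i\<in>I. \<tau> (b i \<otimes>\<^bsub>A\<^esub> \<iota> (?s i k)) (q (a k \<odot>\<^bsub>M\<^esub> w)))"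
    using c w by (intro M.finsum_swap) (auto simp: q_simps)
  also have "\<dots> = (\<Oplus>\<^bsub>M\<^esub>k\<in>I. c \<odot>\<^bsub>M\<^esub> \<tau> (b k) (q (a k \<odot>\<^bsub>M\<^esub> w)))"
  proof (rule M.finsum_cong')
    fix k assume k: "k \<in> I"
    have "(\<Oplus>\<^bsub>M\<^esub>i\<in>I. \<tau> (b i \<otimes>\<^bsub>A\<^esub> \<iota> (?s i k)) (q (a k \<odot>\<^bsub>M\<^esub> w))) =
        \<tau> (\<Oplus>\<^bsub>A\<^esub>i\<in>I. b i \<otimes>\<^bsub>A\<^esub> \<iota> (?s i k)) (q (a k \<odot>\<^bsub>M\<^esub> w))"
      by (rule additive_finsum[OF A.is_abelian_group abelian_group_tensor pure_tensor_additive_left, symmetric])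
        (use k c w in \<open>auto simp: q_simps\<close>)
    also have "\<dots> = c \<odot>\<^bsub>M\<^esub> \<tau> (b k) (q (a k \<odot>\<^bsub>M\<^esub> w))"
      using k c w by (simp add: right_dual q_simps)
    finally show "(\<Oplus>\<^bsub>M\<^esub>i\<in>I. \<tau> (b i \<otimes>\<^bsub>A\<^esub> \<iota> (?s i k)) (q (a k \<odot>\<^bsub>M\<^esub> w))) = \<dots>" .
  qed (use c w in \<open>auto simp: q_simps simp del: smult_pure_tensor\<close>)
  also have "\<dots> = c \<odot>\<^bsub>M\<^esub> coinduced_map q w"
    using c w by (subst MA.smult_finsum[symmetric]) (auto simp: q_simps coinduced_map_def)
  finally show "coinduced_map q (c \<odot>\<^bsub>M\<^esub> w) = c \<odot>\<^bsub>M\<^esub> coinduced_map q w" .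
qed (use additiveD[OF coinduced_map_additive] in \<open>auto simp: coinduced_map_def\<close>)

text \<open>Applying \<epsilon> gives the sum of \<open>E (b i) \<odot> q (a\<^sub>i w)\<close>. As
  \<open>q\<close> is \<open>R\<close>-linear, \<open>left_dual\<close> at 1 collapses it, so
  composition with \<epsilon> recovers \<open>q\<close>.\<close>

lemma \<epsilon>_coinduced_map:
  assumes w: "w \<in> carrier M"
  shows "\<epsilon> (coinduced_map q w) = q w"
proof -
  have "\<epsilon> (coinduced_map q w) = (\<Oplus>\<^bsub>T\<^esub>i\<in>I. \<epsilon> (\<tau> (b i) (q (a i \<odot>\<^bsub>M\<^esub> w))))"
    using w unfolding coinduced_map_def
    by (simp, intro additive_finsum[OF abelian_group_tensor T.M.abelian_group_axioms \<epsilon>_additive])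
      (auto simp: q_simps)
  also have "\<dots> = (\<Oplus>\<^bsub>T\<^esub>i\<in>I. q ((\<iota> (E (b i)) \<otimes>\<^bsub>A\<^esub> a i) \<odot>\<^bsub>M\<^esub> w))"
    using w by (intro T.M.finsum_cong') (auto simp: q_simps MA.smult_assoc1)
  also have "\<dots> = q (\<Oplus>\<^bsub>M\<^esub>i\<in>I. (\<iota> (E (b i)) \<otimes>\<^bsub>A\<^esub> a i) \<odot>\<^bsub>M\<^esub> w)"
    using w by (intro additive_finsum[OF abelian_group_tensor T.M.abelian_group_axioms q_additive, symmetric]) auto
  also have "(\<Oplus>\<^bsub>M\<^esub>i\<in>I. (\<iota> (E (b i)) \<otimes>\<^bsub>A\<^esub> a i) \<odot>\<^bsub>M\<^esub> w) = (\<Oplus>\<^bsub>A\<^esub>i\<in>I. \<iota> (E (b i)) \<otimes>\<^bsub>A\<^esub> a i) \<odot>\<^bsub>M\<^esub> w"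
    using w by (intro MA.finsum_smult[symmetric]) auto
  \<comment> \<open>A factor 1 is inserted so that the sum has the form required by
    \<open>left_dual\<close>.\<close>
  also have "(\<Oplus>\<^bsub>A\<^esub>i\<in>I. \<iota> (E (b i)) \<otimes>\<^bsub>A\<^esub> a i) = (\<Oplus>\<^bsub>A\<^esub>i\<in>I. \<iota> (E (\<one>\<^bsub>A\<^esub> \<otimes>\<^bsub>A\<^esub> b i)) \<otimes>\<^bsub>A\<^esub> a i)"
    by (intro A.finsum_cong') auto
  also have "\<dots> \<odot>\<^bsub>M\<^esub> w = w" using w by (simp add: left_dual del: A.l_one)
  finally show ?thesis .
qed

end

text \<open>The left side is the coinduced map of \<epsilon>. It is additive in \<open>w\<close>,
  and on pure tensors it is the identity by \<open>right_dual\<close>.\<close>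

lemma tensor_reconstruct:
  assumes w: "w \<in> carrier M"
  shows "(\<Oplus>\<^bsub>M\<^esub>i\<in>I. \<tau> (b i) (\<epsilon> (a i \<odot>\<^bsub>M\<^esub> w))) = w"
proof (rule tensor_ext[OF abelian_group_tensor coinduced_map_additive[OF \<epsilon>_hom] additive_id _ w])
  fix c t assume *: "c \<in> carrier A" "t \<in> carrier T"
  have "(\<Oplus>\<^bsub>M\<^esub>i\<in>I. \<tau> (b i) (\<epsilon> (a i \<odot>\<^bsub>M\<^esub> \<tau> c t))) = (\<Oplus>\<^bsub>M\<^esub>i\<in>I. \<tau> (b i \<otimes>\<^bsub>A\<^esub> \<iota> (E (a i \<otimes>\<^bsub>A\<^esub> c))) t)"
    using * by (intro M.finsum_cong') (auto simp: pure_tensor_balanced)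
  also have "\<dots> = \<tau> (\<Oplus>\<^bsub>A\<^esub>i\<in>I. b i \<otimes>\<^bsub>A\<^esub> \<iota> (E (a i \<otimes>\<^bsub>A\<^esub> c))) t"
    by (rule additive_finsum[OF A.is_abelian_group abelian_group_tensor pure_tensor_additive_left, symmetric])
      (use * in auto)
  finally show "(\<Oplus>\<^bsub>M\<^esub>i\<in>I. \<tau> (b i) (\<epsilon> (a i \<odot>\<^bsub>M\<^esub> \<tau> c t))) = \<tau> c t"
    using * by (simp add: right_dual)
qed

section \<open>The Frobenius homomorphism and dual bases of the endomorphism rings\<close>

abbreviation S where "S \<equiv> End_ring R T"
abbreviation B where "B \<equiv> End_ring A M"
abbreviation \<rho> where "\<rho> \<equiv> induced_End R A \<iota> T"

definition E\<^sub>B where "E\<^sub>B \<beta> = (\<lambda>t\<in>carrier T. \<epsilon> (\<beta> (\<tau> \<one>\<^bsub>A\<^esub> t)))"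

lemma End_apply_closed [simp]: "\<lbrakk>\<beta> \<in> lmod_hom A M M; w \<in> carrier M\<rbrakk> \<Longrightarrow> \<beta> w \<in> carrier M"
  by (rule lmod_homD(2))

lemma End_apply_closed_T [simp]: "\<lbrakk>s \<in> lmod_hom R T T; t \<in> carrier T\<rbrakk> \<Longrightarrow> s t \<in> carrier T"
  by (rule lmod_homD(2))

lemma E\<^sub>B_closed:
  assumes \<beta>: "\<beta> \<in> lmod_hom A M M"
  shows "E\<^sub>B \<beta> \<in> lmod_hom R T T"
proof (rule lmod_homI)
  fix r t assume *: "r \<in> carrier R" "t \<in> carrier T"
  \<comment> \<open>The unit map \<open>t \<mapsto> 1 \<otimes> t\<close> is
    \<open>R\<close>-linear, by balancing.\<close>
  have "\<tau> \<one>\<^bsub>A\<^esub> (r \<odot>\<^bsub>T\<^esub> t) = \<iota> r \<odot>\<^bsub>M\<^esub> \<tau> \<one>\<^bsub>A\<^esub> t"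
    using * pure_tensor_balanced[of "\<one>\<^bsub>A\<^esub>" r t] by simp
  then show "E\<^sub>B \<beta> (r \<odot>\<^bsub>T\<^esub> t) = r \<odot>\<^bsub>T\<^esub> E\<^sub>B \<beta> t"
    using * \<beta> by (simp add: E\<^sub>B_def lmod_homD(4)[OF \<beta>] del: smult_pure_tensor)
qed (use \<beta> in \<open>auto simp: E\<^sub>B_def pure_tensor_add_right lmod_homD(3)[OF \<beta>]\<close>)

text \<open>Naturality of \<epsilon> in \<open>T\<close>. It yields the right
  \<open>S\<close>-linearity of \<open>E\<^sub>B\<close>.\<close>

lemma \<epsilon>_induced_End:
  assumes s: "s \<in> lmod_hom R T T" and w: "w \<in> carrier M"
  shows "\<epsilon> (\<rho> s w) = s (\<epsilon> w)"
  by (rule tensor_ext[OF T.M.abelian_group_axioms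
        additive_comp[OF lmod_hom_additive[OF induced_End_closed[OF s]] \<epsilon>_additive]
        additive_comp[OF \<epsilon>_additive lmod_hom_additive[OF s]] _ w])
    (use s in \<open>auto simp: lmod_homD(4)[OF s]\<close>)

text \<open>Evaluated at \<open>1 \<otimes> t\<close>, the left dual identity becomes
  \<open>pq\<close> at \<open>\<beta> (1 \<otimes> t)\<close>. Evaluated at \<open>w\<close>, the
  right one becomes \<open>pq\<close> at each \<open>a\<^sub>i w\<close>, followed by the
  reconstruction of \<open>\<beta> w\<close> from the elements
  \<open>\<epsilon> (a\<^sub>i \<beta> w)\<close>.\<close>

lemma frobenius_system_End:
  assumes F: "finite F"
    and p: "\<forall>j\<in>F. p j \<in> lmod_hom R T M\<^sub>R" and q: "\<forall>j\<in>F. q j \<in> lmod_hom R M\<^sub>R T"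
    and pq: "\<forall>w\<in>carrier M\<^sub>R. (\<Oplus>\<^bsub>M\<^sub>R\<^esub>j\<in>F. p j (q j w)) = w"
  shows "\<exists>x y. frobenius_system S B \<rho> E\<^sub>B F x y"
proof -
  interpret S: ring S by (rule T.ring_End_ring)
  interpret B: ring B by (rule MA.ring_End_ring)
  have p_closed: "p j t \<in> carrier M" if "j \<in> F" "t \<in> carrier T" for j t
    using lmod_homD(2)[OF bspec[OF p that(1)]] that by simp
  have p_additive: "p j \<in> hom (add_monoid T) (add_monoid M)" if "j \<in> F" for j
    using lmod_homD(2,3)[OF bspec[OF p that]] by (auto intro!: additiveI)
  have p_smult: "p j (r \<odot>\<^bsub>T\<^esub> t) = \<iota> r \<odot>\<^bsub>M\<^esub> p j t" if "j \<in> F" "r \<in> carrier R" "t \<in> carrier T" for j r t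
    using lmod_homD(4)[OF bspec[OF p that(1)]] that by simp
  have q_closed: "q j w \<in> carrier T" if "j \<in> F" "w \<in> carrier M" for j w
    using lmod_homD(2)[OF bspec[OF q that(1)]] that by simp
  have pq': "(\<Oplus>\<^bsub>M\<^esub>j\<in>F. p j (q j w)) = w" if "w \<in> carrier M" for w
    using pq that by simp
  have "\<exists>h\<in>lmod_hom A M M. \<forall>c\<in>carrier A. \<forall>t\<in>carrier T. h (\<tau> c t) = c \<odot>\<^bsub>M\<^esub> p j t" if "j \<in> F" for j
    by (rule tensor_lift[OF left_module_tensor p_additive[OF that] p_smult[OF that]])
  then obtain x where x: "\<And>j. j \<in> F \<Longrightarrow> x j \<in> lmod_hom A M M"
    and x_pure: "\<And>j c t. \<lbrakk>j \<in> F; c \<in> carrier A; t \<in> carrier T\<rbrakk> \<Longrightarrow> x j (\<tau> c t) = c \<odot>\<^bsub>M\<^esub> p j t"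
    by metis
  define y where "y j = coinduced_map (q j)" for j
  have y: "y j \<in> lmod_hom A M M" if "j \<in> F" for j
    unfolding y_def using coinduced_map_hom q that by blast
  have \<epsilon>y: "\<epsilon> (y j w) = q j w" if "j \<in> F" "w \<in> carrier M" for j w
    unfolding y_def using \<epsilon>_coinduced_map q that by blast
  have eval: "\<rho> s (\<tau> \<one>\<^bsub>A\<^esub> t) = \<tau> \<one>\<^bsub>A\<^esub> (s t)" if "s \<in> lmod_hom R T T" "t \<in> carrier T" for s t
    using that by simp
  have "frobenius_system S B \<rho> E\<^sub>B F x y"
  proof (unfold_locales)
    show "\<rho> \<in> ring_hom S B" by (rule induced_End_ring_hom)
  next
    fix \<beta> assume "\<beta> \<in> carrier B"
    then show "E\<^sub>B \<beta> \<in> carrier S" using E\<^sub>B_closed by simp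
  next
    fix \<beta> \<gamma> assume "\<beta> \<in> carrier B" "\<gamma> \<in> carrier B"
    then show "E\<^sub>B (\<beta> \<oplus>\<^bsub>B\<^esub> \<gamma>) = E\<^sub>B \<beta> \<oplus>\<^bsub>S\<^esub> E\<^sub>B \<gamma>"
      by (auto simp: E\<^sub>B_def fun_eq_iff)
  next
    \<comment> \<open>Here \<open>\<rho> s\<close> acts first and sends \<open>1 \<otimes> t\<close>
      to \<open>1 \<otimes> s t\<close>. In the next case it acts last and passes through \<epsilon>
      by naturality.\<close>
    fix s \<beta> assume "s \<in> carrier S" "\<beta> \<in> carrier B"
    then show "E\<^sub>B (\<rho> s \<otimes>\<^bsub>B\<^esub> \<beta>) = s \<otimes>\<^bsub>S\<^esub> E\<^sub>B \<beta>"
      by (auto simp: E\<^sub>B_def fun_eq_iff compose_def)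
  next
    fix s \<beta> assume "s \<in> carrier S" "\<beta> \<in> carrier B"
    then show "E\<^sub>B (\<beta> \<otimes>\<^bsub>B\<^esub> \<rho> s) = E\<^sub>B \<beta> \<otimes>\<^bsub>S\<^esub> s"
      by (auto simp: E\<^sub>B_def fun_eq_iff compose_def \<epsilon>_induced_End)
  next
    fix \<beta> assume \<beta>: "\<beta> \<in> carrier B"
    have sE: "E\<^sub>B (\<beta> \<otimes>\<^bsub>B\<^esub> y j) \<in> lmod_hom R T T" if "j \<in> F" for j
      using E\<^sub>B_closed B.m_closed[OF \<beta>, of "y j"] y[OF that] by simp
    have terms: "(\<lambda>j. \<rho> (E\<^sub>B (\<beta> \<otimes>\<^bsub>B\<^esub> y j)) \<otimes>\<^bsub>B\<^esub> x j) \<in> F \<rightarrow> carrier B"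
      using sE x induced_End_closed by (intro Pi_I B.m_closed) simp_all
    show "(\<Oplus>\<^bsub>B\<^esub>j\<in>F. \<rho> (E\<^sub>B (\<beta> \<otimes>\<^bsub>B\<^esub> y j)) \<otimes>\<^bsub>B\<^esub> x j) = \<beta>"
    proof (rule tensor_lmod_ext[OF _ _ left_module_tensor])
      show "(\<Oplus>\<^bsub>B\<^esub>j\<in>F. \<rho> (E\<^sub>B (\<beta> \<otimes>\<^bsub>B\<^esub> y j)) \<otimes>\<^bsub>B\<^esub> x j) \<in> lmod_hom A M M"
        using B.finsum_closed[OF terms] by simp
      show "\<beta> \<in> lmod_hom A M M" using \<beta> by simp
      fix t assume t: "t \<in> carrier T"
      have \<beta>t: "\<beta> (\<tau> \<one>\<^bsub>A\<^esub> t) \<in> carrier M" using \<beta> t by simp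
      have "(\<Oplus>\<^bsub>B\<^esub>j\<in>F. \<rho> (E\<^sub>B (\<beta> \<otimes>\<^bsub>B\<^esub> y j)) \<otimes>\<^bsub>B\<^esub> x j) (\<tau> \<one>\<^bsub>A\<^esub> t) =
          (\<Oplus>\<^bsub>M\<^esub>j\<in>F. (\<rho> (E\<^sub>B (\<beta> \<otimes>\<^bsub>B\<^esub> y j)) \<otimes>\<^bsub>B\<^esub> x j) (\<tau> \<one>\<^bsub>A\<^esub> t))"
        using t by (intro MA.End_ring_finsum_apply[OF terms]) auto
      also have "\<dots> = (\<Oplus>\<^bsub>M\<^esub>j\<in>F. p j (q j (\<beta> (\<tau> \<one>\<^bsub>A\<^esub> t))))"
      proof (rule M.finsum_cong')
        fix j assume j: "j \<in> F"
        \<comment> \<open>In this product \<open>y j\<close> acts last, so \<epsilon> meets it and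
          returns \<open>q j\<close>.\<close>
        have "E\<^sub>B (\<beta> \<otimes>\<^bsub>B\<^esub> y j) t = q j (\<beta> (\<tau> \<one>\<^bsub>A\<^esub> t))"
          using t \<epsilon>y[OF j \<beta>t] by (simp add: E\<^sub>B_def compose_eq)
        then have "\<rho> (E\<^sub>B (\<beta> \<otimes>\<^bsub>B\<^esub> y j)) (\<tau> \<one>\<^bsub>A\<^esub> t) = \<tau> \<one>\<^bsub>A\<^esub> (q j (\<beta> (\<tau> \<one>\<^bsub>A\<^esub> t)))"
          using eval[OF sE[OF j] t] by simp
        then show "(\<rho> (E\<^sub>B (\<beta> \<otimes>\<^bsub>B\<^esub> y j)) \<otimes>\<^bsub>B\<^esub> x j) (\<tau> \<one>\<^bsub>A\<^esub> t) = p j (q j (\<beta> (\<tau> \<one>\<^bsub>A\<^esub> t)))"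
          using t j q_closed[OF j \<beta>t] p_closed by (simp add: compose_eq x_pure)
      qed (use q_closed[OF _ \<beta>t] p_closed in auto)
      also have "\<dots> = \<beta> (\<tau> \<one>\<^bsub>A\<^esub> t)" using pq'[OF \<beta>t] .
      finally show "(\<Oplus>\<^bsub>B\<^esub>j\<in>F. \<rho> (E\<^sub>B (\<beta> \<otimes>\<^bsub>B\<^esub> y j)) \<otimes>\<^bsub>B\<^esub> x j) (\<tau> \<one>\<^bsub>A\<^esub> t) = \<beta> (\<tau> \<one>\<^bsub>A\<^esub> t)" .
    qed
  next
    fix \<beta> assume \<beta>: "\<beta> \<in> carrier B"
    then have \<beta>': "\<beta> \<in> lmod_hom A M M" by simp
    define s where "s j = E\<^sub>B (x j \<otimes>\<^bsub>B\<^esub> \<beta>)" for j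
    have s: "s j \<in> lmod_hom R T T" if "j \<in> F" for j
      unfolding s_def using E\<^sub>B_closed B.m_closed[OF _ \<beta>, of "x j"] x[OF that] by simp
    \<comment> \<open>Now \<open>x j\<close> acts first and turns \<open>1 \<otimes> t\<close> into
      \<open>p j t\<close>.\<close>
    have s_apply: "s j t = \<epsilon> (\<beta> (p j t))" if "j \<in> F" "t \<in> carrier T" for j t
      using that p_closed by (simp add: s_def E\<^sub>B_def compose_eq x_pure)
    have terms: "(\<lambda>j. y j \<otimes>\<^bsub>B\<^esub> \<rho> (s j)) \<in> F \<rightarrow> carrier B"
      using s y induced_End_closed by (intro Pi_I B.m_closed) simp_all
    have "(\<Oplus>\<^bsub>B\<^esub>j\<in>F. y j \<otimes>\<^bsub>B\<^esub> \<rho> (s j)) = \<beta>"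
    proof (rule lmod_hom_eqI)
      show "(\<Oplus>\<^bsub>B\<^esub>j\<in>F. y j \<otimes>\<^bsub>B\<^esub> \<rho> (s j)) \<in> lmod_hom A M M"
        using B.finsum_closed[OF terms] by simp
      show "\<beta> \<in> lmod_hom A M M" by (rule \<beta>')
      fix w assume w: "w \<in> carrier M"
      have aw: "a i \<odot>\<^bsub>M\<^esub> w \<in> carrier M" if "i \<in> I" for i using that w by simp
      have "(\<Oplus>\<^bsub>B\<^esub>j\<in>F. y j \<otimes>\<^bsub>B\<^esub> \<rho> (s j)) w = (\<Oplus>\<^bsub>M\<^esub>j\<in>F. (y j \<otimes>\<^bsub>B\<^esub> \<rho> (s j)) w)"
        by (rule MA.End_ring_finsum_apply[OF terms w])
      also have "\<dots> = (\<Oplus>\<^bsub>M\<^esub>j\<in>F. \<Oplus>\<^bsub>M\<^esub>i\<in>I. \<tau> (b i) (s j (q j (a i \<odot>\<^bsub>M\<^esub> w))))"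
      proof (rule M.finsum_cong')
        fix j assume j: "j \<in> F"
        have "(y j \<otimes>\<^bsub>B\<^esub> \<rho> (s j)) w = \<rho> (s j) (\<Oplus>\<^bsub>M\<^esub>i\<in>I. \<tau> (b i) (q j (a i \<odot>\<^bsub>M\<^esub> w)))"
          using w by (simp add: compose_eq y_def coinduced_map_def)
        also have "\<dots> = (\<Oplus>\<^bsub>M\<^esub>i\<in>I. \<rho> (s j) (\<tau> (b i) (q j (a i \<odot>\<^bsub>M\<^esub> w))))"
          using q_closed[OF j aw]
          by (intro additive_finsum[OF abelian_group_tensor abelian_group_tensor
                lmod_hom_additive[OF induced_End_closed[OF s[OF j]]]]) auto
        also have "\<dots> = (\<Oplus>\<^bsub>M\<^esub>i\<in>I. \<tau> (b i) (s j (q j (a i \<odot>\<^bsub>M\<^esub> w))))"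
          using q_closed[OF j aw] s[OF j] by (intro M.finsum_cong') auto
        finally show "(y j \<otimes>\<^bsub>B\<^esub> \<rho> (s j)) w = \<dots>" .
      qed (use q_closed[OF _ aw] s in \<open>auto intro!: M.finsum_closed\<close>)
      \<comment> \<open>With \<open>i\<close> outside, the sum over \<open>j\<close> can be drawn
        through the right tensor factor, \<epsilon> and \<beta>, where \<open>pq'\<close> evaluates
        it.\<close>
      also have "\<dots> = (\<Oplus>\<^bsub>M\<^esub>i\<in>I. \<Oplus>\<^bsub>M\<^esub>j\<in>F. \<tau> (b i) (s j (q j (a i \<odot>\<^bsub>M\<^esub> w))))"
        using q_closed[OF _ aw] s F by (intro M.finsum_swap) auto
      also have "\<dots> = (\<Oplus>\<^bsub>M\<^esub>i\<in>I. \<tau> (b i) (\<epsilon> (a i \<odot>\<^bsub>M\<^esub> \<beta> w)))"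
      proof (rule M.finsum_cong')
        fix i assume i: "i \<in> I"
        note q' = q_closed[OF _ aw[OF i]]
        have \<beta>_add: "\<beta> \<in> hom (add_monoid M) (add_monoid M)" by (rule lmod_hom_additive[OF \<beta>'])
        have "(\<Oplus>\<^bsub>M\<^esub>j\<in>F. \<tau> (b i) (s j (q j (a i \<odot>\<^bsub>M\<^esub> w)))) = \<tau> (b i) (\<Oplus>\<^bsub>T\<^esub>j\<in>F. s j (q j (a i \<odot>\<^bsub>M\<^esub> w)))"
          by (rule additive_finsum[OF T.M.abelian_group_axioms abelian_group_tensor
                pure_tensor_additive_right, symmetric]) (use i q' s in auto)
        also have "(\<Oplus>\<^bsub>T\<^esub>j\<in>F. s j (q j (a i \<odot>\<^bsub>M\<^esub> w))) = (\<Oplus>\<^bsub>T\<^esub>j\<in>F. \<epsilon> (\<beta> (p j (q j (a i \<odot>\<^bsub>M\<^esub> w)))))"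
          using q' p_closed \<beta>' by (intro T.M.finsum_cong') (auto simp: s_apply)
        also have "\<dots> = \<epsilon> (\<beta> (\<Oplus>\<^bsub>M\<^esub>j\<in>F. p j (q j (a i \<odot>\<^bsub>M\<^esub> w))))"
          by (rule additive_finsum[OF abelian_group_tensor T.M.abelian_group_axioms
                additive_comp[OF \<beta>_add \<epsilon>_additive], symmetric]) (use q' p_closed in auto)
        \<comment> \<open>Linearity of \<beta> over \<open>A\<close> releases \<open>a i\<close>,
          which leaves the shape required by \<open>tensor_reconstruct\<close>.\<close>
        also have "\<dots> = \<epsilon> (a i \<odot>\<^bsub>M\<^esub> \<beta> w)"
          using i w by (simp add: pq' lmod_homD(4)[OF \<beta>'])
        finally show "(\<Oplus>\<^bsub>M\<^esub>j\<in>F. \<tau> (b i) (s j (q j (a i \<odot>\<^bsub>M\<^esub> w)))) = \<tau> (b i) (\<epsilon> (a i \<odot>\<^bsub>M\<^esub> \<beta> w))" .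
      qed (use w \<beta>' in auto)
      also have "\<dots> = \<beta> w" using tensor_reconstruct w \<beta>' by simp
      finally show "(\<Oplus>\<^bsub>B\<^esub>j\<in>F. y j \<otimes>\<^bsub>B\<^esub> \<rho> (s j)) w = \<beta> w" .
    qed
    then show "(\<Oplus>\<^bsub>B\<^esub>j\<in>F. y j \<otimes>\<^bsub>B\<^esub> \<rho> (E\<^sub>B (x j \<otimes>\<^bsub>B\<^esub> \<beta>))) = \<beta>" by (simp only: s_def)
  qed (use F x y in auto)
  then show ?thesis by blast
qed

end

theorem corollary3p8:
  fixes R :: "'r ring" and A :: "'a ring" and T :: "('r, 't) module"
    and K :: "'k ring" and L :: "'l ring"
    and \<kappa> :: "'k \<Rightarrow> 'r" and \<mu> :: "'l \<Rightarrow> 'a" and \<iota> :: "'r \<Rightarrow> 'a"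
  assumes "artin_algebra K \<kappa> R"
    and "artin_algebra L \<mu> A"
    and "frobenius_extension R A \<iota>"
    and "additive_generator R T"
  shows "frobenius_extension (End_ring R T) (End_ring A (induced_module R A \<iota> T))
           (induced_End R A \<iota> T)"
proof -
  obtain E I and a b :: "'a \<Rightarrow> 'a" where "frobenius_system R A \<iota> E I a b"
    by (rule frobenius_extensionE[OF assms(3)])
  then interpret frobenius_system R A \<iota> E I a b .
  have T: "left_module R T" "finitely_generated R T"
    using assms(4) by (auto simp: additive_generator_def fin_gen_module_def)
  then interpret T: left_module R T by simp
  interpret frobenius_tensor R A \<iota> E I a b T ..
  \<comment> \<open>The generator hypothesis enters here, for \<open>M\<close> regarded as an
    \<open>R\<close>-module.\<close>
  obtain F :: "nat set" and p q where F: "finite F"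
    and p: "\<forall>j\<in>F. p j \<in> lmod_hom R T M\<^sub>R" and q: "\<forall>j\<in>F. q j \<in> lmod_hom R M\<^sub>R T"
    and pq: "\<forall>w\<in>carrier M\<^sub>R. (\<Oplus>\<^bsub>M\<^sub>R\<^esub>j\<in>F. p j (q j w)) = w"
    by (rule additive_generator_decomposition[OF assms(4) MR.left_module_axioms
          finitely_generated_tensor[OF T(2)]])
  show ?thesis
    using frobenius_system_End[OF F p q pq] frobenius_system.frobenius_extensionI by (elim exE)
qed

end
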